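(* Let $d \in \mathbb{N}$ and let $S_{\mathbb{T}^d}$ denote the $d$-parameter Littlewood-Paley square function. Then $$ \sup_{\substack{ \|f\|_{L^p(\mathbb{T}^d)} \le 1 \\ f \in H^p_A(\mathbb{T}^d)}} \| S_{\mathbb{T}^d}(f) \|_{L^p(\mathbb{T}^d)} \sim_d (p-1)^{-d} \quad \text{as } p \to 1^+. $$ That is, there exist $p_0 > 1$ and constants $0 < c \le C < \infty$, depending only on $d$, such that for all $1 < p < p_0$ the supremum above lies between $c(p-1)^{-d}$ and $C(p-1)^{-d}$.
   Context: $\mathbb{N} = \{1,2,\dots\}$, $\mathbb{N}_0 = \mathbb{N}\cup\{0\}$, $\mathbb{T} = \mathbb{R}/\mathbb{Z}$ with Lebesgue measure, and $\widehat{f}(n) = \int_{\mathbb{T}^d} f(x) e^{-i2\pi n\cdot x}\,dx$ for $n \in \mathbb{Z}^d$. Analytic Hardy space: for $1 \le p \le \infty$, $H^p_A(\mathbb{T}^d)$ is the space of functions in $L^p(\mathbb{T}^d)$ that are boundary values of functions in the Hardy space $H^p$ of holomorphic functions on the polydisc $\mathbb{D}^d$; equivalently, $H^p_A(\mathbb{T}^d) = \{ f \in L^p(\mathbb{T}^d) : \operatorname{supp}(\widehat{f}) \subset \mathbb{N}_0^d \}$. Littlewood-Paley projections on $\mathbb{T}$: for $k \in \mathbb{N}$, $$\Delta_k(f)(x) = \sum_{n=2^{k-1}}^{2^k-1} \widehat{f}(n) e^{i2\pi nx}, \qquad \Delta_{-k}(f)(x) = \sum_{n=-2^k+1}^{-2^{k-1}}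 \widehat{f}(n) e^{i2\pi nx},$$ and $\Delta_0(f)(x) = \widehat{f}(0)$. For $k_1,\dots,k_d \in \mathbb{Z}$, $\Delta_{k_1,\dots,k_d} = \Delta_{k_1}\otimes\cdots\otimes\Delta_{k_d}$, where $\Delta_{k_j}$ acts on the $j$-th variable. The $d$-parameter Littlewood-Paley square function is $$ S_{\mathbb{T}^d}(f)(x) = \Big( \sum_{k_1,\dots,k_d\in\mathbb{Z}} |\Delta_{k_1,\dots,k_d}(f)(x)|^2 \Big)^{1/2}. $$ *)

theory Defs
  imports "HOL-Analysis.Analysis"
begin

text \<open>
  The circle is modelled by the fundamental domain \<open>[0,1)\<close> with Lebesgue measure on its Borel sets;
  a point of the \<open>d\<close>-torus is an extensional function on \<open>{..<d}\<close>, so coordinates are numbered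
  \<open>0, ..., d - 1\<close>. Frequencies in \<open>\<int>\<^sup>d\<close> are likewise extensional functions on \<open>{..<d}\<close>.
\<close>

definition circle :: "real measure" where
  "circle = restrict_space lborel {0..<1}"

definition torus :: "nat \<Rightarrow> (nat \<Rightarrow> real) measure" where
  "torus d = (\<Pi>\<^sub>M j\<in>{..<d}. circle)"

definition freqs :: "nat \<Rightarrow> (nat \<Rightarrow> int) set" where
  "freqs d = ({..<d} \<rightarrow>\<^sub>E UNIV)"


text \<open>
  Norms and square functions take values in \<open>[0, \<infinity>]\<close>. The power below is only used with
  exponent \<open>a > 0\<close>, where \<open>\<infinity>\<^sup>a = \<infinity>\<close> and \<open>0\<^sup>a = 0\<close>.
\<close>

definition epowr :: "ennreal \<Rightarrow> real \<Rightarrow> ennreal" where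
  "epowr x a = (if x = top then top else ennreal (enn2real x powr a))"

definition Lp_norm :: "'a measure \<Rightarrow> real \<Rightarrow> ('a \<Rightarrow> ennreal) \<Rightarrow> ennreal" where
  "Lp_norm M p g = epowr (\<integral>\<^sup>+ x. epowr (g x) p \<partial>M) (1 / p)"

abbreviation cLp_norm :: "'a measure \<Rightarrow> real \<Rightarrow> ('a \<Rightarrow> complex) \<Rightarrow> ennreal" where
  "cLp_norm M p f \<equiv> Lp_norm M p (\<lambda>x. ennreal (cmod (f x)))"

definition Lp_space :: "'a measure \<Rightarrow> real \<Rightarrow> ('a \<Rightarrow> complex) set" where
  "Lp_space M p = {f \<in> borel_measurable M. cLp_norm M p f < top}"


definition fourier_coeff :: "nat \<Rightarrow> ((nat \<Rightarrow> real) \<Rightarrow> complex) \<Rightarrow> (nat \<Rightarrow> int) \<Rightarrow> complex" where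
  "fourier_coeff d f n =
     (\<integral>x. f x * exp (- (\<i> * of_real (2 * pi * (\<Sum>j<d. of_int (n j) * x j)))) \<partial>torus d)"

definition fourier_support :: "nat \<Rightarrow> ((nat \<Rightarrow> real) \<Rightarrow> complex) \<Rightarrow> (nat \<Rightarrow> int) set" where
  "fourier_support d f = {n \<in> freqs d. fourier_coeff d f n \<noteq> 0}"

definition analytic_Hardy :: "nat \<Rightarrow> real \<Rightarrow> ((nat \<Rightarrow> real) \<Rightarrow> complex) set" where
  "analytic_Hardy d p =
     {f \<in> Lp_space (torus d) p. fourier_support d f \<subseteq> {n. \<forall>j<d. 0 \<le> n j}}"


definition circle_fourier_coeff :: "(real \<Rightarrow> complex) \<Rightarrow> int \<Rightarrow> complex" where
  "circle_fourier_coeff g n = (\<integral>t. g t * exp (- (\<i> * of_real (2 * pi * of_int n * t))) \<partial>circle)"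

definition dyadic_block :: "int \<Rightarrow> int set" where
  "dyadic_block k =
     (if k > 0 then {2 ^ (nat k - 1) .. 2 ^ nat k - 1}
      else if k < 0 then {- (2 ^ nat (- k)) + 1 .. - (2 ^ (nat (- k) - 1))}
      else {0})"

definition LP_proj :: "int \<Rightarrow> (real \<Rightarrow> complex) \<Rightarrow> real \<Rightarrow> complex" where
  "LP_proj k g x =
     (\<Sum>n\<in>dyadic_block k. circle_fourier_coeff g n * exp (\<i> * of_real (2 * pi * of_int n * x)))"

definition LP_proj_var ::
    "nat \<Rightarrow> int \<Rightarrow> ((nat \<Rightarrow> real) \<Rightarrow> complex) \<Rightarrow> (nat \<Rightarrow> real) \<Rightarrow> complex" where
  "LP_proj_var j k f x = LP_proj k (\<lambda>t. f (x(j := t))) (x j)"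

text \<open>
  The tensor product of the projections \<open>LP_proj (k j)\<close> for \<open>j < d\<close>: each acts on its own variable,
  one after the other. For integrable \<open>f\<close> almost every slice is integrable, and on
  almost-everywhere classes the factors commute, so the order of composition is irrelevant.
\<close>

primrec LP_proj_tensor ::
    "nat \<Rightarrow> (nat \<Rightarrow> int) \<Rightarrow> ((nat \<Rightarrow> real) \<Rightarrow> complex) \<Rightarrow> (nat \<Rightarrow> real) \<Rightarrow> complex" where
  "LP_proj_tensor 0 k f = f"
| "LP_proj_tensor (Suc d) k f = LP_proj_var d (k d) (LP_proj_tensor d k f)"

definition LP_square :: "nat \<Rightarrow> ((nat \<Rightarrow> real) \<Rightarrow> complex) \<Rightarrow> (nat \<Rightarrow> real) \<Rightarrow> ennreal" where
  "LP_square d f x =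
     epowr (\<Sum>\<^sub>\<infinity>k\<in>freqs d. ennreal ((cmod (LP_proj_tensor d k f x))\<^sup>2)) (1 / 2)"

end

theory Submission
  imports Defs "HOL-Probability.Probability"
begin

text \<open>
  Upper bound. In one variable the inequality is proved for finite families of analytic polynomials
  with the Euclidean norm on the family; in this vector-valued form it iterates over the variables by
  Fubini, each variable costing one factor \<open>C / (p - 1)\<close>. Fejer means and Fatou's lemma then give it for
  all functions in the Hardy space.

  In one variable put \<open>z = exp (s + i y)\<close>. Comparing Laplacians of powers \<open>(|h|\<^sup>2 + e) powr (p/2)\<close> of
  harmonic families gives M. Riesz' theorem with constant \<open>2 / (p - 1)\<close>, and, for analytic families,
  a Hardy-Stein estimate that does not degenerate as \<open>p\<close> tends to 1. Since \<open>|f| powr (p/2)\<close> is subharmonic,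
  it is dominated by its Poisson integral, so its maximal function is controlled in the square mean.
  Together these bound the smooth square function with pieces \<open>t\<^sub>k f'(-t\<^sub>k + i y)\<close>, \<open>t\<^sub>k ~ 2^(-k)\<close>, uniformly
  in \<open>p\<close>. Abel summation writes the sharp dyadic block of \<open>f\<close> as an average of frequency tails of the
  smooth piece, so that a single use of Riesz' theorem suffices.

  Lower bound. Take the tensor power of a Fejer kernel of degree \<open>2^N\<close> shifted by the frequency \<open>2^N\<close>,
  with \<open>N ~ 1 / (p - 1)\<close>: its \<open>L\<^sup>p\<close> norm stays bounded, while a single dyadic block cuts the kernel in
  half, and pairing with the sawtooth \<open>t - 1/2\<close> shows that the half has \<open>L\<^sup>1\<close> norm of order \<open>N\<close>.
\<close>

section \<open>Powers of square norms in logarithmic coordinates\<close>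

text \<open>The obstacle is the exponent: each variable may cost only one power of
  \<open>1 / (p - 1)\<close>. For a general harmonic family the Laplacian of the regularised power
  keeps a fraction of the energy of order \<open>p - 1\<close> only, so the smooth square function
  would already be paid for before any block is cut out. For an analytic family the Cauchy-Riemann
  equations halve the gradient term and the fraction stays bounded below; only the sharp cuts remain
  to be paid for.

  These cuts occur at many frequencies \<open>j\<close>. Multiplying a component by
  \<open>exp (- i j y)\<close> moves its cut to frequency 0 and leaves its modulus alone. Components
  that are modulated differently thus form one vector with the same Euclidean norm, and one
  vector-valued Riesz inequality makes all cuts together. The same freedom of the index set lets the
  family carry the blocks of the variables already treated.

  The maximal inequality enters at exponent 2 alone, applied to \<open>|f| powr (p/2)\<close>, hence
  with a constant free of \<open>p\<close>. That so small a power of the norm is subharmonic is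
  again due to analyticity.\<close>

text \<open>Analytic polynomials are written in the logarithm \<open>s + i y\<close> of the disc variable: the disc is
  \<open>s < 0\<close>, the circle is \<open>s = 0\<close>, and \<open>y\<close> has period \<open>2 * pi\<close>.\<close>

definition apoly :: "(nat \<Rightarrow> complex) \<Rightarrow> nat \<Rightarrow> complex \<Rightarrow> complex" where
  "apoly a N z = (\<Sum>n\<le>N. a n * exp (of_nat n * z))"

text \<open>Coefficients of the derivative along the direction \<open>c\<close>. In logarithmic
  coordinates differentiation only multiplies the coefficient of index \<open>n\<close> by
  \<open>n\<close>, so all derivatives stay of the form \<open>apoly\<close>.\<close>

definition dcoef :: "complex \<Rightarrow> (nat \<Rightarrow> complex) \<Rightarrow> nat \<Rightarrow> complex" where
  "dcoef c a = (\<lambda>n. c * (of_nat n * a n))"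

definition spt :: "real \<Rightarrow> real \<Rightarrow> complex" where
  "spt s y = of_real s + \<i> * of_real y"

definition hpoly :: "(nat \<Rightarrow> complex) \<Rightarrow> (nat \<Rightarrow> complex) \<Rightarrow> nat \<Rightarrow> complex \<Rightarrow> complex" where
  "hpoly a b N z = apoly a N z + cnj (apoly b N z)"

lemma apoly_dcoef: "apoly (dcoef c a) N z = c * apoly (dcoef 1 a) N z"
  by (simp add: apoly_def dcoef_def sum_distrib_left mult_ac)

lemma apoly_dd2: "apoly (dcoef c (dcoef c a)) N z = c^2 * apoly (dcoef 1 (dcoef 1 a)) N z"
  by (simp add: apoly_def dcoef_def sum_distrib_left mult_ac power2_eq_square)

lemma apoly_period: "apoly a N (spt s (y + 2 * pi)) = apoly a N (spt s y)"
proof -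
  have "exp (of_nat n * spt s (y + 2 * pi)) = exp (of_nat n * spt s y)" for n
  proof -
    have "of_nat n * spt s (y + 2 * pi) = of_nat n * spt s y + of_real (2 * of_int (int n) * pi) * \<i>"
      by (simp add: spt_def algebra_simps)
    then show ?thesis
      by (simp only: exp_add) (metis exp_integer_2pi Ints_of_int mult.commute mult.right_neutral mult.left_commute of_real_mult of_real_numeral of_real_of_int_eq)
  qed
  then show ?thesis by (simp add: apoly_def)
qed

lemma apoly_has_field_derivative: "(apoly a N has_field_derivative apoly (dcoef 1 a) N z) (at z)"
  unfolding apoly_def dcoef_def by (auto intro!: derivative_eq_intros sum.cong)

lemma apoly_line:
  "((\<lambda>t. apoly a N (z + c * of_real t)) has_vector_derivative apoly (dcoef c a) N (z + c * of_real t)) (at t)"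
proof -
  have "((\<lambda>t. z + c * of_real t) has_vector_derivative c) (at t)"
    by (auto intro!: derivative_eq_intros)
  from field_vector_diff_chain_at[OF this apoly_has_field_derivative]
  show ?thesis by (simp add: o_def apoly_dcoef[of c])
qed

lemma hpoly_line:
  "((\<lambda>t. hpoly a b N (z + c * of_real t)) has_vector_derivative hpoly (dcoef c a) (dcoef c b) N (z + c * of_real t)) (at t)"
  unfolding hpoly_def
  by (intro has_vector_derivative_add apoly_line bounded_linear.has_vector_derivative[OF bounded_linear_cnj])

lemma cmod_sum_line:
  fixes h h1 h2 :: "'i \<Rightarrow> real \<Rightarrow> complex"
  assumes d1: "\<And>i. i \<in> I \<Longrightarrow> (h i has_vector_derivative h1 i t) (at t)"
    and d2: "\<And>i. i \<in> I \<Longrightarrow> (h1 i has_vector_derivative h2 i t) (at t)"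
  shows "((\<lambda>t. (\<Sum>i\<in>I. (cmod (h i t))\<^sup>2) + e) has_real_derivative
            (\<Sum>i\<in>I. 2 * Re (cnj (h i t) * h1 i t))) (at t)"
    and "((\<lambda>t. \<Sum>i\<in>I. 2 * Re (cnj (h i t) * h1 i t)) has_real_derivative
            (\<Sum>i\<in>I. 2 * ((cmod (h1 i t))\<^sup>2 + Re (cnj (h i t) * h2 i t)))) (at t)"
proof -
  have re: "((\<lambda>t. Re (g t)) has_real_derivative Re g') (at t)"
       "((\<lambda>t. Im (g t)) has_real_derivative Im g') (at t)"
    if "(g has_vector_derivative g') (at t)" for g :: "real \<Rightarrow> complex" and g'
    using bounded_linear.has_vector_derivative[OF bounded_linear_Re that]
      bounded_linear.has_vector_derivative[OF bounded_linear_Im that]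
    by (simp_all add: has_real_derivative_iff_has_vector_derivative)
  show "((\<lambda>t. (\<Sum>i\<in>I. (cmod (h i t))\<^sup>2) + e) has_real_derivative
            (\<Sum>i\<in>I. 2 * Re (cnj (h i t) * h1 i t))) (at t)"
  proof -
    have "((\<lambda>t. (cmod (h i t))\<^sup>2) has_real_derivative 2 * Re (cnj (h i t) * h1 i t)) (at t)" if "i \<in> I" for i
      unfolding cmod_power2 by (rule re[OF d1[OF that]] derivative_eq_intros refl)+ simp
    from DERIV_add[OF DERIV_sum[OF this] DERIV_const] show ?thesis by simp
  qed
  show "((\<lambda>t. \<Sum>i\<in>I. 2 * Re (cnj (h i t) * h1 i t)) has_real_derivative
            (\<Sum>i\<in>I. 2 * ((cmod (h1 i t))\<^sup>2 + Re (cnj (h i t) * h2 i t)))) (at t)"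
  proof (rule DERIV_sum)
    fix i assume i: "i \<in> I"
    have eq: "(\<lambda>t. 2 * Re (cnj (h i t) * h1 i t)) = (\<lambda>t. 2 * (Re (h i t) * Re (h1 i t) + Im (h i t) * Im (h1 i t)))"
      by auto
    show "((\<lambda>t. 2 * Re (cnj (h i t) * h1 i t)) has_real_derivative
            2 * ((cmod (h1 i t))\<^sup>2 + Re (cnj (h i t) * h2 i t))) (at t)"
      unfolding cmod_power2 eq by (rule re[OF d1[OF i]] re[OF d2[OF i]] derivative_eq_intros refl)+
        (simp add: power2_eq_square algebra_simps)
  qed
qed

lemma powr_line:
  fixes Q Q1 :: "real \<Rightarrow> real"
  assumes "(Q has_real_derivative Q1 t) (at t)" "(Q1 has_real_derivative Q2) (at t)" "Q t > 0"
  shows "((\<lambda>t. Q t powr al) has_real_derivative al * Q t powr (al - 1) * Q1 t) (at t)"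
    and "((\<lambda>t. al * Q t powr (al - 1) * Q1 t) has_real_derivative
          al * Q t powr (al - 1) * Q2 + al * (al - 1) * Q t powr (al - 2) * (Q1 t)\<^sup>2) (at t)"
proof -
  have *: "((\<lambda>t. Q t powr al) has_real_derivative al * Q t powr (al - 1) * Q1 t) (at t)" for al
    using assms(1,3) by (auto intro!: derivative_eq_intros simp: powr_diff field_simps)
  show "((\<lambda>t. Q t powr al) has_real_derivative al * Q t powr (al - 1) * Q1 t) (at t)" by fact
  have "((\<lambda>t. al * Q t powr (al - 1) * Q1 t) has_real_derivative
     al * (Q t powr (al - 1) * Q2 + ((al - 1) * Q t powr (al - 1 - 1) * Q1 t) * Q1 t)) (at t)"
    using assms by (auto intro!: derivative_eq_intros * simp: algebra_simps)
  then show "((\<lambda>t. al * Q t powr (al - 1) * Q1 t) has_real_derivative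
          al * Q t powr (al - 1) * Q2 + al * (al - 1) * Q t powr (al - 2) * (Q1 t)\<^sup>2) (at t)"
    by (simp add: algebra_simps power2_eq_square)
qed

text \<open>The derivatives are arguments, so that hypotheses can speak of the Laplacian
  \<open>Vss + Vyy\<close> of any function with explicit derivatives. The period of
  \<open>Vy\<close> is what makes the integral of \<open>Vyy\<close> over a period vanish.\<close>

definition strip_C2 :: "(real \<Rightarrow> real \<Rightarrow> real) \<Rightarrow> (real \<Rightarrow> real \<Rightarrow> real) \<Rightarrow> (real \<Rightarrow> real \<Rightarrow> real)
    \<Rightarrow> (real \<Rightarrow> real \<Rightarrow> real) \<Rightarrow> (real \<Rightarrow> real \<Rightarrow> real) \<Rightarrow> bool" where
  "strip_C2 V Vs Vss Vy Vyy \<longleftrightarrow>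
     (\<forall>s y. ((\<lambda>s. V s y) has_real_derivative Vs s y) (at s)) \<and>
     (\<forall>s y. ((\<lambda>s. Vs s y) has_real_derivative Vss s y) (at s)) \<and>
     (\<forall>s y. ((\<lambda>y. V s y) has_real_derivative Vy s y) (at y)) \<and>
     (\<forall>s y. ((\<lambda>y. Vy s y) has_real_derivative Vyy s y) (at y)) \<and>
     continuous_on UNIV (\<lambda>q. V (fst q) (snd q)) \<and>
     continuous_on UNIV (\<lambda>q. Vs (fst q) (snd q)) \<and>
     continuous_on UNIV (\<lambda>q. Vss (fst q) (snd q)) \<and>
     continuous_on UNIV (\<lambda>q. Vyy (fst q) (snd q)) \<and>
     (\<forall>s y. V s (y + 2 * pi) = V s y) \<and> (\<forall>s y. Vy s (y + 2 * pi) = Vy s y)"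

lemma strip_C2_lincomb:
  assumes "strip_C2 V Vs Vss Vy Vyy" "strip_C2 W Ws Wss Wy Wyy"
  shows "strip_C2 (\<lambda>s y. c * V s y + d * W s y) (\<lambda>s y. c * Vs s y + d * Ws s y)
     (\<lambda>s y. c * Vss s y + d * Wss s y) (\<lambda>s y. c * Vy s y + d * Wy s y) (\<lambda>s y. c * Vyy s y + d * Wyy s y)"
  using assms unfolding strip_C2_def
  by (intro conjI allI) (auto intro!: derivative_intros continuous_intros DERIV_cmult)

lemma continuous_on_apoly [continuous_intros]:
  "continuous_on S f \<Longrightarrow> continuous_on S (\<lambda>x. apoly a N (f x))"
  unfolding apoly_def by (intro continuous_intros)

lemma continuous_on_hpoly [continuous_intros]:
  "continuous_on S f \<Longrightarrow> continuous_on S (\<lambda>x. hpoly a b N (f x))"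
  unfolding hpoly_def by (intro continuous_intros)

lemma continuous_on_spt [continuous_intros]:
  "continuous_on S f \<Longrightarrow> continuous_on S g \<Longrightarrow> continuous_on S (\<lambda>x. spt (f x) (g x))"
  unfolding spt_def by (intro continuous_intros)

lemma hpoly_period: "hpoly a b N (spt s (y + 2 * pi)) = hpoly a b N (spt s y)"
  by (simp add: hpoly_def apoly_period)

text \<open>The summand \<open>e > 0\<close> keeps the powers smooth at common zeros. The direction \<open>c\<close> below is 1 for
  derivatives in \<open>s\<close> and \<open>\<i>\<close> for derivatives in \<open>y\<close>.\<close>

definition reg_sq :: "'i set \<Rightarrow> ('i \<Rightarrow> nat \<Rightarrow> complex) \<Rightarrow> ('i \<Rightarrow> nat \<Rightarrow> complex) \<Rightarrow> nat \<Rightarrow> real \<Rightarrow> complex \<Rightarrow> real" where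
  "reg_sq I a b N e z = (\<Sum>i\<in>I. (cmod (hpoly (a i) (b i) N z))\<^sup>2) + e"

definition reg_sq_d1 :: "complex \<Rightarrow> 'i set \<Rightarrow> ('i \<Rightarrow> nat \<Rightarrow> complex) \<Rightarrow> ('i \<Rightarrow> nat \<Rightarrow> complex) \<Rightarrow> nat \<Rightarrow> complex \<Rightarrow> real" where
  "reg_sq_d1 c I a b N z = (\<Sum>i\<in>I. 2 * Re (cnj (hpoly (a i) (b i) N z) * hpoly (dcoef c (a i)) (dcoef c (b i)) N z))"

definition reg_sq_d2 :: "complex \<Rightarrow> 'i set \<Rightarrow> ('i \<Rightarrow> nat \<Rightarrow> complex) \<Rightarrow> ('i \<Rightarrow> nat \<Rightarrow> complex) \<Rightarrow> nat \<Rightarrow> complex \<Rightarrow> real" where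
  "reg_sq_d2 c I a b N z = (\<Sum>i\<in>I. 2 * ((cmod (hpoly (dcoef c (a i)) (dcoef c (b i)) N z))\<^sup>2
      + Re (cnj (hpoly (a i) (b i) N z) * hpoly (dcoef c (dcoef c (a i))) (dcoef c (dcoef c (b i))) N z)))"

text \<open>Half of the squared gradient of the family: for \<open>h = w + cnj z\<close> the cross
  terms of the two partial derivatives cancel.\<close>

definition energy :: "'i set \<Rightarrow> ('i \<Rightarrow> nat \<Rightarrow> complex) \<Rightarrow> ('i \<Rightarrow> nat \<Rightarrow> complex) \<Rightarrow> nat \<Rightarrow> complex \<Rightarrow> real" where
  "energy I a b N z = (\<Sum>i\<in>I. (cmod (apoly (dcoef 1 (a i)) N z))\<^sup>2 + (cmod (apoly (dcoef 1 (b i)) N z))\<^sup>2)"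

lemma reg_sq_pos: "e > 0 \<Longrightarrow> reg_sq I a b N e z > 0"
  unfolding reg_sq_def by (intro add_nonneg_pos sum_nonneg) auto

lemma reg_sq_nz: "e > 0 \<Longrightarrow> reg_sq I a b N e z \<noteq> 0"
  using reg_sq_pos[of e I a b N z] by auto

lemma reg_sq_line:
  "((\<lambda>t. reg_sq I a b N e (z + c * of_real t)) has_real_derivative reg_sq_d1 c I a b N (z + c * of_real t)) (at t)"
  "((\<lambda>t. reg_sq_d1 c I a b N (z + c * of_real t)) has_real_derivative reg_sq_d2 c I a b N (z + c * of_real t)) (at t)"
  unfolding reg_sq_def reg_sq_d1_def reg_sq_d2_def
  by (rule cmod_sum_line, rule hpoly_line, rule hpoly_line)+

definition reg_pow_d1 where
  "reg_pow_d1 c al I a b N e z = al * reg_sq I a b N e z powr (al - 1) * reg_sq_d1 c I a b N z"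
definition reg_pow_d2 where
  "reg_pow_d2 c al I a b N e z = al * reg_sq I a b N e z powr (al - 1) * reg_sq_d2 c I a b N z
      + al * (al - 1) * reg_sq I a b N e z powr (al - 2) * (reg_sq_d1 c I a b N z)\<^sup>2"

lemma reg_pow_line:
  assumes "e > 0"
  shows "((\<lambda>t. reg_sq I a b N e (z + c * of_real t) powr al) has_real_derivative
            reg_pow_d1 c al I a b N e (z + c * of_real t)) (at t)"
    and "((\<lambda>t. reg_pow_d1 c al I a b N e (z + c * of_real t)) has_real_derivative
            reg_pow_d2 c al I a b N e (z + c * of_real t)) (at t)"
  unfolding reg_pow_d1_def reg_pow_d2_def
  by (rule powr_line[OF reg_sq_line reg_sq_pos[OF assms]])+

lemma continuous_on_reg_sq [continuous_intros]:
  "continuous_on S f \<Longrightarrow> continuous_on S (\<lambda>x. reg_sq I a b N e (f x))"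
  "continuous_on S f \<Longrightarrow> continuous_on S (\<lambda>x. reg_sq_d1 c I a b N (f x))"
  "continuous_on S f \<Longrightarrow> continuous_on S (\<lambda>x. reg_sq_d2 c I a b N (f x))"
  unfolding reg_sq_def reg_sq_d1_def reg_sq_d2_def by (intro continuous_intros; simp)+

lemma continuous_on_reg_sq_powr [continuous_intros]:
  assumes "e > 0" "continuous_on S f"
  shows "continuous_on S (\<lambda>x. reg_sq I a b N e (f x) powr al)"
  using assms by (intro continuous_on_powr continuous_intros) (auto simp: reg_sq_nz)

lemma continuous_on_reg_pow [continuous_intros]:
  assumes "e > 0" "continuous_on S f"
  shows "continuous_on S (\<lambda>x. reg_pow_d1 c al I a b N e (f x))"
    "continuous_on S (\<lambda>x. reg_pow_d2 c al I a b N e (f x))"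
  unfolding reg_pow_d1_def reg_pow_d2_def using assms by (intro continuous_intros; simp)+

lemma strip_C2_reg_pow:
  assumes "e > 0"
  shows "strip_C2 (\<lambda>s y. reg_sq I a b N e (spt s y) powr al)
     (\<lambda>s y. reg_pow_d1 1 al I a b N e (spt s y)) (\<lambda>s y. reg_pow_d2 1 al I a b N e (spt s y))
     (\<lambda>s y. reg_pow_d1 \<i> al I a b N e (spt s y)) (\<lambda>s y. reg_pow_d2 \<i> al I a b N e (spt s y))"
proof -
  have p1: "spt s y = \<i> * of_real y + 1 * of_real s" and p2: "spt s y = of_real s + \<i> * of_real y" for s y
    by (simp_all add: spt_def)
  show ?thesis
    unfolding strip_C2_def
  proof (intro conjI allI)
    fix s y :: real
    show "((\<lambda>s. reg_sq I a b N e (spt s y) powr al) has_real_derivative reg_pow_d1 1 al I a b N e (spt s y)) (at s)"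
      unfolding p1 by (rule reg_pow_line[OF assms])
    show "((\<lambda>s. reg_pow_d1 1 al I a b N e (spt s y)) has_real_derivative reg_pow_d2 1 al I a b N e (spt s y)) (at s)"
      unfolding p1 by (rule reg_pow_line[OF assms])
    show "((\<lambda>y. reg_sq I a b N e (spt s y) powr al) has_real_derivative reg_pow_d1 \<i> al I a b N e (spt s y)) (at y)"
      unfolding p2 by (rule reg_pow_line[OF assms])
    show "((\<lambda>y. reg_pow_d1 \<i> al I a b N e (spt s y)) has_real_derivative reg_pow_d2 \<i> al I a b N e (spt s y)) (at y)"
      unfolding p2 by (rule reg_pow_line[OF assms])
      show "reg_sq I a b N e (spt s (y + 2 * pi)) powr al = reg_sq I a b N e (spt s y) powr al"
      "reg_pow_d1 \<i> al I a b N e (spt s (y + 2 * pi)) = reg_pow_d1 \<i> al I a b N e (spt s y)"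
      by (simp_all add: reg_sq_def reg_pow_d1_def reg_sq_d1_def hpoly_period)
  qed (intro continuous_intros assms)+
qed

text \<open>Every member of the family is harmonic, so the terms containing second derivatives
  cancel and the squared gradient remains.\<close>

lemma reg_sq_d2_laplacian: "reg_sq_d2 1 I a b N z + reg_sq_d2 \<i> I a b N z = 4 * energy I a b N z"
proof -
  have hyy: "hpoly (dcoef \<i> (dcoef \<i> u)) (dcoef \<i> (dcoef \<i> v)) N z = - hpoly (dcoef 1 (dcoef 1 u)) (dcoef 1 (dcoef 1 v)) N z" for u v
    unfolding hpoly_def apoly_dd2[of \<i>] by simp
  have par: "(cmod (hpoly (dcoef 1 u) (dcoef 1 v) N z))\<^sup>2 + (cmod (hpoly (dcoef \<i> u) (dcoef \<i> v) N z))\<^sup>2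
     = 2 * ((cmod (apoly (dcoef 1 u) N z))\<^sup>2 + (cmod (apoly (dcoef 1 v) N z))\<^sup>2)" for u v
    unfolding hpoly_def apoly_dcoef[of \<i>] cmod_power2 by (simp add: algebra_simps power2_eq_square)
  show ?thesis
    unfolding reg_sq_d2_def energy_def sum.distrib[symmetric] sum_distrib_left hyy
  proof (rule sum.cong[OF refl])
    fix i
    show "2 * ((cmod (hpoly (dcoef 1 (a i)) (dcoef 1 (b i)) N z))\<^sup>2 +
            Re (cnj (hpoly (a i) (b i) N z) * hpoly (dcoef 1 (dcoef 1 (a i))) (dcoef 1 (dcoef 1 (b i))) N z)) +
        2 * ((cmod (hpoly (dcoef \<i> (a i)) (dcoef \<i> (b i)) N z))\<^sup>2 +
            Re (cnj (hpoly (a i) (b i) N z) * - hpoly (dcoef 1 (dcoef 1 (a i))) (dcoef 1 (dcoef 1 (b i))) N z)) =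
        4 * ((cmod (apoly (dcoef 1 (a i)) N z))\<^sup>2 + (cmod (apoly (dcoef 1 (b i)) N z))\<^sup>2)"
      using par[of "a i" "b i"] by (simp add: algebra_simps)
  qed
qed

text \<open>Cauchy-Schwarz is used in each of the two directions separately, followed by the
  parallelogram law for \<open>w'\<close> and \<open>cnj z'\<close>.\<close>

lemma reg_sq_d1_square_le:
  assumes "e > 0"
  shows "(reg_sq_d1 1 I a b N z)\<^sup>2 + (reg_sq_d1 \<i> I a b N z)\<^sup>2 \<le> 8 * reg_sq I a b N e z * energy I a b N z"
proof -
  have par: "(cmod (hpoly (dcoef 1 u) (dcoef 1 v) N z))\<^sup>2 + (cmod (hpoly (dcoef \<i> u) (dcoef \<i> v) N z))\<^sup>2
     = 2 * ((cmod (apoly (dcoef 1 u) N z))\<^sup>2 + (cmod (apoly (dcoef 1 v) N z))\<^sup>2)" for u v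
    unfolding hpoly_def apoly_dcoef[of \<i>] cmod_power2 by (simp add: algebra_simps power2_eq_square)
  have one: "(reg_sq_d1 c I a b N z)\<^sup>2 \<le> 4 * (reg_sq I a b N e z * (\<Sum>i\<in>I. (cmod (hpoly (dcoef c (a i)) (dcoef c (b i)) N z))\<^sup>2))" for c
  proof -
    have "\<bar>reg_sq_d1 c I a b N z\<bar> \<le> (\<Sum>i\<in>I. 2 * (cmod (hpoly (a i) (b i) N z) * cmod (hpoly (dcoef c (a i)) (dcoef c (b i)) N z)))"
      unfolding reg_sq_d1_def
      proof (rule order_trans[OF sum_abs], rule sum_mono)
        fix i
        have "\<bar>Re (cnj (hpoly (a i) (b i) N z) * hpoly (dcoef c (a i)) (dcoef c (b i)) N z)\<bar> \<le> cmod (hpoly (a i) (b i) N z) * cmod (hpoly (dcoef c (a i)) (dcoef c (b i)) N z)"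
          using abs_Re_le_cmod[of "cnj (hpoly (a i) (b i) N z) * hpoly (dcoef c (a i)) (dcoef c (b i)) N z"]
          by (simp only: norm_mult complex_mod_cnj)
        then show "\<bar>2 * Re (cnj (hpoly (a i) (b i) N z) * hpoly (dcoef c (a i)) (dcoef c (b i)) N z)\<bar> \<le> 2 * (cmod (hpoly (a i) (b i) N z) * cmod (hpoly (dcoef c (a i)) (dcoef c (b i)) N z))"
          by (simp only: abs_mult)
      qed
    then have "(reg_sq_d1 c I a b N z)\<^sup>2 \<le> (2 * (\<Sum>i\<in>I. cmod (hpoly (a i) (b i) N z) * cmod (hpoly (dcoef c (a i)) (dcoef c (b i)) N z)))\<^sup>2"
      by (subst abs_le_square_iff[symmetric]) (simp add: sum_distrib_left)
    also have "\<dots> \<le> 4 * ((\<Sum>i\<in>I. (cmod (hpoly (a i) (b i) N z))\<^sup>2) * (\<Sum>i\<in>I. (cmod (hpoly (dcoef c (a i)) (dcoef c (b i)) N z))\<^sup>2))"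
      using Cauchy_Schwarz_ineq_sum[of "\<lambda>i. cmod (hpoly (a i) (b i) N z)" "\<lambda>i. cmod (hpoly (dcoef c (a i)) (dcoef c (b i)) N z)" I]
      by (simp add: power_mult_distrib)
    also have "\<dots> \<le> 4 * (reg_sq I a b N e z * (\<Sum>i\<in>I. (cmod (hpoly (dcoef c (a i)) (dcoef c (b i)) N z))\<^sup>2))"
      using assms unfolding reg_sq_def by (intro mult_left_mono mult_right_mono sum_nonneg) auto
    finally show ?thesis .
  qed
  have "(\<Sum>i\<in>I. (cmod (hpoly (dcoef 1 (a i)) (dcoef 1 (b i)) N z))\<^sup>2) + (\<Sum>i\<in>I. (cmod (hpoly (dcoef \<i> (a i)) (dcoef \<i> (b i)) N z))\<^sup>2)
      = 2 * energy I a b N z"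
    unfolding energy_def sum.distrib[symmetric] sum_distrib_left par ..
  moreover have "(reg_sq_d1 1 I a b N z)\<^sup>2 + (reg_sq_d1 \<i> I a b N z)\<^sup>2 \<le>
     4 * (reg_sq I a b N e z * ((\<Sum>i\<in>I. (cmod (hpoly (dcoef 1 (a i)) (dcoef 1 (b i)) N z))\<^sup>2) + (\<Sum>i\<in>I. (cmod (hpoly (dcoef \<i> (a i)) (dcoef \<i> (b i)) N z))\<^sup>2)))"
    using one[of 1] one[of \<i>] by (simp add: algebra_simps)
  ultimately show ?thesis by simp
qed

text \<open>By the Cauchy-Riemann equations the two directional derivatives are, up to the factor 2
  and a sign, the real and imaginary part of the same sum \<open>S\<close>. A single Cauchy-Schwarz
  for \<open>S\<close> gives 4 where the harmonic case has 8; everything that does not degenerate as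
  \<open>p\<close> tends to 1 rests on this factor.\<close>

lemma reg_sq_d1_square_le_analytic:
  assumes "e > 0"
  shows "(reg_sq_d1 1 I a (\<lambda>_ _. 0) N z)\<^sup>2 + (reg_sq_d1 \<i> I a (\<lambda>_ _. 0) N z)\<^sup>2
     \<le> 4 * reg_sq I a (\<lambda>_ _. 0) N e z * energy I a (\<lambda>_ _. 0) N z"
proof -
  define S where "S = (\<Sum>i\<in>I. cnj (apoly (a i) N z) * apoly (dcoef 1 (a i)) N z)"
  have [simp]: "apoly (dcoef c (\<lambda>_. 0)) N z = 0" "apoly (\<lambda>_. 0) N z = 0" for c by (simp_all add: apoly_def dcoef_def)
  have "reg_sq_d1 1 I a (\<lambda>_ _. 0) N z = 2 * Re S"
    by (simp add: reg_sq_d1_def S_def hpoly_def sum_distrib_left)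
  moreover have "reg_sq_d1 \<i> I a (\<lambda>_ _. 0) N z = - 2 * Im S"
    unfolding reg_sq_d1_def S_def hpoly_def apoly_dcoef[of \<i>] by (simp add: sum_distrib_left sum_negf[symmetric] algebra_simps)
  ultimately have "(reg_sq_d1 1 I a (\<lambda>_ _. 0) N z)\<^sup>2 + (reg_sq_d1 \<i> I a (\<lambda>_ _. 0) N z)\<^sup>2 = 4 * (cmod S)\<^sup>2"
    by (simp add: cmod_power2 power_mult_distrib)
  also have "\<dots> \<le> 4 * ((\<Sum>i\<in>I. cmod (apoly (a i) N z) * cmod (apoly (dcoef 1 (a i)) N z)))\<^sup>2"
    unfolding S_def by (intro mult_left_mono power_mono order_trans[OF norm_sum]) (auto simp: norm_mult intro!: sum_mono)
  also have "\<dots> \<le> 4 * ((\<Sum>i\<in>I. (cmod (apoly (a i) N z))\<^sup>2) * (\<Sum>i\<in>I. (cmod (apoly (dcoef 1 (a i)) N z))\<^sup>2))"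
    by (intro mult_left_mono Cauchy_Schwarz_ineq_sum) auto
  also have "\<dots> \<le> 4 * (reg_sq I a (\<lambda>_ _. 0) N e z * (\<Sum>i\<in>I. (cmod (apoly (dcoef 1 (a i)) N z))\<^sup>2))"
    using assms unfolding reg_sq_def hpoly_def by (intro mult_left_mono mult_right_mono sum_nonneg) auto
  finally show ?thesis by (simp add: energy_def)
qed

lemma energy_nonneg: "energy I a b N z \<ge> 0"
  unfolding energy_def by (intro sum_nonneg) auto

lemma reg_pow_d2_sum: 
  assumes "e > 0"
  shows "reg_pow_d2 1 al I a b N e z + reg_pow_d2 \<i> al I a b N e z = al * reg_sq I a b N e z powr (al - 1) *
    (4 * energy I a b N z + (al - 1) * (((reg_sq_d1 1 I a b N z)\<^sup>2 + (reg_sq_d1 \<i> I a b N z)\<^sup>2) / reg_sq I a b N e z))"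
proof -
  have "reg_sq I a b N e z powr (al - 2) = reg_sq I a b N e z powr (al - 1) / reg_sq I a b N e z"
    using reg_sq_pos[OF assms, of I a b N z] powr_diff[of "reg_sq I a b N e z" "al - 1" 1] by simp
  then show ?thesis unfolding reg_pow_d2_def reg_sq_d2_laplacian[symmetric] by (simp add: algebra_simps add_divide_distrib)
qed

text \<open>The gradient term has the negative factor \<open>al - 1\<close>; with the bound 8 there
  remains \<open>4 + 8 * (al - 1) = 4 * (2 * al - 1)\<close>. For \<open>al = p / 2\<close> this is
  \<open>4 * (p - 1)\<close>, the origin of every power of \<open>1 / (p - 1)\<close> in the upper
  bound.\<close>

lemma laplacian_ge:
  assumes "e > 0" "0 < al" "al \<le> 1"
  shows "reg_pow_d2 1 al I a b N e z + reg_pow_d2 \<i> al I a b N e z \<ge> 4 * al * (2 * al - 1) * reg_sq I a b N e z powr (al - 1) * energy I a b N z"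
proof -
  have "((reg_sq_d1 1 I a b N z)\<^sup>2 + (reg_sq_d1 \<i> I a b N z)\<^sup>2) / reg_sq I a b N e z \<le> 8 * energy I a b N z"
    using reg_sq_d1_square_le[OF assms(1), of I a b N z] reg_sq_pos[OF assms(1), of I a b N z] by (simp add: divide_le_eq mult_ac)
  then have "(al - 1) * (8 * energy I a b N z) \<le> (al - 1) * (((reg_sq_d1 1 I a b N z)\<^sup>2 + (reg_sq_d1 \<i> I a b N z)\<^sup>2) / reg_sq I a b N e z)"
    using assms by (intro mult_left_mono_neg) auto
  then have "4 * energy I a b N z + (al - 1) * (8 * energy I a b N z) \<le> 4 * energy I a b N z + (al - 1) * (((reg_sq_d1 1 I a b N z)\<^sup>2 + (reg_sq_d1 \<i> I a b N z)\<^sup>2) / reg_sq I a b N e z)"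
    by simp
  from mult_left_mono[OF this, of "al * reg_sq I a b N e z powr (al - 1)"] show ?thesis
    unfolding reg_pow_d2_sum[OF assms(1)] using assms by (simp add: algebra_simps)
qed

text \<open>Here \<open>4 + 4 * (al - 1) = 4 * al\<close> remains, which does not vanish as
  \<open>al\<close> tends to \<open>1/2\<close>. It is positive for every \<open>al > 0\<close>, so
  all powers in this range are subharmonic.\<close>

lemma laplacian_ge_analytic:
  assumes "e > 0" "0 < al" "al \<le> 1"
  shows "reg_pow_d2 1 al I a (\<lambda>_ _. 0) N e z + reg_pow_d2 \<i> al I a (\<lambda>_ _. 0) N e z
     \<ge> 4 * al\<^sup>2 * reg_sq I a (\<lambda>_ _. 0) N e z powr (al - 1) * energy I a (\<lambda>_ _. 0) N z"
proof -
  let ?b = "(\<lambda>_ _. 0) :: 'a \<Rightarrow> nat \<Rightarrow> complex"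
  have "((reg_sq_d1 1 I a ?b N z)\<^sup>2 + (reg_sq_d1 \<i> I a ?b N z)\<^sup>2) / reg_sq I a ?b N e z \<le> 4 * energy I a ?b N z"
    using reg_sq_d1_square_le_analytic[OF assms(1), of I a N z] reg_sq_pos[OF assms(1), of I a ?b N z] by (simp add: divide_le_eq mult_ac)
  then have "(al - 1) * (4 * energy I a ?b N z) \<le> (al - 1) * (((reg_sq_d1 1 I a ?b N z)\<^sup>2 + (reg_sq_d1 \<i> I a ?b N z)\<^sup>2) / reg_sq I a ?b N e z)"
    using assms by (intro mult_left_mono_neg) auto
  then have "4 * energy I a ?b N z + (al - 1) * (4 * energy I a ?b N z) \<le> 4 * energy I a ?b N z + (al - 1) * (((reg_sq_d1 1 I a ?b N z)\<^sup>2 + (reg_sq_d1 \<i> I a ?b N z)\<^sup>2) / reg_sq I a ?b N e z)"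
    by simp
  from mult_left_mono[OF this, of "al * reg_sq I a ?b N e z powr (al - 1)"] show ?thesis
    unfolding reg_pow_d2_sum[OF assms(1)] using assms by (simp add: algebra_simps power2_eq_square)
qed

lemma laplacian_le:
  assumes "e > 0" "0 < al" "al \<le> 1"
  shows "reg_pow_d2 1 al I a b N e z + reg_pow_d2 \<i> al I a b N e z \<le> 4 * al * reg_sq I a b N e z powr (al - 1) * energy I a b N z"
proof -
  have "(al - 1) * (((reg_sq_d1 1 I a b N z)\<^sup>2 + (reg_sq_d1 \<i> I a b N z)\<^sup>2) / reg_sq I a b N e z) \<le> 0"
    using assms reg_sq_pos[OF assms(1), of I a b N z] by (intro mult_nonpos_nonneg divide_nonneg_pos) auto
  then have "4 * energy I a b N z + (al - 1) * (((reg_sq_d1 1 I a b N z)\<^sup>2 + (reg_sq_d1 \<i> I a b N z)\<^sup>2) / reg_sq I a b N e z) \<le> 4 * energy I a b N z"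
    by simp
  from mult_left_mono[OF this, of "al * reg_sq I a b N e z powr (al - 1)"] show ?thesis
    unfolding reg_pow_d2_sum[OF assms(1)] using assms by (simp add: algebra_simps)
qed

section \<open>Maximum principle and circular means\<close>

lemma second_deriv_nonpos_at_max:
  fixes f f1 :: "real \<Rightarrow> real"
  assumes d1: "\<And>x. (f has_real_derivative f1 x) (at x)"
    and d2: "(f1 has_real_derivative f2) (at t)"
    and max: "r > 0" "\<And>x. \<bar>t - x\<bar> < r \<Longrightarrow> f x \<le> f t"
  shows "f2 \<le> 0"
proof (rule ccontr)
  assume "\<not> f2 \<le> 0"
  have z: "f1 t = 0"
    by (rule DERIV_local_max[OF d1 max(1)]) (use max(2) in auto)
  obtain d where d: "d > 0" "\<And>h. h > 0 \<Longrightarrow> h < d \<Longrightarrow> f1 t < f1 (t + h)"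
    using DERIV_pos_inc_right[OF d2] \<open>\<not> f2 \<le> 0\<close> by force
  define h where "h = min d r / 2"
  have h: "0 < h" "h < d" "h < r" using d max by (auto simp: h_def min_def)
  obtain x where x: "t < x" "x < t + h" "f (t + h) - f t = (t + h - t) * f1 x"
    using MVT2[of t "t + h" f f1] d1 h by auto
  have "f1 x > 0" using d(2)[of "x - t"] x h z by auto
  then have "f (t + h) - f t > 0" using x(3) h by simp
  then have "f (t + h) > f t" by simp
  moreover have "f (t + h) \<le> f t" using max(2)[of "t + h"] h by auto
  ultimately show False by simp
qed

lemma periodic_int:
  fixes g :: "real \<Rightarrow> 'a"
  assumes "\<And>y. g (y + 2 * pi) = g y"
  shows "g (y + 2 * pi * of_int n) = g y"
proof -
  have pos: "g (y + 2 * pi * of_nat m) = g y" for y m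
  proof (induction m)
    case (Suc m)
    have "g (y + 2 * pi * of_nat (Suc m)) = g ((y + 2 * pi * of_nat m) + 2 * pi)"
      by (simp add: algebra_simps)
    then show ?case using assms Suc by simp
  qed simp
  show ?thesis
  proof (cases "n \<ge> 0")
    case True
    then show ?thesis using pos[of y "nat n"] by simp
  next
    case False
    then show ?thesis using pos[of "y + 2 * pi * of_int n" "nat (- n)"] by simp
  qed
qed

text \<open>At minus infinity only boundedness is known. A small multiple of \<open>s\<close> pushes
  the function down there, and a small multiple of \<open>exp s\<close>, whose Laplacian is
  positive, excludes an interior maximum.\<close>

lemma max_principle:
  assumes C2: "strip_C2 V Vs Vss Vy Vyy"
    and lap: "\<And>s y. Vss s y + Vyy s y \<ge> 0"
    and bnd: "\<And>s y. s \<le> 0 \<Longrightarrow> V s y \<le> B"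
    and b0: "\<And>y. V 0 y \<le> 0"
    and s0: "s0 \<le> 0"
  shows "V s0 y0 \<le> 0"
proof -
  have main: "V s0 y0 \<le> \<delta> * (1 - s0)" if "\<delta> > 0" for \<delta>
  proof (rule ccontr)
    assume contra: "\<not> V s0 y0 \<le> \<delta> * (1 - s0)"
    define E where "E s y = V s y + \<delta> * s + \<delta> * exp s" for s y
    have per: "E s (y + 2 * pi) = E s y" for s y
      using C2 by (simp add: E_def strip_C2_def)
    have E0: "E s0 y0 > \<delta>"
      using contra that by (simp add: E_def algebra_simps) (smt (verit) exp_gt_zero mult_pos_pos)
    \<comment> \<open>So far to the left that \<open>\<delta> * S\<close> absorbs \<open>B\<close>;
      hence the maximum over the rectangle cannot lie on its left side.\<close>
    define S where "S = min (s0 - 1) (- \<bar>B\<bar> / \<delta> - 1)"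
    have "\<delta> * S \<le> \<delta> * (- \<bar>B\<bar> / \<delta> - 1)"
      unfolding S_def using that by (intro mult_left_mono) auto
    also have "\<dots> = - \<bar>B\<bar> - \<delta>" using that by (simp add: field_simps)
    finally have dS: "\<delta> * S \<le> - \<bar>B\<bar> - \<delta>" .
    have S: "S < s0" "S < 0" using s0 by (auto simp: S_def)
    have ES: "E S y \<le> \<delta>" for y
    proof -
      have "\<delta> * exp S \<le> \<delta> * 1" using that S by (intro mult_left_mono) auto
      then show ?thesis using bnd[of S y] S dS that unfolding E_def by linarith
    qed
    have Ez: "E 0 y \<le> \<delta>" for y using b0[of y] by (simp add: E_def)
    have contE: "continuous_on ({S..0} \<times> {0..2*pi}) (\<lambda>q. E (fst q) (snd q))"
      unfolding E_def using C2 unfolding strip_C2_def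
      by (intro continuous_intros) (auto intro: continuous_on_subset)
    have "compact ({S..0} \<times> {0..2*pi})" by (intro compact_Times) auto
    moreover have "{S..0} \<times> {0..2*pi} \<noteq> {}" using S by auto
    ultimately obtain q where q: "q \<in> {S..0} \<times> {0..2*pi}"
      "\<And>r. r \<in> {S..0} \<times> {0..2*pi} \<Longrightarrow> E (fst r) (snd r) \<le> E (fst q) (snd q)"
      using continuous_attains_sup[OF _ _ contE] by blast
    define s y where "s = fst q" "y = snd q"
    have max: "E s' y' \<le> E s y" if "S \<le> s'" "s' \<le> 0" for s' y'
    proof -
      define n where "n = \<lfloor>y' / (2 * pi)\<rfloor>"
      have "of_int n \<le> y' / (2 * pi)" "y' / (2 * pi) < of_int n + 1"
        unfolding n_def by linarith+
      then have "y' + 2 * pi * of_int (- n) \<in> {0..2*pi}"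
        by (auto simp: field_simps)
      moreover have "E s' (y' + 2 * pi * of_int (- n)) = E s' y'"
        by (rule periodic_int) (rule per)
      ultimately show ?thesis using q(2)[of "(s', y' + 2 * pi * of_int (- n))"] that
        by (simp add: s_y_def)
    qed
    have "E s y > \<delta>" using max[of s0 y0] S s0 E0 by auto
    then have "s \<noteq> S" "s \<noteq> 0" using ES[of y] Ez[of y] by auto
    then have s: "S < s" "s < 0" using q(1) by (auto simp: s_y_def)
    have d1: "((\<lambda>s. E s y) has_real_derivative Vs s y + \<delta> + \<delta> * exp s) (at s)" for s y
      unfolding E_def using C2 unfolding strip_C2_def by (auto intro!: derivative_eq_intros)
    have d2: "((\<lambda>s. Vs s y + \<delta> + \<delta> * exp s) has_real_derivative Vss s y + \<delta> * exp s) (at s)" for s y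
      using C2 unfolding strip_C2_def by (auto intro!: derivative_eq_intros)
    have e1: "((\<lambda>y. E s y) has_real_derivative Vy s y) (at y)" for s y
      unfolding E_def using C2 unfolding strip_C2_def by (auto intro!: derivative_eq_intros)
    have e2: "((\<lambda>y. Vy s y) has_real_derivative Vyy s y) (at y)" for s y
      using C2 unfolding strip_C2_def by auto
    have "Vss s y + \<delta> * exp s \<le> 0"
      by (rule second_deriv_nonpos_at_max[OF d1 d2, of "min (s - S) (- s)"]) (use s in \<open>auto intro!: max\<close>)
    moreover have "Vyy s y \<le> 0"
      by (rule second_deriv_nonpos_at_max[OF e1 e2, of 1]) (use s in \<open>auto intro!: max\<close>)
    ultimately show False using lap[of s y] that by (smt (verit) exp_gt_zero mult_pos_pos)
  qed
  show ?thesis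
  proof (rule field_le_epsilon)
    fix e :: real assume "e > 0"
    then show "V s0 y0 \<le> 0 + e"
      using main[of "e / (1 - s0)"] s0 by simp
  qed
qed

section \<open>Means over one period in \<open>y\<close>\<close>

definition mean :: "(real \<Rightarrow> real \<Rightarrow> real) \<Rightarrow> real \<Rightarrow> real" where
  "mean V s = integral {0..1} (\<lambda>x. V s (2 * pi * x))"

lemma continuous_on_slice:
  assumes "continuous_on UNIV (\<lambda>q. V (fst q) (snd q))"
  shows "continuous_on S (\<lambda>x. V s (2 * pi * x))"
proof -
  have "continuous_on S (\<lambda>x. (s, 2 * pi * x))" by (intro continuous_intros)
  from continuous_on_compose2[OF assms this] show ?thesis by simp
qed

lemma mean_has_derivative:
  assumes "\<And>s y. ((\<lambda>s. V s y) has_real_derivative Vs s y) (at s)"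
    "continuous_on UNIV (\<lambda>q. V (fst q) (snd q))"
    "continuous_on UNIV (\<lambda>q. Vs (fst q) (snd q))"
  shows "(mean V has_real_derivative mean Vs s) (at s)"
proof -
  have "((\<lambda>s. integral (cbox 0 1) (\<lambda>x. V s (2 * pi * x))) has_real_derivative
      integral (cbox 0 1) (\<lambda>x. Vs s (2 * pi * x))) (at s within UNIV)"
  proof (rule leibniz_rule_field_derivative)
    show "continuous_on (UNIV \<times> cbox 0 1) (\<lambda>(s, x). Vs s (2 * pi * x))"
    proof -
      have "continuous_on (UNIV \<times> cbox 0 1) (\<lambda>q::real\<times>real. (fst q, 2 * pi * snd q))"
        by (intro continuous_intros)
      from continuous_on_compose2[OF assms(3) this] show ?thesis
        by (simp add: case_prod_unfold)
    qed
  qed (use assms continuous_on_slice[OF assms(2)] in \<open>auto intro!: integrable_continuous_interval\<close>)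
  then show ?thesis by (simp add: mean_def[abs_def])
qed

text \<open>Differentiate under the integral. \<open>Vyy\<close> may be added for free, because its
  integral over a period is an increment of the periodic \<open>Vy\<close>; so the Laplacian
  controls the convexity of the means.\<close>

lemma mean_second_derivative:
  assumes C2: "strip_C2 V Vs Vss Vy Vyy"
  shows "(mean V has_real_derivative mean Vs s) (at s)"
    and "(mean Vs has_real_derivative mean (\<lambda>s y. Vss s y + Vyy s y) s) (at s)"
proof -
  show "(mean V has_real_derivative mean Vs s) (at s)"
    using C2 by (intro mean_has_derivative) (auto simp: strip_C2_def)
  have "(mean Vs has_real_derivative mean Vss s) (at s)"
    using C2 by (intro mean_has_derivative) (auto simp: strip_C2_def)
  moreover have "mean (\<lambda>s y. Vss s y + Vyy s y) s = mean Vss s"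
  proof -
    have "((\<lambda>x. Vyy s (2 * pi * x)) has_integral (Vy s (2 * pi * 1) / (2 * pi) - Vy s (2 * pi * 0) / (2 * pi))) {0..1}"
    proof (rule fundamental_theorem_of_calculus)
      fix x :: real assume "x \<in> {0..1}"
      have "((\<lambda>x. Vy s (2 * pi * x) / (2 * pi)) has_real_derivative Vyy s (2 * pi * x) * (2 * pi) / (2 * pi)) (at x)"
        using C2 unfolding strip_C2_def
        by (intro DERIV_cdivide DERIV_chain2[of "Vy s" _ "\<lambda>x. 2 * pi * x"]) (auto intro!: derivative_eq_intros)
      then show "((\<lambda>x. Vy s (2 * pi * x) / (2 * pi)) has_vector_derivative Vyy s (2 * pi * x)) (at x within {0..1})"
        by (simp add: has_real_derivative_iff_has_vector_derivative[symmetric] has_field_derivative_at_within)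
    qed simp
    moreover have "Vy s (2 * pi * 1) = Vy s (2 * pi * 0)"
      using C2 unfolding strip_C2_def by (metis add_0 mult.right_neutral mult_zero_right)
    ultimately have "integral {0..1} (\<lambda>x. Vyy s (2 * pi * x)) = 0"
      by (simp add: integral_unique)
    moreover have "integral {0..1} (\<lambda>x. Vss s (2 * pi * x) + Vyy s (2 * pi * x)) =
       integral {0..1} (\<lambda>x. Vss s (2 * pi * x)) + integral {0..1} (\<lambda>x. Vyy s (2 * pi * x))"
      using C2 unfolding strip_C2_def
      by (intro Henstock_Kurzweil_Integration.integral_add integrable_continuous_interval continuous_on_slice) auto
    ultimately show ?thesis by (simp add: mean_def)
  qed
  ultimately show "(mean Vs has_real_derivative mean (\<lambda>s y. Vss s y + Vyy s y) s) (at s)" by simp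
qed

lemma mean_nonneg:
  assumes "continuous_on UNIV (\<lambda>q. V (fst q) (snd q))" "\<And>y. V s y \<ge> 0"
  shows "mean V s \<ge> 0"
  unfolding mean_def
  by (intro integral_nonneg integrable_continuous_interval continuous_on_slice assms)

lemma mean_mono:
  assumes "continuous_on UNIV (\<lambda>q. V (fst q) (snd q))" "continuous_on UNIV (\<lambda>q. W (fst q) (snd q))"
     "\<And>y. V s y \<le> W s y"
  shows "mean V s \<le> mean W s"
  unfolding mean_def
  by (intro integral_le integrable_continuous_interval continuous_on_slice assms)

text \<open>A convex function with a negative slope at some \<open>s <= 0\<close> grows at least
  linearly to the left, against the bound \<open>B\<close>.\<close>

lemma bounded_convex_imp_mono:
  fixes m m1 m2 :: "real \<Rightarrow> real"
  assumes d1: "\<And>s. (m has_real_derivative m1 s) (at s)"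
    and d2: "\<And>s. (m1 has_real_derivative m2 s) (at s)"
    and pos: "\<And>s. m2 s \<ge> 0"
    and bnd: "\<And>s. s \<le> 0 \<Longrightarrow> m s \<le> B"
    and le: "u \<le> v" "v \<le> 0"
  shows "m u \<le> m v"
proof -
  have mono1: "m1 x \<le> m1 y" if "x \<le> y" for x y
    using DERIV_nonneg_imp_nondecreasing[OF that] d2 pos by blast
  have "m1 s \<ge> 0" if "s \<le> 0" for s
  proof (rule ccontr)
    assume neg: "\<not> m1 s \<ge> 0"
    \<comment> \<open>Moving left by this much raises the function by at least
      \<open>\<bar>B - m s\<bar> + 1\<close>, hence above \<open>B\<close>.\<close>
    define w where "w = s - (\<bar>B - m s\<bar> + 1) / (- m1 s)"
    have w: "w < s" using neg by (auto simp: w_def field_simps)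
    obtain x where x: "w < x" "x < s" "m s - m w = (s - w) * m1 x"
      using MVT2[OF w, of m m1] d1 by auto
    have "(s - w) * m1 x \<le> (s - w) * m1 s" using x w by (intro mult_left_mono mono1) auto
    also have "\<dots> = - (\<bar>B - m s\<bar> + 1)" using neg by (simp add: w_def)
    finally have "m w \<ge> m s + \<bar>B - m s\<bar> + 1" using x(3) by linarith
    then show False using bnd[of w] w that by linarith
  qed
  then show ?thesis
    using DERIV_nonneg_imp_nondecreasing[OF le(1), of m] d1 le(2) by (meson order_trans)
qed

lemma mean_subharmonic_mono:
  assumes C2: "strip_C2 V Vs Vss Vy Vyy"
    and lap: "\<And>s y. Vss s y + Vyy s y \<ge> 0"
    and bnd: "\<And>s y. s \<le> 0 \<Longrightarrow> V s y \<le> B"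
    and "u \<le> v" "v \<le> 0"
  shows "mean V u \<le> mean V v"
proof (rule bounded_convex_imp_mono[OF mean_second_derivative[OF C2] _ _ assms(4,5)])
  show "mean (\<lambda>s y. Vss s y + Vyy s y) s \<ge> 0" for s
    using C2 lap unfolding strip_C2_def by (intro mean_nonneg) (auto intro!: continuous_intros)
  fix s :: real assume "s \<le> 0"
  then have "mean V s \<le> mean (\<lambda>_ _. B) s"
    using C2 bnd by (intro mean_mono) (auto simp: strip_C2_def)
  then show "mean V s \<le> B" by (simp add: mean_def)
qed

text \<open>The mean value theorem twice: for the increment \<open>m (u + h) - m u\<close>, and for
  \<open>m1\<close>. The intermediate point becomes one of the times of the square function.\<close>

lemma second_difference:
  fixes m m1 m2 :: "real \<Rightarrow> real"
  assumes d1: "\<And>s. (m has_real_derivative m1 s) (at s)"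
    and d2: "\<And>s. (m1 has_real_derivative m2 s) (at s)" and h: "h > 0"
  shows "\<exists>x\<in>{a..a + 2 * h}. m (a + 2 * h) - 2 * m (a + h) + m a = h\<^sup>2 * m2 x"
proof -
  have "((\<lambda>u. m (u + h) - m u) has_real_derivative m1 (u + h) - m1 u) (at u)" for u
    using DERIV_shift[THEN iffD1, OF d1] by (intro DERIV_diff d1)
  then obtain u where u: "a < u" "u < a + h"
    "(m (a + h + h) - m (a + h)) - (m (a + h) - m a) = h * (m1 (u + h) - m1 u)"
    using MVT2[of a "a + h" "\<lambda>u. m (u + h) - m u" "\<lambda>u. m1 (u + h) - m1 u"] h by auto
  obtain x where x: "u < x" "x < u + h" "m1 (u + h) - m1 u = h * m2 x"
    using MVT2[of u "u + h" m1 m2] h d2 by auto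
  have "a + 2 * h = a + h + h" by simp
  then have "m (a + 2 * h) - 2 * m (a + h) + m a = h\<^sup>2 * m2 x"
    using u(3) unfolding x(3) by (simp add: power2_eq_square algebra_simps)
  then show ?thesis using u x by (intro bexI[of _ x]) auto
qed

section \<open>Riesz projection and the Hardy-Stein estimate\<close>

lemma Re_spt [simp]: "Re (spt s y) = s"
  by (simp add: spt_def)

lemma norm_exp_spt: "cmod (exp (of_nat n * spt s y)) = exp (of_nat n * s)"
  by (simp add: spt_def)

lemma apoly_bound: "s \<le> 0 \<Longrightarrow> cmod (apoly a N (spt s y)) \<le> (\<Sum>n\<le>N. cmod (a n))"
  unfolding apoly_def by (rule order_trans[OF norm_sum])
    (auto intro!: sum_mono mult_left_le simp: norm_mult norm_exp_spt mult_nonneg_nonpos)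

lemma hpoly_bound: "s \<le> 0 \<Longrightarrow> cmod (hpoly a b N (spt s y)) \<le> (\<Sum>n\<le>N. cmod (a n)) + (\<Sum>n\<le>N. cmod (b n))"
  unfolding hpoly_def
  by (rule order_trans[OF norm_triangle_ineq]) (auto intro: add_mono apoly_bound)

lemma reg_sq_bounded: "\<exists>B. \<forall>s y. s \<le> 0 \<longrightarrow> reg_sq I a b N e (spt s y) \<le> B"
proof -
  have "reg_sq I a b N e (spt s y) \<le> (\<Sum>i\<in>I. ((\<Sum>n\<le>N. cmod (a i n)) + (\<Sum>n\<le>N. cmod (b i n)))\<^sup>2) + e" if "s \<le> 0" for s y
    unfolding reg_sq_def using that by (auto intro!: sum_mono power_mono hpoly_bound)
  then show ?thesis by blast
qed

lemma reg_sq_powr_bounded: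
  assumes "e > 0" "al \<ge> 0"
  shows "\<exists>B\<ge>0. \<forall>s y. s \<le> 0 \<longrightarrow> reg_sq I a b N e (spt s y) powr al \<le> B"
proof -
  obtain B where B: "\<forall>s y. s \<le> 0 \<longrightarrow> reg_sq I a b N e (spt s y) \<le> B" using reg_sq_bounded by blast
  have "reg_sq I a b N e (spt s y) powr al \<le> B powr al" if "s \<le> 0" for s y
    using B that assms by (intro powr_mono2) (auto simp: less_imp_le reg_sq_pos)
  then show ?thesis by (intro exI[of _ "B powr al"]) auto
qed

text \<open>The analytic and the conjugated parts listed side by side as one analytic family. Its
  squared norm is \<open>|w|^2 + |z|^2\<close>, while its energy is that of the harmonic family
  \<open>w + cnj z\<close>; this makes the two Laplacians in the Riesz argument comparable.\<close>

definition join_coef :: "('i \<Rightarrow> nat \<Rightarrow> complex) \<Rightarrow> ('i \<Rightarrow> nat \<Rightarrow> complex) \<Rightarrow> 'i \<times> bool \<Rightarrow> nat \<Rightarrow> complex" where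
  "join_coef a b j = (if snd j then b (fst j) else a (fst j))"

abbreviation zero_coef :: "'i \<Rightarrow> nat \<Rightarrow> complex" where "zero_coef \<equiv> (\<lambda>_ _. 0)"

lemma apoly_zero [simp]: "apoly (\<lambda>_. 0) N z = 0" "dcoef c (\<lambda>_. 0) = (\<lambda>_. 0)"
  by (simp_all add: apoly_def dcoef_def)

lemma hpoly_zero [simp]: "hpoly a (\<lambda>_. 0) N z = apoly a N z"
  by (simp add: hpoly_def)

lemma sum_times_bool: "(\<Sum>j\<in>I \<times> (UNIV :: bool set). g j) = (\<Sum>i\<in>I. g (i, False) + g (i, True))"
  by (subst sum.cartesian_product') (simp add: UNIV_bool)

lemma reg_sq_join_coef: "reg_sq (I \<times> UNIV) (join_coef a b) zero_coef N e z = (\<Sum>i\<in>I. (cmod (apoly (a i) N z))\<^sup>2 + (cmod (apoly (b i) N z))\<^sup>2) + e"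
  by (simp add: reg_sq_def join_coef_def sum_times_bool)

lemma energy_join_coef: "energy (I \<times> UNIV) (join_coef a b) zero_coef N z = energy I a b N z"
  by (simp add: energy_def join_coef_def sum_times_bool)

lemma norm_add_square_le: "(cmod (u + v))\<^sup>2 \<le> 2 * ((cmod u)\<^sup>2 + (cmod v)\<^sup>2)"
proof -
  have "(cmod (u + v))\<^sup>2 \<le> (cmod u + cmod v)\<^sup>2" by (intro power_mono norm_triangle_ineq) auto
  also have "\<dots> \<le> 2 * ((cmod u)\<^sup>2 + (cmod v)\<^sup>2)"
    using sum_squares_bound[of "cmod u" "cmod v"] by (simp add: power2_sum)
  finally show ?thesis .
qed

lemma reg_sq_le_join_coef:
  assumes "e > 0"
  shows "reg_sq I a b N e z \<le> 2 * reg_sq (I \<times> UNIV) (join_coef a b) zero_coef N e z"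
proof -
  have "(\<Sum>i\<in>I. (cmod (hpoly (a i) (b i) N z))\<^sup>2) \<le> (\<Sum>i\<in>I. 2 * ((cmod (apoly (a i) N z))\<^sup>2 + (cmod (apoly (b i) N z))\<^sup>2))"
    unfolding hpoly_def by (intro sum_mono) (metis complex_mod_cnj norm_add_square_le)
  then show ?thesis using assms by (subst reg_sq_join_coef) (simp add: reg_sq_def sum_distrib_left)
qed

lemma powr_add_le:
  fixes x y :: real
  assumes "0 \<le> x" "0 \<le> y" "0 < al" "al \<le> 1"
  shows "(x + y) powr al \<le> x powr al + y powr al"
proof (cases "x = 0 \<or> y = 0")
  case False
  then have xy: "x > 0" "y > 0" using assms by auto
  have *: "u * (x + y) powr (al - 1) \<le> u powr al" if "0 < u" "u \<le> x + y" for u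
  proof -
    have "(x + y) powr (al - 1) \<le> u powr (al - 1)"
      using that assms by (intro powr_mono2') auto
    then have "u * (x + y) powr (al - 1) \<le> u * u powr (al - 1)" using that by simp
    also have "\<dots> = u powr al" using that by (simp add: powr_diff)
    finally show ?thesis .
  qed
  have "(x + y) powr al = x * (x + y) powr (al - 1) + y * (x + y) powr (al - 1)"
    using xy by (simp add: powr_diff distrib_right[symmetric] add_divide_distrib[symmetric])
  also have "\<dots> \<le> x powr al + y powr al" using *[of x] *[of y] xy by auto
  finally show ?thesis .
qed (use assms in auto)

lemma apoly_small:
  assumes "b 0 = 0" "s \<le> 0"
  shows "cmod (apoly b N (spt s y)) \<le> exp s * (\<Sum>n\<le>N. cmod (b n))"
proof -
  have "cmod (b n * exp (of_nat n * spt s y)) \<le> exp s * cmod (b n)" for n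
  proof (cases n)
    case (Suc m)
    have "real n * s \<le> 1 * s" using Suc assms by (intro mult_right_mono_neg) auto
    then have "exp (of_nat n * s) \<le> exp s" by simp
    then have "cmod (b n) * exp (of_nat n * s) \<le> cmod (b n) * exp s" by (intro mult_left_mono) auto
    then show ?thesis by (simp only: norm_mult norm_exp_spt mult.commute)
  qed (use assms in auto)
  then show ?thesis
    unfolding apoly_def sum_distrib_left by (intro order_trans[OF norm_sum] sum_mono) auto
qed

text \<open>With \<open>h = w + cnj z\<close>, the function \<open>A (|h|\<^sup>2 + e) powr (p/2) - (|w|\<^sup>2 + |z|\<^sup>2 + e) powr (p/2)\<close> is
  subharmonic, and it is nonnegative near \<open>s = -\<infinity>\<close> because \<open>z\<close> vanishes there.\<close>

lemma riesz_eps: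
  assumes p: "1 < p" "p < 2" and e: "e > 0" and I: "finite I" and b0: "\<And>i. i \<in> I \<Longrightarrow> b i 0 = 0"
  shows "mean (\<lambda>s y. reg_sq (I \<times> UNIV) (join_coef a b) zero_coef N e (spt s y) powr (p/2)) 0
     \<le> 2 / (p - 1) * mean (\<lambda>s y. reg_sq I a b N e (spt s y) powr (p/2)) 0"
proof -
  define A where "A = 2 / (p - 1)"
  define al where "al = p / 2"
  have al: "0 < al" "al \<le> 1" "2 * al - 1 = p - 1" using p by (auto simp: al_def)
  have A: "A \<ge> 2" using p by (simp add: A_def field_simps)
  let ?J = "I \<times> (UNIV :: bool set)"
  let ?Q = "\<lambda>s y. reg_sq I a b N e (spt s y)" and ?R = "\<lambda>s y. reg_sq ?J (join_coef a b) zero_coef N e (spt s y)"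
  define V where "V s y = A * ?Q s y powr al + (-1) * ?R s y powr al" for s y
  note C2 = strip_C2_lincomb[OF strip_C2_reg_pow[OF e, of I a b N al] strip_C2_reg_pow[OF e, of ?J "join_coef a b" zero_coef N al],
      of A "-1", folded V_def[abs_def]]
  have lap: "A * reg_pow_d2 1 al I a b N e z + (-1) * reg_pow_d2 1 al ?J (join_coef a b) zero_coef N e z
     + (A * reg_pow_d2 \<i> al I a b N e z + (-1) * reg_pow_d2 \<i> al ?J (join_coef a b) zero_coef N e z) \<ge> 0" for z
  proof -
    let ?q = "reg_sq I a b N e z" and ?r = "reg_sq ?J (join_coef a b) zero_coef N e z"
    have "reg_pow_d2 1 al ?J (join_coef a b) zero_coef N e z + reg_pow_d2 \<i> al ?J (join_coef a b) zero_coef N e z \<le> 4 * al * ?r powr (al - 1) * energy I a b N z"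
      using laplacian_le[OF e al(1,2), of ?J "join_coef a b" zero_coef N z] by (simp add: energy_join_coef)
    moreover have "4 * al * (2 * al - 1) * ?q powr (al - 1) * energy I a b N z \<le> reg_pow_d2 1 al I a b N e z + reg_pow_d2 \<i> al I a b N e z"
      by (rule laplacian_ge[OF e al(1,2)])
    then have "A * (4 * al * (2 * al - 1) * ?q powr (al - 1) * energy I a b N z) \<le> A * (reg_pow_d2 1 al I a b N e z + reg_pow_d2 \<i> al I a b N e z)"
      using A by (intro mult_left_mono) auto
    \<comment> \<open>Since \<open>?q <= 2 * ?r\<close> and \<open>-1 <= al - 1 <= 0\<close>, the
      power of \<open>?q\<close> is at least half that of \<open>?r\<close>. The energies agree, so
      the comparison holds as soon as \<open>A * (p - 1) = 2\<close>.\<close>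
    moreover have "4 * al * ?r powr (al - 1) * energy I a b N z \<le> A * (4 * al * (2 * al - 1) * ?q powr (al - 1) * energy I a b N z)"
    proof -
      have "(1/2) * ?r powr (al - 1) \<le> 2 powr (al - 1) * ?r powr (al - 1)"
        using powr_mono[of "-1" "al - 1" "2::real"] al by (intro mult_right_mono) (auto simp: powr_minus)
      also have "\<dots> = (2 * ?r) powr (al - 1)"
        using reg_sq_pos[OF e, of ?J "join_coef a b" zero_coef N z] by (simp add: powr_mult)
      also have "\<dots> \<le> ?q powr (al - 1)"
        using reg_sq_le_join_coef[OF e, of I a b N z] reg_sq_pos[OF e, of I a b N z] al by (intro powr_mono2') auto
      finally have "?r powr (al - 1) \<le> 2 * ?q powr (al - 1)" by simp
      also have "\<dots> = A * (2 * al - 1) * ?q powr (al - 1)" proof -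
        have "A * (p - 1) = 2" using p unfolding A_def by (simp only: times_divide_eq_left nonzero_mult_div_cancel_right)
        then show ?thesis by (simp only: al(3))
      qed
      finally have "(4 * al * energy I a b N z) * ?r powr (al - 1) \<le> (4 * al * energy I a b N z) * (A * (2 * al - 1) * ?q powr (al - 1))"
        using al energy_nonneg[of I a b N z] by (intro mult_left_mono) auto
      then show ?thesis by (simp only: mult_ac)
    qed
    ultimately show ?thesis by (simp add: algebra_simps)
  qed
  obtain B where B: "\<forall>s y. s \<le> 0 \<longrightarrow> ?Q s y powr al \<le> B" using reg_sq_powr_bounded[OF e, of al I a b N] al by force
  have bnd: "V s y \<le> A * B" if "s \<le> 0" for s y
  proof -
    have "A * ?Q s y powr al \<le> A * B" using B that A by (intro mult_left_mono) auto
    then show ?thesis using powr_ge_zero[of "?R s y" al] unfolding V_def by linarith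
  qed
  define T where "T = (\<Sum>i\<in>I. (\<Sum>n\<le>N. cmod (b i n))\<^sup>2)"
  have T: "T \<ge> 0" unfolding T_def by (intro sum_nonneg) auto
  \<comment> \<open>The factor 3 is 1 + 2: from \<open>|w|^2 <= 2 * |h|^2 + 2 * |z|^2\<close> the
    sum \<open>|w|^2 + |z|^2 + e\<close> is at most \<open>2 * |h|^2 + 3 * |z|^2 + e\<close>, and
    this has to stay below \<open>2 * (|h|^2 + e)\<close>.\<close>
  obtain s0 where s0: "s0 \<le> 0" "3 * ((exp s0)\<^sup>2 * T) \<le> e"
  proof
    define s where "s = min 0 (ln (e / (3 * (T + 1))) / 2)"
    show "s \<le> 0" by (simp add: s_def)
    have "(exp s)\<^sup>2 = exp (2 * s)" by (simp add: power2_eq_square exp_add[symmetric])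
    also have "\<dots> \<le> e / (3 * (T + 1))"
      using e T by (subst ln_ge_iff[symmetric]) (auto simp: s_def min_def)
    finally have "3 * ((exp s)\<^sup>2 * T) \<le> 3 * (e / (3 * (T + 1)) * T)"
      using T by (intro mult_left_mono mult_right_mono) auto
    also have "\<dots> \<le> e" using T e by (simp add: field_simps)
    finally show "3 * ((exp s)\<^sup>2 * T) \<le> e" .
  qed
  have Vpos: "V s0 y \<ge> 0" for y
  proof -
    let ?z = "spt s0 y"
    have "(\<Sum>i\<in>I. (cmod (apoly (b i) N ?z))\<^sup>2) \<le> (\<Sum>i\<in>I. (exp s0 * (\<Sum>n\<le>N. cmod (b i n)))\<^sup>2)"
      using s0 b0 by (intro sum_mono power_mono apoly_small) auto
    also have "\<dots> = (exp s0)\<^sup>2 * T" by (simp only: T_def power_mult_distrib sum_distrib_left[of "(exp s0)\<^sup>2"])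
    finally have z: "3 * (\<Sum>i\<in>I. (cmod (apoly (b i) N ?z))\<^sup>2) \<le> e" using s0(2) by linarith
    have "(\<Sum>i\<in>I. (cmod (apoly (a i) N ?z))\<^sup>2) \<le> (\<Sum>i\<in>I. 2 * ((cmod (hpoly (a i) (b i) N ?z))\<^sup>2 + (cmod (apoly (b i) N ?z))\<^sup>2))"
    proof (rule sum_mono)
      fix i
      show "(cmod (apoly (a i) N ?z))\<^sup>2 \<le> 2 * ((cmod (hpoly (a i) (b i) N ?z))\<^sup>2 + (cmod (apoly (b i) N ?z))\<^sup>2)"
        using norm_add_square_le[of "hpoly (a i) (b i) N ?z" "- cnj (apoly (b i) N ?z)"] by (simp add: hpoly_def)
    qed
    also have "\<dots> = 2 * (\<Sum>i\<in>I. (cmod (hpoly (a i) (b i) N ?z))\<^sup>2) + 2 * (\<Sum>i\<in>I. (cmod (apoly (b i) N ?z))\<^sup>2)"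
      by (simp add: sum_distrib_left sum.distrib)
    finally have w: "(\<Sum>i\<in>I. (cmod (apoly (a i) N ?z))\<^sup>2) \<le> 2 * (\<Sum>i\<in>I. (cmod (hpoly (a i) (b i) N ?z))\<^sup>2) + 2 * (\<Sum>i\<in>I. (cmod (apoly (b i) N ?z))\<^sup>2)" .
    have R: "?R s0 y = (\<Sum>i\<in>I. (cmod (apoly (a i) N ?z))\<^sup>2) + (\<Sum>i\<in>I. (cmod (apoly (b i) N ?z))\<^sup>2) + e"
      by (subst reg_sq_join_coef) (simp add: sum.distrib)
    have Q: "?Q s0 y = (\<Sum>i\<in>I. (cmod (hpoly (a i) (b i) N ?z))\<^sup>2) + e" by (simp add: reg_sq_def)
    have "?R s0 y \<le> 2 * ?Q s0 y" unfolding R Q using w z by argo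
    then have "?R s0 y powr al \<le> (2 * ?Q s0 y) powr al"
      using al reg_sq_pos[OF e, of ?J "join_coef a b" zero_coef N ?z] by (intro powr_mono2) auto
    also have "\<dots> = 2 powr al * ?Q s0 y powr al" using reg_sq_pos[OF e, of I a b N ?z] by (simp add: powr_mult)
    also have "\<dots> \<le> A * ?Q s0 y powr al"
      using A al powr_mono[of al 1 "2::real"] by (intro mult_right_mono) auto
    finally show ?thesis by (simp add: V_def)
  qed
  have contV: "continuous_on UNIV (\<lambda>q. V (fst q) (snd q))" using C2 by (simp add: strip_C2_def)
  have "0 \<le> mean V s0" by (rule mean_nonneg[OF contV Vpos])
  also have "\<dots> \<le> mean V 0"
    by (rule mean_subharmonic_mono[OF C2 lap bnd]) (use s0 in auto)
  also have "\<dots> = A * mean (\<lambda>s y. ?Q s y powr al) 0 - mean (\<lambda>s y. ?R s y powr al) 0"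
  proof -
    have "continuous_on {0..1} (\<lambda>x. reg_sq I' a' b' N e (spt 0 (2 * pi * x)) powr al)" for I' :: "'z set" and a' b'
      by (intro continuous_intros e)
    then show ?thesis unfolding mean_def V_def
      by (subst Henstock_Kurzweil_Integration.integral_add)
        (auto intro!: integrable_continuous_interval continuous_intros e simp: integral_neg)
  qed
  finally show ?thesis by (simp add: A_def al_def)
qed

text \<open>The times \<open>t k\<close> are intermediate points of second differences of the convex function \<open>m\<close> of circular
  means; these differences telescope.\<close>

lemma hardy_stein:
  assumes al: "1/2 \<le> al" "al \<le> 1" and e: "e > 0"
  shows "\<exists>t. (\<forall>k. t k \<in> {1 / 2 ^ (k + 1)..1 / 2 ^ k}) \<and>
    (\<Sum>k=1..K. (t k)\<^sup>2 * mean (\<lambda>s y. reg_sq I a zero_coef N e (spt s y) powr (al - 1) * energy I a zero_coef N (spt s y)) (- t k))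
      \<le> 16 * mean (\<lambda>s y. reg_sq I a zero_coef N e (spt s y) powr al) 0"
proof -
  let ?Q = "\<lambda>s y. reg_sq I a zero_coef N e (spt s y)"
  let ?G = "\<lambda>s y. ?Q s y powr (al - 1) * energy I a zero_coef N (spt s y)"
  let ?L = "\<lambda>s y. reg_pow_d2 1 al I a zero_coef N e (spt s y) + reg_pow_d2 \<i> al I a zero_coef N e (spt s y)"
  note C2 = strip_C2_reg_pow[OF e, of I a zero_coef N al]
  define m where "m = mean (\<lambda>s y. ?Q s y powr al)"
  have d: "(m has_real_derivative mean (\<lambda>s y. reg_pow_d1 1 al I a zero_coef N e (spt s y)) s) (at s)"
    "(mean (\<lambda>s y. reg_pow_d1 1 al I a zero_coef N e (spt s y)) has_real_derivative mean ?L s) (at s)" for s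
    unfolding m_def using mean_second_derivative[OF C2] by auto
  have contE: "continuous_on UNIV (\<lambda>q. energy I a zero_coef N (spt (fst q) (snd q)))"
    unfolding energy_def by (intro continuous_intros)
  have G: "?G s y \<le> ?L s y" for s y
  proof -
    \<comment> \<open>This is where \<open>al >= 1/2\<close> is used: \<open>4 * al^2 >= 1\<close>,
      uniformly down to the endpoint.\<close>
    have "1 * ?G s y \<le> (4 * al\<^sup>2) * ?G s y"
      using al power_mono[of "1/2" al 2] energy_nonneg[of I a zero_coef N "spt s y"] by (intro mult_right_mono) (auto simp: power2_eq_square)
    also have "\<dots> \<le> ?L s y" using laplacian_ge_analytic[OF e, of al I a N "spt s y"] al by (simp add: mult_ac)
    finally show ?thesis by simp
  qed
  have G0: "0 \<le> ?G s y" for s y using energy_nonneg[of I a zero_coef N "spt s y"] by simp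
  have contG: "continuous_on UNIV (\<lambda>q. ?G (fst q) (snd q))" by (intro continuous_intros e contE)
  have contL: "continuous_on UNIV (\<lambda>q. ?L (fst q) (snd q))" by (intro continuous_intros e)
  have GL: "mean ?G s \<le> mean ?L s" for s by (rule mean_mono[OF contG contL G])
  have mono: "m u \<le> m v" if "u \<le> v" "v \<le> 0" for u v
  proof -
    obtain B where "\<forall>s y. s \<le> 0 \<longrightarrow> ?Q s y powr al \<le> B" using reg_sq_powr_bounded[OF e, of al I a zero_coef N] al by force
    moreover have "?L s y \<ge> 0" for s y using G[of s y] G0[of s y] by linarith
    ultimately show ?thesis unfolding m_def using that by (intro mean_subharmonic_mono[OF C2]) auto
  qed
  have m0: "m s \<ge> 0" for s
    unfolding m_def using C2 by (intro mean_nonneg) (auto simp: strip_C2_def)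
  define bb where "bb k = m (- (1 / 2 ^ k))" for k :: nat
  have "\<exists>t. t \<in> {1 / 2 ^ (k + 1)..1 / 2 ^ k} \<and> t\<^sup>2 * mean ?G (- t) \<le> 16 * (bb (k + 1) - bb k)" for k
  proof -
    \<comment> \<open>The interval from \<open>a\<close> to \<open>a + 2 * h\<close> is the dyadic
      one from \<open>- 1 / 2 ^ k\<close> to \<open>- 1 / 2 ^ (k + 1)\<close>. Its points have
      modulus at most \<open>4 * h\<close>, which turns the factor \<open>h^2\<close> of the second
      difference into 16 times the one wanted.\<close>
    define a h where "a = - (1 / 2 ^ k :: real)" "h = (1 / 2 ^ (k + 2) :: real)"
    have h: "h > 0" "a + 2 * h = - (1 / 2 ^ (k + 1))" "1 / 2 ^ k = 4 * h" by (auto simp: a_h_def field_simps)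
    obtain x where x: "x \<in> {a..a + 2 * h}" "m (a + 2 * h) - 2 * m (a + h) + m a = h\<^sup>2 * mean ?L x"
      using second_difference[OF d h(1), of a] by blast
    have xb: "- x \<in> {1 / 2 ^ (k + 1)..1 / 2 ^ k}" 
    proof -
      have "a \<le> x" "x \<le> a + 2 * h" using x(1) by auto
      then have "- x \<le> 1 / 2 ^ k" "1 / 2 ^ (k + 1) \<le> - x" using a_h_def(1) h(2) by linarith+
      then show ?thesis by simp
    qed
    have "a + h \<le> 0" using h(1,2) by (smt (verit) divide_nonneg_nonneg zero_le_power)
    then have mm: "m a \<le> m (a + h)" using h by (intro mono) auto
    have "- x \<ge> 0" using xb by (auto intro: order_trans[rotated])
    then have x2: "(- x)\<^sup>2 \<le> (4 * h)\<^sup>2" using xb h(3) by (intro power_mono) auto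
    have "(- x)\<^sup>2 * mean ?G (- (- x)) \<le> (4 * h)\<^sup>2 * mean ?G x"
      using x2 mean_nonneg[OF contG G0] by (simp add: mult_right_mono)
    also have "\<dots> \<le> (4 * h)\<^sup>2 * mean ?L x" by (intro mult_left_mono GL) auto
    also have "\<dots> = 16 * (m (a + 2 * h) - 2 * m (a + h) + m a)" unfolding x(2) by (simp add: power2_eq_square)
    \<comment> \<open>As \<open>m a <= m (a + h)\<close>, the second difference is at most the first
      difference \<open>m (a + 2 * h) - m a\<close>, and these telescope over
      \<open>k\<close>.\<close>
    also have "\<dots> \<le> 16 * (bb (k + 1) - bb k)" using mm h(2) by (simp add: bb_def a_h_def)
    finally show ?thesis using xb by (intro exI[of _ "- x"] conjI)
  qed
  then have "\<forall>k. \<exists>t. t \<in> {1 / 2 ^ (k + 1)..1 / 2 ^ k} \<and> t\<^sup>2 * mean ?G (- t) \<le> 16 * (bb (k + 1) - bb k)" ..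
  from choice[OF this] obtain t where "\<forall>k. t k \<in> {1 / 2 ^ (k + 1)..1 / 2 ^ k} \<and> (t k)\<^sup>2 * mean ?G (- t k) \<le> 16 * (bb (k + 1) - bb k)" ..
  then have t: "\<And>k. t k \<in> {1 / 2 ^ (k + 1)..1 / 2 ^ k}"
    "\<And>k. (t k)\<^sup>2 * mean ?G (- t k) \<le> 16 * (bb (k + 1) - bb k)" by blast+
  have "(\<Sum>k=1..K. (t k)\<^sup>2 * mean ?G (- t k)) \<le> (\<Sum>k=1..K. 16 * (bb (k + 1) - bb k))"
    by (intro sum_mono t)
  also have "\<dots> = 16 * (bb (K + 1) - bb 1)" 
    by (induction K) (auto simp: algebra_simps)
  also have "\<dots> \<le> 16 * m 0" using m0[of "- (1 / 2 ^ 1)"] mono[of "- (1 / 2 ^ (K + 1))" 0] by (simp add: bb_def)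
  finally show ?thesis using t(1) unfolding m_def by blast
qed

section \<open>Poisson kernel and harmonic majorants\<close>

lemma space_circle [simp]: "space circle = {0..<1}"
  by (simp add: circle_def space_restrict_space)

lemma prob_space_circle: "prob_space circle"
  by (rule prob_spaceI) (simp add: circle_def emeasure_restrict_space space_restrict_space)

interpretation circle: prob_space circle
  by (rule prob_space_circle)

lemma measure_circle [simp]: "measure circle {0..<1} = 1"
  using circle.prob_space by simp

lemma measurable_circle [measurable (raw)]: "f \<in> borel_measurable borel \<Longrightarrow> f \<in> borel_measurable circle"
  by (simp add: circle_def measurable_restrict_space1)

lemma measurable_ident_circle [measurable]: "(\<lambda>x. x) \<in> borel_measurable circle"
  by (rule measurable_circle) simp

lemma circle_integral:
  fixes f :: "real \<Rightarrow> 'a::euclidean_space"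
  assumes "continuous_on {0..1} f"
  shows "integrable circle f" "(\<integral>x. f x \<partial>circle) = integral {0..1} f"
proof -
  have 1: "set_integrable lborel {0..1} f"
    using assms by (rule borel_integrable_atLeastAtMost')
  then have 2: "set_integrable lborel {0..<1} f"
    by (rule set_integrable_subset) auto
  then show "integrable circle f"
    unfolding circle_def set_integrable_def by (subst integrable_restrict_space) auto
  have "(\<integral>x. f x \<partial>circle) = (LINT x:{0..<1}|lborel. f x)"
    unfolding circle_def set_lebesgue_integral_def by (subst integral_restrict_space) auto
  also have "\<dots> = integral {0..<1} f" using 2 by (rule set_borel_integral_eq_integral)
  also have "\<dots> = integral {0..1} f"
    by (rule integral_spike_set) (auto intro: negligible_subset[of "{1}"])
  finally show "(\<integral>x. f x \<partial>circle) = integral {0..1} f" .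
qed

lemma circle_nn_integral:
  fixes f :: "real \<Rightarrow> real"
  assumes "continuous_on {0..1} f" "\<And>x. f x \<ge> 0"
  shows "(\<integral>\<^sup>+x. ennreal (f x) \<partial>circle) = ennreal (integral {0..1} f)"
  using circle_integral[OF assms(1)] assms(2) by (subst nn_integral_eq_integral) auto

text \<open>The Poisson kernel of radius \<open>r = exp (- t)\<close>: numerator and denominator of
  \<open>(1 - r^2) / (1 - 2 * r * cos th + r^2)\<close> have been divided by
  \<open>2 * r\<close>.\<close>

definition poisson :: "real \<Rightarrow> real \<Rightarrow> real" where
  "poisson t th = sinh t / (cosh t - cos th)"

lemma cosh_gt_cos: "t > 0 \<Longrightarrow> cosh t > cos (th::real)"
proof -
  assume "t > 0"
  then have "cosh t > cosh (0::real)" by (subst cosh_real_nonneg_less_iff) auto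
  then show ?thesis using cos_le_one[of th] unfolding cosh_0 by linarith
qed

lemma poisson_nonneg: "t > 0 \<Longrightarrow> poisson t th \<ge> 0"
  unfolding poisson_def using cosh_gt_cos[of t th] by (intro divide_nonneg_pos) auto

lemma continuous_on_poisson [continuous_intros]:
  fixes f :: "real \<Rightarrow> real"
  assumes "t > 0" "continuous_on S f"
  shows "continuous_on S (\<lambda>x. poisson t (f x))"
  unfolding poisson_def using assms less_imp_neq[OF cosh_gt_cos[OF assms(1)], symmetric]
  by (intro continuous_on_divide continuous_on_diff continuous_on_cos continuous_on_const)
    (auto dest: less_imp_neq[symmetric])

definition cos_weight :: "nat \<Rightarrow> real" where "cos_weight n = (if n = 0 then 1 else 2)"

text \<open>With \<open>z = exp (- t + i th)\<close> the kernel is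
  \<open>2 * Re (1 / (1 - z)) - 1\<close>, and the series is the real part of the geometric series;
  the subtracted 1 accounts for the weight 1 at index 0.\<close>

lemma poisson_sums:
  assumes "t > 0"
  shows "(\<lambda>n. cos_weight n * exp (- (real n * t)) * cos (real n * th)) sums poisson t th"
proof -
  define z where "z = exp (spt (- t) th)"
  have nz: "cmod z < 1" using assms by (simp add: z_def)
  have "(\<lambda>n. Re (z ^ n)) sums Re (1 / (1 - z))"
    by (intro sums_Re geometric_sums nz)
  moreover have zn: "Re (z ^ n) = exp (- (real n * t)) * cos (real n * th)" for n
    unfolding z_def exp_of_nat_mult[symmetric] by (simp add: Re_exp spt_def)
  ultimately have "(\<lambda>n. 2 * (exp (- (real n * t)) * cos (real n * th))) sums (2 * Re (1 / (1 - z)))"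
    by (intro sums_mult) simp
  moreover have "(\<lambda>n. if n = 0 then 1 else 0 :: real) sums 1"
    using sums_single[of 0 "\<lambda>_. 1::real"] by (simp add: if_distrib eq_commute cong: if_cong)
  ultimately have "(\<lambda>n. 2 * (exp (- (real n * t)) * cos (real n * th)) - (if n = 0 then 1 else 0)) sums (2 * Re (1 / (1 - z)) - 1)"
    by (rule sums_diff)
  moreover have "(\<lambda>n. 2 * (exp (- (real n * t)) * cos (real n * th)) - (if n = 0 then 1 else 0)) =
     (\<lambda>n. cos_weight n * exp (- (real n * t)) * cos (real n * th))"
    by (auto simp: cos_weight_def)
  moreover have "2 * Re (1 / (1 - z)) - 1 = poisson t th"
  proof -
    define \<rho> where "\<rho> = exp (- t)"
    have \<rho>: "\<rho> > 0" "exp t = 1 / \<rho>" by (auto simp: \<rho>_def exp_minus field_simps)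
    have zz: "Re z = \<rho> * cos th" "Im z = \<rho> * sin th" by (simp_all add: z_def Re_exp Im_exp spt_def \<rho>_def)
    have D: "(1 - Re z)\<^sup>2 + (Im z)\<^sup>2 = 1 - 2 * \<rho> * cos th + \<rho>\<^sup>2"
    proof -
      have "(1 - Re z)\<^sup>2 + (Im z)\<^sup>2 = 1 - 2 * \<rho> * cos th + \<rho>\<^sup>2 * ((cos th)\<^sup>2 + (sin th)\<^sup>2)"
        unfolding zz by algebra
      then show ?thesis by simp
    qed
    have sc: "sinh t = (1 - \<rho>\<^sup>2) / (2 * \<rho>)" "cosh t - cos th = (1 - 2 * \<rho> * cos th + \<rho>\<^sup>2) / (2 * \<rho>)"
      unfolding sinh_def cosh_def \<rho>(2) \<rho>_def[symmetric] using \<rho>(1) by (auto simp: field_simps power2_eq_square)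
    have "z \<noteq> 1" using nz by auto
    then have "(1 - Re z)\<^sup>2 + (Im z)\<^sup>2 \<noteq> 0" by (auto simp: complex_eq_iff sum_power2_eq_zero_iff)
    then have D0: "1 - 2 * \<rho> * cos th + \<rho>\<^sup>2 \<noteq> 0" using D by simp
    have "Re (1 / (1 - z)) = (1 - \<rho> * cos th) / (1 - 2 * \<rho> * cos th + \<rho>\<^sup>2)"
      using D by (simp add: Re_divide zz)
    define N where "N = 1 - 2 * \<rho> * cos th + \<rho>\<^sup>2"
    have "poisson t th = (1 - \<rho>\<^sup>2) / N" unfolding poisson_def sc N_def using \<rho>(1) by simp
    also have "\<dots> = (2 * (1 - \<rho> * cos th) - N) / N" by (simp add: N_def)
    also have "\<dots> = 2 * ((1 - \<rho> * cos th) / N) - 1" using D0 by (simp add: N_def[symmetric] diff_divide_distrib)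
    finally show ?thesis unfolding \<open>Re (1 / (1 - z)) = _\<close> N_def by simp
  qed
  ultimately show ?thesis by simp
qed

lemma circle_integral_cos:
  "(\<integral>y. cos (2 * pi * of_int k * y + c) \<partial>circle) = (if k = 0 then cos c else 0)"
proof -
  have "(\<integral>y. cos (2 * pi * of_int k * y + c) \<partial>circle) = integral {0..1} (\<lambda>y. cos (2 * pi * of_int k * y + c))"
    by (intro circle_integral continuous_intros)
  also have "\<dots> = (if k = 0 then cos c else 0)"
  proof (cases "k = 0")
    case False
    let ?F = "\<lambda>y. sin (2 * pi * of_int k * y + c) / (2 * pi * of_int k)"
    have "((\<lambda>y. cos (2 * pi * of_int k * y + c)) has_integral (?F 1 - ?F 0)) {0..1}"
      by (rule fundamental_theorem_of_calculus)
        (use False in \<open>auto intro!: derivative_eq_intros simp: has_real_derivative_iff_has_vector_derivative[symmetric]\<close>)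
    moreover have "sin (2 * pi * of_int k + c) = sin c"
      using sin.plus_of_int[of c k] by (simp add: add.commute mult.commute mult.left_commute)
    ultimately show ?thesis using False by (simp add: integral_unique)
  qed auto
  finally show ?thesis .
qed

lemma circle_integral_cos_cos:
  "cos_weight m * (\<integral>y. cos (real m * (a - 2 * pi * y)) * cos (real n * (2 * pi * y) - b) \<partial>circle)
     = (if m = n then cos (real n * a - b) else 0)"
proof -
  have "(\<integral>y. cos (real m * (a - 2 * pi * y)) * cos (real n * (2 * pi * y) - b) \<partial>circle) =
     (\<integral>y. (cos (2 * pi * of_int (int m + int n) * y + (- (real m * a) - b)) + cos (2 * pi * of_int (int n - int m) * y + (real m * a - b))) / 2 \<partial>circle)"
  proof (rule Bochner_Integration.integral_cong[OF refl])
    fix y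
    have e1: "2 * pi * of_int (int m + int n) * y + (- (real m * a) - b) = - (real m * (a - 2 * pi * y) - (real n * (2 * pi * y) - b))"
      by (simp add: algebra_simps)
    have e2: "2 * pi * of_int (int n - int m) * y + (real m * a - b) = real m * (a - 2 * pi * y) + (real n * (2 * pi * y) - b)"
      by (simp add: algebra_simps)
    show "cos (real m * (a - 2 * pi * y)) * cos (real n * (2 * pi * y) - b) =
      (cos (2 * pi * of_int (int m + int n) * y + (- (real m * a) - b)) + cos (2 * pi * of_int (int n - int m) * y + (real m * a - b))) / 2"
      unfolding e1 e2 cos_minus by (simp only: cos_add cos_diff) simp
  qed
  also have "\<dots> = ((\<integral>y. cos (2 * pi * of_int (int m + int n) * y + (- (real m * a) - b)) \<partial>circle) + (\<integral>y. cos (2 * pi * of_int (int n - int m) * y + (real m * a - b)) \<partial>circle)) / 2"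
    by (subst integral_divide_zero) (subst Bochner_Integration.integral_add, auto intro!: circle_integral continuous_intros)
  also have "\<dots> = ((if int m + int n = 0 then cos (- (real m * a) - b) else 0) + (if int n - int m = 0 then cos (real m * a - b) else 0)) / 2"
    unfolding circle_integral_cos ..
  finally show ?thesis by (auto simp: cos_weight_def)
qed

lemma summable_exp: "t > 0 \<Longrightarrow> summable (\<lambda>m. cos_weight m * exp (- (real m * t)))"
  using poisson_sums[of t 0] by (simp add: sums_iff)

text \<open>The cosine series converges absolutely and uniformly in \<open>y\<close>, so it may be
  integrated term by term; orthogonality keeps the term of index \<open>n\<close>.\<close>

lemma poisson_integral_cos:
  assumes "t > 0"
  shows "(\<integral>y. poisson t (a - 2 * pi * y) * cos (real n * (2 * pi * y) - b) \<partial>circle) = exp (- (real n * t)) * cos (real n * a - b)"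
proof -
  let ?f = "\<lambda>m y. cos_weight m * exp (- (real m * t)) * (cos (real m * (a - 2 * pi * y)) * cos (real n * (2 * pi * y) - b))"
  have ec0: "cos_weight m \<ge> 0" for m by (simp add: cos_weight_def)
  have sums: "(\<lambda>m. ?f m y) sums (poisson t (a - 2 * pi * y) * cos (real n * (2 * pi * y) - b))" for y
    using sums_mult2[OF poisson_sums[OF assms, of "a - 2 * pi * y"], of "cos (real n * (2 * pi * y) - b)"]
    by (simp add: mult.assoc)
  have int: "integrable circle (?f m)" for m
    by (intro circle_integral continuous_intros)
  have bnd: "norm (?f m y) \<le> cos_weight m * exp (- (real m * t))" for m y
  proof -
    have "\<bar>cos (real m * (a - 2 * pi * y)) * cos (real n * (2 * pi * y) - b)\<bar> \<le> 1"
      unfolding abs_mult by (intro mult_le_one) auto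
    then show ?thesis using ec0[of m] by (simp only: real_norm_def abs_mult[of "cos_weight m * exp (- (real m * t))"]) (simp add: mult_left_le)
  qed
  have "(\<integral>y. (\<Sum>m. ?f m y) \<partial>circle) = (\<Sum>m. (\<integral>y. ?f m y \<partial>circle))"
  proof (rule integral_suminf[OF int])
    show "AE y in circle. summable (\<lambda>m. norm (?f m y))"
      by (intro AE_I2 summable_comparison_test'[OF summable_exp[OF assms], of 0]) (use bnd in auto)
    have "norm (\<integral>y. norm (?f m y) \<partial>circle) \<le> cos_weight m * exp (- (real m * t))" for m
    proof -
      have "(\<integral>y. norm (?f m y) \<partial>circle) \<le> (\<integral>y. cos_weight m * exp (- (real m * t)) \<partial>circle)"
        by (intro integral_mono integrable_norm int bnd) auto
      moreover have "(\<integral>y. norm (?f m y) \<partial>circle) \<ge> 0" by simp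
      ultimately show ?thesis by (simp add: circle.prob_space)
    qed
    then show "summable (\<lambda>m. \<integral>y. norm (?f m y) \<partial>circle)"
      by (intro summable_comparison_test'[OF summable_exp[OF assms], of 0]) auto
  qed
  also have "(\<lambda>m. (\<integral>y. ?f m y \<partial>circle)) = (\<lambda>m. if m = n then exp (- (real n * t)) * cos (real n * a - b) else 0)"
  proof
    fix m
    have "(\<integral>y. ?f m y \<partial>circle) = exp (- (real m * t)) * (cos_weight m * (\<integral>y. cos (real m * (a - 2 * pi * y)) * cos (real n * (2 * pi * y) - b) \<partial>circle))"
      by simp
    then show "(\<integral>y. ?f m y \<partial>circle) = (if m = n then exp (- (real n * t)) * cos (real n * a - b) else 0)"
      using circle_integral_cos_cos[of m a n b] by (cases "m = n") auto
  qed
  also have "(\<Sum>m. if m = n then exp (- (real n * t)) * cos (real n * a - b) else 0) = exp (- (real n * t)) * cos (real n * a - b)"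
    using sums_single[of n "\<lambda>_. exp (- (real n * t)) * cos (real n * a - b)"] by (simp add: sums_iff)
  finally show ?thesis using sums by (simp add: sums_iff)
qed

lemma poisson_integral_one: "t > 0 \<Longrightarrow> (\<integral>y. poisson t (a - 2 * pi * y) \<partial>circle) = 1"
  using poisson_integral_cos[of t a 0 0] by simp

section \<open>Trigonometric polynomials and their harmonic extensions\<close>

inductive trig_sum :: "(real \<Rightarrow> real) \<Rightarrow> bool" where
  base: "trig_sum (\<lambda>y. A * cos (real n * y - b))"
| add: "trig_sum f \<Longrightarrow> trig_sum g \<Longrightarrow> trig_sum (\<lambda>y. f y + g y)"

lemma trig_sum_const: "trig_sum (\<lambda>_. c)"
  using trig_sum.base[of c 0 0] by simp

lemma trig_sum_mult:
  assumes "trig_sum f" "trig_sum g"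
  shows "trig_sum (\<lambda>y. f y * g y)"
proof -
  have b: "trig_sum (\<lambda>y. (A * cos (real n * y - b)) * (B * cos (real m * y - c)))" for A n b B m c
  proof -
    have le: "trig_sum (\<lambda>y. (A * cos (real n * y - b)) * (B * cos (real m * y - c)))" if "n \<ge> m" for A n b B m c
    proof -
      have "trig_sum (\<lambda>y. (A * B / 2) * cos (real (n - m) * y - (b - c)) + (A * B / 2) * cos (real (n + m) * y - (b + c)))"
        by (intro trig_sum.intros)
      also have "(\<lambda>y. (A * B / 2) * cos (real (n - m) * y - (b - c)) + (A * B / 2) * cos (real (n + m) * y - (b + c))) =
         (\<lambda>y. (A * cos (real n * y - b)) * (B * cos (real m * y - c)))"
      proof
        fix y
        have e: "real (n - m) * y - (b - c) = (real n * y - b) - (real m * y - c)"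
          "real (n + m) * y - (b + c) = (real n * y - b) + (real m * y - c)"
          using that by (simp_all add: of_nat_diff algebra_simps)
        show "(A * B / 2) * cos (real (n - m) * y - (b - c)) + (A * B / 2) * cos (real (n + m) * y - (b + c)) = (A * cos (real n * y - b)) * (B * cos (real m * y - c))"
          unfolding e cos_add[of "real n * y - b"] cos_diff[of "real n * y - b"] by (simp add: algebra_simps)
      qed
      finally show ?thesis .
    qed
    show ?thesis
    proof (cases "n \<ge> m")
      case True then show ?thesis by (rule le)
    next
      case False
      then have "trig_sum (\<lambda>y. (B * cos (real m * y - c)) * (A * cos (real n * y - b)))" by (intro le) auto
      then show ?thesis by (simp only: mult.commute)
    qed
  qed
  have b2: "trig_sum (\<lambda>y. f y * (B * cos (real m * y - c)))" if "trig_sum f" for f B m c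
    using that by induction (auto simp: distrib_right intro: b trig_sum.add)
  from assms(2) show ?thesis
    by induction (auto simp: distrib_left intro: b2[OF assms(1)] trig_sum.add)
qed

lemma trig_sum_sum: "(\<And>i. i \<in> I \<Longrightarrow> trig_sum (f i)) \<Longrightarrow> trig_sum (\<lambda>y. \<Sum>i\<in>I. f i y)"
  by (induction I rule: infinite_finite_induct) (auto intro: trig_sum_const trig_sum.add)

text \<open>In polar form the argument of a coefficient goes into the phase of the cosine; the
  imaginary part needs an additional shift by a quarter period.\<close>

lemma trig_sum_apoly: "trig_sum (\<lambda>y. Re (apoly a N (spt 0 y)))" "trig_sum (\<lambda>y. Im (apoly a N (spt 0 y)))"
proof -
  have e: "Re (a n * exp (of_nat n * spt 0 y)) = cmod (a n) * cos (real n * y - (- Arg (a n)))"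
    "Im (a n * exp (of_nat n * spt 0 y)) = cmod (a n) * cos (real n * y - (pi/2 - Arg (a n)))" for n y
  proof -
    have "a n * exp (of_nat n * spt 0 y) = rcis (cmod (a n)) (Arg (a n)) * cis (real n * y)"
      by (simp add: rcis_cmod_Arg spt_def cis_conv_exp mult_ac)
    also have "\<dots> = rcis (cmod (a n)) (Arg (a n) + real n * y)" by (simp add: rcis_def cis_mult)
    finally have *: "a n * exp (of_nat n * spt 0 y) = rcis (cmod (a n)) (Arg (a n) + real n * y)" .
    have "cos (real n * y - (pi/2 - Arg (a n))) = cos (pi / 2 - (Arg (a n) + real n * y))"
      using cos_minus[of "real n * y - (pi/2 - Arg (a n))"] by (simp add: algebra_simps)
    then show "Re (a n * exp (of_nat n * spt 0 y)) = cmod (a n) * cos (real n * y - (- Arg (a n)))"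
      "Im (a n * exp (of_nat n * spt 0 y)) = cmod (a n) * cos (real n * y - (pi/2 - Arg (a n)))"
      unfolding * by (simp_all add: add.commute cos_sin_eq[symmetric] sin_cos_eq)
  qed
  show "trig_sum (\<lambda>y. Re (apoly a N (spt 0 y)))" "trig_sum (\<lambda>y. Im (apoly a N (spt 0 y)))"
    unfolding apoly_def Re_sum Im_sum e by (intro trig_sum_sum trig_sum.base)+
qed

lemma trig_sum_reg_sq: "trig_sum (\<lambda>y. reg_sq I a zero_coef N e (spt 0 y))"
  unfolding reg_sq_def hpoly_zero cmod_power2 unfolding power2_eq_square
  by (intro trig_sum.add trig_sum_sum trig_sum_mult trig_sum_apoly trig_sum_const)

lemma trig_sum_polynomial:
  assumes "real_polynomial_function g" "trig_sum Q"
  shows "trig_sum (\<lambda>y. g (Q y :: real))"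
  using assms(1)
proof induction
  case (linear f)
  then have "f (Q y) = Q y * f 1" for y
    using linear_cmul[of f "Q y" 1] bounded_linear.linear by (metis mult.right_neutral real_scaleR_def)
  then show ?case using trig_sum_mult[OF assms(2) trig_sum_const[of "f 1"]] by simp
qed (auto intro: trig_sum_const trig_sum.add trig_sum_mult)

lemma trig_sum_continuous: "trig_sum T \<Longrightarrow> continuous_on UNIV T"
  by (induction rule: trig_sum.induct) (auto intro!: continuous_intros)

text \<open>A cosine of frequency \<open>n\<close> is extended by the factor
  \<open>exp (n * s)\<close>, exactly the factor its Poisson integral produces. All clauses are
  compatible with addition, so the induction closes.\<close>

lemma trig_sum_harmonic_extension:
  assumes "trig_sum T"
  shows "\<exists>H Hs Hss Hy Hyy. strip_C2 H Hs Hss Hy Hyy \<and> (\<forall>s y. Hss s y + Hyy s y = 0) \<and>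
    (\<forall>y. H 0 y = T y) \<and> (\<exists>B. \<forall>s y. s \<le> 0 \<longrightarrow> \<bar>H s y\<bar> \<le> B) \<and>
    (\<forall>t a. t > 0 \<longrightarrow> H (- t) a = (\<integral>y. poisson t (a - 2 * pi * y) * T (2 * pi * y) \<partial>circle))"
  using assms
proof induction
  case (base A n b)
  let ?H = "\<lambda>s y. A * (exp (real n * s) * cos (real n * y - b))"
  have per: "cos (real n * (y + 2 * pi) - b) = cos (real n * y - b)" "sin (real n * (y + 2 * pi) - b) = sin (real n * y - b)" for y
    using cos.plus_of_int[of "real n * y - b" "int n"] sin.plus_of_int[of "real n * y - b" "int n"]
    by (simp_all add: algebra_simps)
  have "strip_C2 ?H (\<lambda>s y. A * (real n * exp (real n * s) * cos (real n * y - b)))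
     (\<lambda>s y. A * ((real n)\<^sup>2 * exp (real n * s) * cos (real n * y - b)))
     (\<lambda>s y. - (A * (exp (real n * s) * real n * sin (real n * y - b))))
     (\<lambda>s y. - (A * (exp (real n * s) * (real n)\<^sup>2 * cos (real n * y - b))))"
    unfolding strip_C2_def
    by (intro conjI allI) (auto intro!: derivative_eq_intros continuous_intros simp: per power2_eq_square)
  moreover have "\<bar>?H s y\<bar> \<le> \<bar>A\<bar>" if "s \<le> 0" for s y
  proof -
    have "exp (real n * s) * \<bar>cos (real n * y - b)\<bar> \<le> 1"
      using that by (intro mult_le_one) (auto simp: mult_nonneg_nonpos)
    then show ?thesis by (simp add: abs_mult mult_left_le)
  qed
  moreover have "?H (- t) a = (\<integral>y. poisson t (a - 2 * pi * y) * (A * cos (real n * (2 * pi * y) - b)) \<partial>circle)" if "t > 0" for t a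
    using arg_cong[OF poisson_integral_cos[OF that, of a n b], of "(*) A"]
    by (simp add: integral_mult_right_zero[symmetric] mult_ac del: integral_mult_right_zero)
  ultimately show ?case
    by (intro exI[of _ ?H] exI conjI) (auto simp: algebra_simps)
next
  case (add f g)
  from add.IH(1) obtain H Hs Hss Hy Hyy B where
   H: "strip_C2 H Hs Hss Hy Hyy" "\<forall>s y. Hss s y + Hyy s y = 0" "\<forall>y. H 0 y = f y" "\<forall>s y. s \<le> 0 \<longrightarrow> \<bar>H s y\<bar> \<le> B"
    "\<forall>t a. t > 0 \<longrightarrow> H (- t) a = (\<integral>y. poisson t (a - 2 * pi * y) * f (2 * pi * y) \<partial>circle)"
    by (elim exE conjE) (rule that)
  from add.IH(2) obtain K Ks Kss Ky Kyy C where
   K: "strip_C2 K Ks Kss Ky Kyy" "\<forall>s y. Kss s y + Kyy s y = 0" "\<forall>y. K 0 y = g y" "\<forall>s y. s \<le> 0 \<longrightarrow> \<bar>K s y\<bar> \<le> C"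
    "\<forall>t a. t > 0 \<longrightarrow> K (- t) a = (\<integral>y. poisson t (a - 2 * pi * y) * g (2 * pi * y) \<partial>circle)"
    by (elim exE conjE) (rule that)
  have "\<bar>1 * H s y + 1 * K s y\<bar> \<le> B + C" if "s \<le> 0" for s y
    using H(4)[rule_format, OF that, of y] K(4)[rule_format, OF that, of y] by linarith
  moreover have "1 * H (- t) a + 1 * K (- t) a = (\<integral>y. poisson t (a - 2 * pi * y) * (f (2 * pi * y) + g (2 * pi * y)) \<partial>circle)" if "t > 0" for t a
  proof -
    have "integrable circle (\<lambda>y. poisson t (a - 2 * pi * y) * u (2 * pi * y))" if "trig_sum u" for u
    proof -
      have "continuous_on {0..1} (\<lambda>x. u (2 * pi * x))"
        by (rule continuous_on_compose2[OF trig_sum_continuous[OF that]]) (auto intro!: continuous_intros)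
      then show ?thesis
        by (intro circle_integral continuous_on_mult continuous_on_poisson \<open>t > 0\<close>) (auto intro!: continuous_intros)
    qed
    then show ?thesis using H(5) K(5) add.hyps that by (simp add: distrib_left)
  qed
  moreover have "1 * Hss s y + 1 * Kss s y + (1 * Hyy s y + 1 * Kyy s y) = 0" for s y
    using H(2)[rule_format, of s y] K(2)[rule_format, of s y] by linarith
  moreover have "1 * H 0 y + 1 * K 0 y = f y + g y" for y using H(3) K(3) by simp
  ultimately show ?case
    using strip_C2_lincomb[OF H(1) K(1), of 1 1] by blast
qed

text \<open>The maximum principle compares a subharmonic power with a harmonic function lying above
  it on the circle. The boundary values are no trigonometric polynomial because of the power, but a
  polynomial in \<open>reg_sq\<close> is one, and its extension is explicit. So the power is
  approximated uniformly on the range of \<open>reg_sq\<close>.\<close>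

lemma poisson_majorant:
  assumes e: "e > 0" and be: "0 < be" "be \<le> 1" and t: "t > 0"
  shows "reg_sq I a zero_coef N e (spt (- t) y) powr be \<le>
    (\<integral>x. poisson t (y - 2 * pi * x) * reg_sq I a zero_coef N e (spt 0 (2 * pi * x)) powr be \<partial>circle)"
proof (rule field_le_epsilon)
  fix \<eta> :: real assume \<eta>: "\<eta> > 0"
  let ?V = "\<lambda>s y. reg_sq I a zero_coef N e (spt s y) powr be"
  obtain C where C: "\<And>s y. s \<le> 0 \<Longrightarrow> reg_sq I a zero_coef N e (spt s y) \<le> C" using reg_sq_bounded by metis
  have Q: "reg_sq I a zero_coef N e (spt 0 y) \<in> {e..C}" for y
    using C[of 0 y] by (auto simp: reg_sq_def intro!: sum_nonneg)
  \<comment> \<open>The range stays away from 0 by \<open>e\<close>.\<close>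
  have "continuous_on {e..C} (\<lambda>x. x powr be)" using e by (intro continuous_intros) auto
  then obtain g where g: "real_polynomial_function g" "\<And>x. x \<in> {e..C} \<Longrightarrow> \<bar>x powr be - g x\<bar> < \<eta> / 2"
    by (rule Stone_Weierstrass_real_polynomial_function[OF compact_Icc, where e = "\<eta> / 2"]) (use \<eta> in auto)
  \<comment> \<open>Half of the tolerance is added, so that the approximant lies above the boundary
    values and exceeds them by at most \<open>\<eta>\<close>.\<close>
  define T where "T y = g (reg_sq I a zero_coef N e (spt 0 y)) + \<eta> / 2" for y
  have T: "trig_sum T" unfolding T_def by (rule trig_sum.add[OF trig_sum_polynomial[OF g(1) trig_sum_reg_sq] trig_sum_const])
  have VT: "?V 0 y \<le> T y" "T y \<le> ?V 0 y + \<eta>" for y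
    using g(2)[OF Q[of y]] by (auto simp: T_def abs_if split: if_splits)
  obtain H Hs Hss Hy Hyy B where
   H: "strip_C2 H Hs Hss Hy Hyy" "\<forall>s y. Hss s y + Hyy s y = 0" "\<forall>y. H 0 y = T y" "\<forall>s y. s \<le> 0 \<longrightarrow> \<bar>H s y\<bar> \<le> B"
    "\<forall>t a. t > 0 \<longrightarrow> H (- t) a = (\<integral>y. poisson t (a - 2 * pi * y) * T (2 * pi * y) \<partial>circle)"
    using trig_sum_harmonic_extension[OF T] by blast
  obtain B' where B': "\<forall>s y. s \<le> 0 \<longrightarrow> ?V s y \<le> B'" using reg_sq_powr_bounded[OF e, of be I a zero_coef N] be by force
  note C2 = strip_C2_lincomb[OF strip_C2_reg_pow[OF e, of I a zero_coef N be] H(1), of 1 "-1"]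
  have "1 * ?V (- t) y + (-1) * H (- t) y \<le> 0"
  proof (rule max_principle[OF C2])
    fix s y :: real
    have "reg_pow_d2 1 be I a zero_coef N e (spt s y) + reg_pow_d2 \<i> be I a zero_coef N e (spt s y) \<ge> 0"
    proof (rule order_trans[OF _ laplacian_ge_analytic[OF e be]])
      show "0 \<le> 4 * be\<^sup>2 * reg_sq I a zero_coef N e (spt s y) powr (be - 1) * energy I a zero_coef N (spt s y)"
        by (intro mult_nonneg_nonneg energy_nonneg) auto
    qed
    then show "1 * reg_pow_d2 1 be I a zero_coef N e (spt s y) + - 1 * Hss s y + (1 * reg_pow_d2 \<i> be I a zero_coef N e (spt s y) + - 1 * Hyy s y) \<ge> 0"
      using H(2)[rule_format, of s y] by linarith
  next
    fix s y :: real assume "s \<le> 0"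
    then have "\<bar>H s y\<bar> \<le> B" "?V s y \<le> B'" using H(4) B' by blast+
    then show "1 * ?V s y + - 1 * H s y \<le> B' + B" by linarith
  qed (use VT H(3) t in auto)
  then have "?V (- t) y \<le> (\<integral>x. poisson t (y - 2 * pi * x) * T (2 * pi * x) \<partial>circle)" using H(5) t by simp
  also have "\<dots> \<le> (\<integral>x. poisson t (y - 2 * pi * x) * (?V 0 (2 * pi * x) + \<eta>) \<partial>circle)"
  proof (rule integral_mono)
    have "continuous_on {0..1} (\<lambda>x. T (2 * pi * x))"
      by (rule continuous_on_compose2[OF trig_sum_continuous[OF T]]) (auto intro!: continuous_intros)
    then show "integrable circle (\<lambda>x. poisson t (y - 2 * pi * x) * T (2 * pi * x))"
      by (intro circle_integral continuous_on_mult continuous_on_poisson t) (auto intro!: continuous_intros)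
    show "integrable circle (\<lambda>x. poisson t (y - 2 * pi * x) * (?V 0 (2 * pi * x) + \<eta>))"
      by (intro circle_integral continuous_intros t e)
    show "poisson t (y - 2 * pi * x) * T (2 * pi * x) \<le> poisson t (y - 2 * pi * x) * (?V 0 (2 * pi * x) + \<eta>)" for x
      by (intro mult_left_mono VT poisson_nonneg t)
  qed
  also have "\<dots> = (\<integral>x. poisson t (y - 2 * pi * x) * ?V 0 (2 * pi * x) + \<eta> * poisson t (y - 2 * pi * x) \<partial>circle)"
    by (simp add: algebra_simps)
  also have "\<dots> = (\<integral>x. poisson t (y - 2 * pi * x) * ?V 0 (2 * pi * x) \<partial>circle) + \<eta> * (\<integral>x. poisson t (y - 2 * pi * x) \<partial>circle)"
    by (subst Bochner_Integration.integral_add) (auto intro!: circle_integral continuous_intros t e)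
  finally show "?V (- t) y \<le> (\<integral>x. poisson t (y - 2 * pi * x) * ?V 0 (2 * pi * x) \<partial>circle) + \<eta>"
    by (simp add: poisson_integral_one[OF t])
qed

section \<open>The maximal inequality on square-integrable functions\<close>

lemma poisson_minus: "poisson t (- th) = poisson t th"
  by (simp add: poisson_def)

lemma borel_measurable_poisson [measurable (raw)]:
  assumes [measurable]: "f \<in> borel_measurable M" "g \<in> borel_measurable M"
  shows "(\<lambda>x. poisson (f x) (g x)) \<in> borel_measurable M"
proof -
  have [measurable]: "(cos :: real \<Rightarrow> real) \<in> borel_measurable borel"
    by (intro borel_measurable_continuous_onI continuous_intros)
  show ?thesis unfolding poisson_def sinh_def cosh_def by measurable
qed

lemma poisson_nn_integral_one: "t > 0 \<Longrightarrow> (\<integral>\<^sup>+y. ennreal (poisson t (2 * pi * (a - y))) \<partial>circle) = 1"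
proof -
  assume t: "t > 0"
  have "integrable circle (\<lambda>y. poisson t (2 * pi * a - 2 * pi * y))"
    by (intro circle_integral continuous_intros t)
  then show ?thesis using poisson_integral_one[OF t, of "2 * pi * a"] poisson_nonneg[OF t]
    by (simp add: nn_integral_eq_integral right_diff_distrib)
qed

text \<open>Expanding one kernel into cosines reduces the claim to
  \<open>poisson_integral_cos\<close>: the decay factors multiply, so the times add.\<close>

lemma poisson_semigroup:
  assumes s: "s > 0" and t: "t > 0"
  shows "(\<integral>y. poisson s (a - 2 * pi * y) * poisson t (2 * pi * y - b) \<partial>circle) = poisson (s + t) (a - b)"
proof -
  let ?f = "\<lambda>n y. cos_weight n * exp (- (real n * t)) * (poisson s (a - 2 * pi * y) * cos (real n * (2 * pi * y) - real n * b))"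
  have ec0: "cos_weight m \<ge> 0" for m by (simp add: cos_weight_def)
  have sums: "(\<lambda>n. ?f n y) sums (poisson s (a - 2 * pi * y) * poisson t (2 * pi * y - b))" for y
    using sums_mult[OF poisson_sums[OF t, of "2 * pi * y - b"], of "poisson s (a - 2 * pi * y)"]
    by (simp add: mult_ac right_diff_distrib)
  have int: "integrable circle (?f n)" for n
    by (intro circle_integral continuous_intros s)
  have intp: "integrable circle (\<lambda>y. poisson s (a - 2 * pi * y))"
    by (intro circle_integral continuous_intros s)
  have bnd: "norm (?f n y) \<le> cos_weight n * exp (- (real n * t)) * poisson s (a - 2 * pi * y)" for n y
  proof -
    have "\<bar>poisson s (a - 2 * pi * y) * cos (real n * (2 * pi * y) - real n * b)\<bar> \<le> poisson s (a - 2 * pi * y)"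
      using poisson_nonneg[OF s] by (simp add: abs_mult mult_left_le)
    then show ?thesis using ec0[of n]
      by (simp only: real_norm_def abs_mult[of "cos_weight n * exp (- (real n * t))"] abs_of_nonneg mult_nonneg_nonneg exp_ge_zero)
        (intro mult_left_mono, auto)
  qed
  have "(\<integral>y. (\<Sum>n. ?f n y) \<partial>circle) = (\<Sum>n. (\<integral>y. ?f n y \<partial>circle))"
  proof (rule integral_suminf[OF int])
    show "AE y in circle. summable (\<lambda>n. norm (?f n y))"
      by (intro AE_I2 summable_comparison_test'[OF summable_mult2[OF summable_exp[OF t]], of 0])
        (use bnd in auto)
    have "norm (\<integral>y. norm (?f n y) \<partial>circle) \<le> cos_weight n * exp (- (real n * t))" for n
    proof -
      have "(\<integral>y. norm (?f n y) \<partial>circle) \<le> (\<integral>y. cos_weight n * exp (- (real n * t)) * poisson s (a - 2 * pi * y) \<partial>circle)"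
        by (intro integral_mono integrable_norm int bnd integrable_mult_right intp)
      also have "\<dots> = cos_weight n * exp (- (real n * t))"
        using poisson_integral_one[OF s, of a] by simp
      finally have "(\<integral>y. norm (?f n y) \<partial>circle) \<le> cos_weight n * exp (- (real n * t))" .
      moreover have "(\<integral>y. norm (?f n y) \<partial>circle) \<ge> 0" by simp
      ultimately show ?thesis by simp
    qed
    then show "summable (\<lambda>m. \<integral>y. norm (?f m y) \<partial>circle)"
      by (intro summable_comparison_test'[OF summable_exp[OF t], of 0]) auto
  qed
  also have "(\<lambda>n. (\<integral>y. ?f n y \<partial>circle)) = (\<lambda>n. cos_weight n * exp (- (real n * (s + t))) * cos (real n * (a - b)))"
    using poisson_integral_cos[OF s, of a]
    by (auto simp: right_diff_distrib exp_add[symmetric] algebra_simps)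
  also have "(\<Sum>n. cos_weight n * exp (- (real n * (s + t))) * cos (real n * (a - b))) = poisson (s + t) (a - b)"
    using poisson_sums[of "s + t" "a - b"] s t by (simp add: sums_iff)
  finally show ?thesis using sums by (simp add: sums_iff)
qed

lemma poisson_semigroup_nn:
  assumes s: "s > 0" and t: "t > 0"
  shows "(\<integral>\<^sup>+y. ennreal (poisson s (2 * pi * (x - y))) * ennreal (poisson t (2 * pi * (x' - y))) \<partial>circle) = ennreal (poisson (s + t) (2 * pi * (x - x')))"
proof -
  have "(\<integral>\<^sup>+y. ennreal (poisson s (2 * pi * (x - y))) * ennreal (poisson t (2 * pi * (x' - y))) \<partial>circle)
     = (\<integral>\<^sup>+y. ennreal (poisson s (2 * pi * x - 2 * pi * y) * poisson t (2 * pi * y - 2 * pi * x')) \<partial>circle)"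
    using poisson_nonneg[OF s] poisson_nonneg[OF t] poisson_minus[of t]
    by (intro nn_integral_cong) (metis (no_types, opaque_lifting) ennreal_mult minus_diff_eq right_diff_distrib)
  also have "\<dots> = ennreal (\<integral>y. poisson s (2 * pi * x - 2 * pi * y) * poisson t (2 * pi * y - 2 * pi * x') \<partial>circle)"
    using poisson_nonneg[OF s] poisson_nonneg[OF t]
    by (intro nn_integral_eq_integral circle_integral continuous_intros s t) auto
  finally show ?thesis unfolding poisson_semigroup[OF s t] by (simp add: right_diff_distrib)
qed

text \<open>If \<open>v\<close> is the larger time, the total is at most \<open>2 * v\<close>, and
  \<open>sinh (2 * v) = 2 * sinh v * cosh v <= 4 * sinh v\<close> because \<open>cosh v <= 2\<close>
  for \<open>v <= 1\<close>; the denominator only grows with time.\<close>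

lemma poisson_doubling:
  assumes s: "0 < s" "s \<le> 1" and t: "0 < t" "t \<le> 1"
  shows "poisson (s + t) th \<le> 4 * (poisson s th + poisson t th)"
proof -
  have main: "poisson (u + v) th \<le> 4 * poisson v th" if "0 < u" "u \<le> v" "v \<le> 1" for u v :: real
  proof -
    have "exp v \<le> 3" using that exp_le exp_le_cancel_iff[of v 1] by linarith
    moreover have "exp (- v) \<le> 1" using that by simp
    moreover have "cosh v = (exp v + exp (- v)) / 2" by (simp add: cosh_def)
    ultimately have ch: "cosh v \<le> 2" by argo
    have "sinh (u + v) \<le> sinh (2 * v)" using that by simp
    also have "\<dots> = 2 * sinh v * cosh v" by (simp add: sinh_double)
    also have "\<dots> \<le> 2 * sinh v * 2" using that ch by (intro mult_left_mono) auto
    finally have sh: "sinh (u + v) \<le> 4 * sinh v" by simp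
    have "cosh v \<le> cosh (u + v)" using that by (subst cosh_real_nonneg_le_iff) auto
    moreover have "0 < cosh v - cos th" using cosh_gt_cos[of v th] that by auto
    ultimately have "sinh (u + v) / (cosh (u + v) - cos th) \<le> 4 * sinh v / (cosh v - cos th)"
      using sh that by (intro frac_le) auto
    then show ?thesis by (simp add: poisson_def)
  qed
  show ?thesis
  proof (cases "s \<le> t")
    case True
    then show ?thesis using main[of s t] poisson_nonneg[of s th] s t by auto
  next
    case False
    then show ?thesis using main[of t s] poisson_nonneg[of t th] s t by (auto simp: add.commute)
  qed
qed

definition poisson_mean :: "real \<Rightarrow> (real \<Rightarrow> ennreal) \<Rightarrow> real \<Rightarrow> ennreal" where
  "poisson_mean t g x = (\<integral>\<^sup>+y. ennreal (poisson t (2 * pi * (x - y))) * g y \<partial>circle)"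

text \<open>With finitely many times the supremum is attained (for \<open>m > 0\<close>) and some
  finite constant is available from the start; the estimate below is uniform in
  \<open>m\<close>.\<close>

definition poisson_max :: "nat \<Rightarrow> (nat \<Rightarrow> real) \<Rightarrow> (real \<Rightarrow> ennreal) \<Rightarrow> real \<Rightarrow> ennreal" where
  "poisson_max m t g x = (SUP j\<in>{..<m}. poisson_mean (t j) g x)"

interpretation CC: pair_sigma_finite circle circle
  by standard

lemma measurable_poisson_mean [measurable]:
  assumes [measurable]: "g \<in> borel_measurable circle"
  shows "poisson_mean t g \<in> borel_measurable circle"
  unfolding poisson_mean_def[abs_def] by measurable

lemma measurable_poisson_max [measurable]:
  assumes [measurable]: "g \<in> borel_measurable circle"
  shows "poisson_max m t g \<in> borel_measurable circle"
  unfolding poisson_max_def[abs_def] by measurable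

text \<open>Cauchy-Schwarz against the unit mass of the kernel in one variable, Fubini and unit mass
  in the other.\<close>

lemma poisson_mean_L2:
  assumes [measurable]: "g \<in> borel_measurable circle" and t: "t > 0"
  shows "(\<integral>\<^sup>+x. (poisson_mean t g x)\<^sup>2 \<partial>circle) \<le> (\<integral>\<^sup>+x. (g x)\<^sup>2 \<partial>circle)"
proof -
  have *: "(poisson_mean t g x)\<^sup>2 \<le> (\<integral>\<^sup>+y. ennreal (poisson t (2 * pi * (x - y))) * (g y)\<^sup>2 \<partial>circle)" for x
  proof -
    let ?r = "\<lambda>y. ennreal (sqrt (poisson t (2 * pi * (x - y))))"
    have rr: "?r y * ?r y = ennreal (poisson t (2 * pi * (x - y)))" for y
      using poisson_nonneg[OF t] by (simp add: ennreal_mult[symmetric])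
    have "poisson_mean t g x = (\<integral>\<^sup>+y. ?r y * (?r y * g y) \<partial>circle)"
      unfolding poisson_mean_def mult.assoc[symmetric] rr ..
    then have "(poisson_mean t g x)\<^sup>2 \<le> (\<integral>\<^sup>+y. (?r y)\<^sup>2 \<partial>circle) * (\<integral>\<^sup>+y. (?r y * g y)\<^sup>2 \<partial>circle)"
      using Cauchy_Schwarz_nn_integral[of ?r circle "\<lambda>y. ?r y * g y"] by simp
    also have "(\<integral>\<^sup>+y. (?r y)\<^sup>2 \<partial>circle) = 1"
      unfolding power2_eq_square rr by (rule poisson_nn_integral_one[OF t])
    also have "(\<lambda>y. (?r y * g y)\<^sup>2) = (\<lambda>y. ennreal (poisson t (2 * pi * (x - y))) * (g y)\<^sup>2)"
      unfolding power_mult_distrib unfolding power2_eq_square rr ..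
    finally show ?thesis by simp
  qed
  have "(\<integral>\<^sup>+x. (poisson_mean t g x)\<^sup>2 \<partial>circle) \<le> (\<integral>\<^sup>+x. \<integral>\<^sup>+y. ennreal (poisson t (2 * pi * (x - y))) * (g y)\<^sup>2 \<partial>circle \<partial>circle)"
    by (intro nn_integral_mono *)
  also have "\<dots> = (\<integral>\<^sup>+y. \<integral>\<^sup>+x. ennreal (poisson t (2 * pi * (x - y))) * (g y)\<^sup>2 \<partial>circle \<partial>circle)"
    by (rule CC.Fubini') measurable
  also have "\<dots> = (\<integral>\<^sup>+y. (\<integral>\<^sup>+x. ennreal (poisson t (2 * pi * (y - x))) \<partial>circle) * (g y)\<^sup>2 \<partial>circle)"
  proof (rule nn_integral_cong)
    fix y
    have "poisson t (2 * pi * (x - y)) = poisson t (2 * pi * (y - x))" for x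
      using poisson_minus[of t "2 * pi * (x - y)"] by (simp add: algebra_simps)
    then show "(\<integral>\<^sup>+x. ennreal (poisson t (2 * pi * (x - y))) * (g y)\<^sup>2 \<partial>circle) = (\<integral>\<^sup>+x. ennreal (poisson t (2 * pi * (y - x))) \<partial>circle) * (g y)\<^sup>2"
      by (subst nn_integral_multc[symmetric]) auto
  qed
  finally show ?thesis by (simp add: poisson_nn_integral_one[OF t])
qed

definition poisson_max_bound :: "nat \<Rightarrow> (nat \<Rightarrow> real) \<Rightarrow> real \<Rightarrow> bool" where
  "poisson_max_bound m t c \<longleftrightarrow> c \<ge> 0 \<and> (\<forall>g\<in>borel_measurable circle.
     (\<integral>\<^sup>+x. (poisson_max m t g x)\<^sup>2 \<partial>circle) \<le> ennreal c * (\<integral>\<^sup>+x. (g x)\<^sup>2 \<partial>circle))"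

text \<open>The square of a maximum is at most the sum of the squares. Only the finiteness of this
  constant matters: it starts the improvement below.\<close>

lemma poisson_max_bound_trivial:
  assumes "\<And>j. j < m \<Longrightarrow> t j > 0"
  shows "poisson_max_bound m t (real m)"
  unfolding poisson_max_bound_def
proof (intro conjI ballI)
  fix g :: "real \<Rightarrow> ennreal" assume [measurable]: "g \<in> borel_measurable circle"
  have "(poisson_max m t g x)\<^sup>2 \<le> (\<Sum>j<m. (poisson_mean (t j) g x)\<^sup>2)" for x
  proof (cases "m = 0")
    case False
    then have "poisson_max m t g x \<in> (\<lambda>j. poisson_mean (t j) g x) ` {..<m}"
      unfolding poisson_max_def by (subst Max_Sup[symmetric]) (auto intro!: Max_in)
    then obtain j where "j < m" "poisson_max m t g x = poisson_mean (t j) g x" by auto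
    then show ?thesis using member_le_sum[of j "{..<m}" "\<lambda>j. (poisson_mean (t j) g x)\<^sup>2"] by simp
  qed (simp add: poisson_max_def bot_ennreal)
  then have "(\<integral>\<^sup>+x. (poisson_max m t g x)\<^sup>2 \<partial>circle) \<le> (\<integral>\<^sup>+x. (\<Sum>j<m. (poisson_mean (t j) g x)\<^sup>2) \<partial>circle)"
    by (intro nn_integral_mono) auto
  also have "\<dots> = (\<Sum>j<m. (\<integral>\<^sup>+x. (poisson_mean (t j) g x)\<^sup>2 \<partial>circle))" by (rule nn_integral_sum) auto
  also have "\<dots> \<le> (\<Sum>j<m. (\<integral>\<^sup>+x. (g x)\<^sup>2 \<partial>circle))" by (intro sum_mono poisson_mean_L2) (auto intro: assms)
  finally show "(\<integral>\<^sup>+x. (poisson_max m t g x)\<^sup>2 \<partial>circle) \<le> ennreal (real m) * (\<integral>\<^sup>+x. (g x)\<^sup>2 \<partial>circle)"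
    by (simp add: ennreal_of_nat_eq_real_of_nat)
qed simp

text \<open>The \<open>TT*\<close> argument: linearise the supremum by a measurable choice of the time; the semigroup law and
  the doubling property bound the square of the adjoint by the maximal function itself. Iterating
  \<open>c \<mapsto> 8 * sqrt c\<close> removes the dependence on \<open>m\<close>.\<close>

lemma poisson_max_bound_improve:
  assumes t: "\<And>j. j < m \<Longrightarrow> 0 < t j \<and> t j \<le> 1" and m: "m > 0" and c: "poisson_max_bound m t c"
  shows "poisson_max_bound m t (8 * sqrt c)"
  unfolding poisson_max_bound_def
proof (intro conjI ballI)
  show "0 \<le> 8 * sqrt c" using c by (simp add: poisson_max_bound_def)
  fix g :: "real \<Rightarrow> ennreal" assume [measurable]: "g \<in> borel_measurable circle"
  define G where "G = (\<integral>\<^sup>+x. (g x)\<^sup>2 \<partial>circle)"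
  define \<psi> where "\<psi> = poisson_max m t g"
  have [measurable]: "\<psi> \<in> borel_measurable circle" unfolding \<psi>_def by measurable
  define S where "S = (\<integral>\<^sup>+x. (\<psi> x)\<^sup>2 \<partial>circle)"
  define W where "W = (\<integral>\<^sup>+x. \<psi> x * poisson_max m t \<psi> x \<partial>circle)"
  \<comment> \<open>The least maximising index is a measurable function of \<open>x\<close>, so the
    supremum becomes a linear operator with the variable time \<open>T x\<close>.\<close>
  define \<kappa> where "\<kappa> x = (LEAST j. j < m \<and> poisson_mean (t j) g x = \<psi> x)" for x
  have [measurable]: "\<kappa> \<in> measurable circle (count_space UNIV)"
    unfolding \<kappa>_def by measurable
  have \<kappa>: "\<kappa> x < m \<and> poisson_mean (t (\<kappa> x)) g x = \<psi> x" for x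
  proof -
    have "poisson_max m t g x \<in> (\<lambda>j. poisson_mean (t j) g x) ` {..<m}"
      unfolding poisson_max_def using m by (subst Max_Sup[symmetric]) (auto intro!: Max_in)
    then have "\<exists>j. j < m \<and> poisson_mean (t j) g x = \<psi> x" by (auto simp: \<psi>_def)
    then show ?thesis unfolding \<kappa>_def by (rule LeastI_ex)
  qed
  define T where "T x = t (\<kappa> x)" for x
  have [measurable]: "T \<in> borel_measurable circle"
    unfolding T_def by (rule measurable_compose[of \<kappa> _ "count_space UNIV"]) auto
  have T: "0 < T x" "T x \<le> 1" for x using t[of "\<kappa> x"] \<kappa>[of x] by (auto simp: T_def)
  let ?k = "\<lambda>x y. ennreal (poisson (T x) (2 * pi * (x - y)))"
  \<comment> \<open>The adjoint of the linearised operator applied to \<open>\<psi>\<close>; thus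
    \<open>S\<close> is the pairing of \<open>g\<close> with \<open>A\<close>.\<close>
  define A where "A y = (\<integral>\<^sup>+x. ?k x y * \<psi> x \<partial>circle)" for y
  have [measurable]: "A \<in> borel_measurable circle"
    unfolding A_def by measurable
  have \<psi>eq: "\<psi> x = (\<integral>\<^sup>+y. ?k x y * g y \<partial>circle)" for x
    using \<kappa>[of x] by (simp add: poisson_mean_def T_def)
  have "S = (\<integral>\<^sup>+x. \<integral>\<^sup>+y. \<psi> x * (?k x y * g y) \<partial>circle \<partial>circle)"
    unfolding S_def power2_eq_square
    by (intro nn_integral_cong) (subst nn_integral_cmult, auto simp: \<psi>eq[symmetric])
  also have "\<dots> = (\<integral>\<^sup>+y. \<integral>\<^sup>+x. \<psi> x * (?k x y * g y) \<partial>circle \<partial>circle)"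
    by (rule CC.Fubini') measurable
  also have "\<dots> = (\<integral>\<^sup>+y. g y * A y \<partial>circle)"
    unfolding A_def by (intro nn_integral_cong) (subst nn_integral_cmult[symmetric], auto simp: mult_ac)
  finally have "S\<^sup>2 \<le> G * (\<integral>\<^sup>+y. (A y)\<^sup>2 \<partial>circle)"
    using Cauchy_Schwarz_nn_integral[of g circle A] by (simp add: G_def)
  also have "(\<integral>\<^sup>+y. (A y)\<^sup>2 \<partial>circle) = (\<integral>\<^sup>+y. \<integral>\<^sup>+x. \<integral>\<^sup>+x'. (\<psi> x * \<psi> x') * (?k x y * ?k x' y) \<partial>circle \<partial>circle \<partial>circle)"
  proof (rule nn_integral_cong)
    fix y
    have "(A y)\<^sup>2 = (\<integral>\<^sup>+x. ?k x y * \<psi> x * A y \<partial>circle)"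
      unfolding power2_eq_square by (subst nn_integral_multc) (auto simp: A_def)
    also have "\<dots> = (\<integral>\<^sup>+x. \<integral>\<^sup>+x'. (\<psi> x * \<psi> x') * (?k x y * ?k x' y) \<partial>circle \<partial>circle)"
      unfolding A_def by (intro nn_integral_cong) (subst nn_integral_cmult[symmetric], auto simp: mult_ac)
    finally show "(A y)\<^sup>2 = (\<integral>\<^sup>+x. \<integral>\<^sup>+x'. (\<psi> x * \<psi> x') * (?k x y * ?k x' y) \<partial>circle \<partial>circle)" .
  qed
  also have "\<dots> = (\<integral>\<^sup>+x. \<integral>\<^sup>+y. \<integral>\<^sup>+x'. (\<psi> x * \<psi> x') * (?k x y * ?k x' y) \<partial>circle \<partial>circle \<partial>circle)"
    by (rule CC.Fubini') measurable
  also have "\<dots> = (\<integral>\<^sup>+x. \<integral>\<^sup>+x'. \<integral>\<^sup>+y. (\<psi> x * \<psi> x') * (?k x y * ?k x' y) \<partial>circle \<partial>circle \<partial>circle)"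
    by (rule nn_integral_cong, rule CC.Fubini') measurable
  also have "\<dots> = (\<integral>\<^sup>+x. \<integral>\<^sup>+x'. (\<psi> x * \<psi> x') * ennreal (poisson (T x + T x') (2 * pi * (x - x'))) \<partial>circle \<partial>circle)"
    by (intro nn_integral_cong) (subst nn_integral_cmult, auto simp: poisson_semigroup_nn T)
  \<comment> \<open>The semigroup law has produced the kernel at time \<open>T x + T x'\<close>.
    Doubling splits it into one kernel at \<open>T x\<close> and one at \<open>T x'\<close>; the two
    double integrals agree after exchanging \<open>x\<close> and \<open>x'\<close>, whence the
    constant 4 + 4 = 8.\<close>
  also have "\<dots> \<le> (\<integral>\<^sup>+x. \<integral>\<^sup>+x'. 4 * (\<psi> x * \<psi> x' * ?k x x') + 4 * (\<psi> x' * \<psi> x * ?k x' x) \<partial>circle \<partial>circle)"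
  proof (intro nn_integral_mono)
    fix x x'
    have sym: "poisson (T x') (2 * pi * (x - x')) = poisson (T x') (2 * pi * (x' - x))"
      using poisson_minus[of "T x'" "2 * pi * (x - x')"] by (simp add: algebra_simps)
    have "ennreal (poisson (T x + T x') (2 * pi * (x - x'))) \<le> ennreal (4 * (poisson (T x) (2 * pi * (x - x')) + poisson (T x') (2 * pi * (x' - x))))"
      using poisson_doubling[OF T[of x] T[of x'], of "2 * pi * (x - x')"] sym by (intro ennreal_leI) simp
    also have "\<dots> = 4 * (?k x x' + ?k x' x)"
      using poisson_nonneg[OF T(1)] by (simp add: ennreal_mult ennreal_plus)
    finally have "(\<psi> x * \<psi> x') * ennreal (poisson (T x + T x') (2 * pi * (x - x'))) \<le> (\<psi> x * \<psi> x') * (4 * (?k x x' + ?k x' x))"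
      by (intro mult_left_mono) auto
    then show "(\<psi> x * \<psi> x') * ennreal (poisson (T x + T x') (2 * pi * (x - x'))) \<le> 4 * (\<psi> x * \<psi> x' * ?k x x') + 4 * (\<psi> x' * \<psi> x * ?k x' x)"
      by (simp add: distrib_left mult_ac)
  qed
  also have "\<dots> = (\<integral>\<^sup>+x. (\<integral>\<^sup>+x'. 4 * (\<psi> x * \<psi> x' * ?k x x') \<partial>circle) + (\<integral>\<^sup>+x'. 4 * (\<psi> x' * \<psi> x * ?k x' x) \<partial>circle) \<partial>circle)"
    by (intro nn_integral_cong nn_integral_add) measurable
  also have "\<dots> = (\<integral>\<^sup>+x. \<integral>\<^sup>+x'. 4 * (\<psi> x * \<psi> x' * ?k x x') \<partial>circle \<partial>circle) + (\<integral>\<^sup>+x. \<integral>\<^sup>+x'. 4 * (\<psi> x' * \<psi> x * ?k x' x) \<partial>circle \<partial>circle)"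
    by (intro nn_integral_add) measurable
  also have "(\<integral>\<^sup>+x. \<integral>\<^sup>+x'. 4 * (\<psi> x' * \<psi> x * ?k x' x) \<partial>circle \<partial>circle) = (\<integral>\<^sup>+x'. \<integral>\<^sup>+x. 4 * (\<psi> x' * \<psi> x * ?k x' x) \<partial>circle \<partial>circle)"
    by (rule CC.Fubini') measurable
  also have "(\<integral>\<^sup>+x. \<integral>\<^sup>+x'. 4 * (\<psi> x * \<psi> x' * ?k x x') \<partial>circle \<partial>circle) + (\<integral>\<^sup>+x. \<integral>\<^sup>+x'. 4 * (\<psi> x * \<psi> x' * ?k x x') \<partial>circle \<partial>circle)
      = 8 * (\<integral>\<^sup>+x. \<psi> x * poisson_mean (T x) \<psi> x \<partial>circle)"
  proof -
    have [measurable]: "(\<lambda>x. poisson_mean (T x) \<psi> x) \<in> borel_measurable circle"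
      unfolding poisson_mean_def by measurable
    have "(\<integral>\<^sup>+x'. 4 * (\<psi> x * \<psi> x' * ?k x x') \<partial>circle) = 4 * (\<psi> x * poisson_mean (T x) \<psi> x)" for x
      unfolding poisson_mean_def
      by (subst nn_integral_cmult[symmetric], measurable, subst nn_integral_cmult[symmetric], measurable)
        (simp add: mult_ac)
    then have "(\<integral>\<^sup>+x. \<integral>\<^sup>+x'. 4 * (\<psi> x * \<psi> x' * ?k x x') \<partial>circle \<partial>circle) = (\<integral>\<^sup>+x. 4 * (\<psi> x * poisson_mean (T x) \<psi> x) \<partial>circle)"
      by (intro nn_integral_cong)
    also have "\<dots> = 4 * (\<integral>\<^sup>+x. \<psi> x * poisson_mean (T x) \<psi> x \<partial>circle)" by (rule nn_integral_cmult) measurable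
    finally have eq: "(\<integral>\<^sup>+x. \<integral>\<^sup>+x'. 4 * (\<psi> x * \<psi> x' * ?k x x') \<partial>circle \<partial>circle) = 4 * (\<integral>\<^sup>+x. \<psi> x * poisson_mean (T x) \<psi> x \<partial>circle)" .
    show ?thesis unfolding eq distrib_right[symmetric] by simp
  qed
  also have "\<dots> \<le> 8 * W"
    unfolding W_def poisson_max_def using \<kappa> by (intro mult_left_mono nn_integral_mono SUP_upper2[of "\<kappa> x" for x]) (auto simp: T_def)
  finally have 1: "S\<^sup>2 \<le> G * (8 * W)" by (simp add: mult_left_mono)
  have "W\<^sup>2 \<le> S * (\<integral>\<^sup>+x. (poisson_max m t \<psi> x)\<^sup>2 \<partial>circle)"
    unfolding W_def S_def by (rule Cauchy_Schwarz_nn_integral) measurable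
  also have "\<dots> \<le> S * (ennreal c * S)"
    using c unfolding S_def poisson_max_bound_def by (intro mult_left_mono) auto
  finally have 2: "W\<^sup>2 \<le> S * (ennreal c * S)" .
  have 3: "S \<le> ennreal c * G" using c unfolding S_def G_def poisson_max_bound_def \<psi>_def by auto
  have c0: "c \<ge> 0" using c by (simp add: poisson_max_bound_def)
  show "(\<integral>\<^sup>+x. (poisson_max m t g x)\<^sup>2 \<partial>circle) \<le> ennreal (8 * sqrt c) * (\<integral>\<^sup>+x. (g x)\<^sup>2 \<partial>circle)"
  \<comment> \<open>\<open>S^2 <= 8 * G * W\<close> and \<open>W^2 <= c * S^2\<close> give
    \<open>S^2 <= 8 * sqrt c * G * S\<close>. Cancelling \<open>S\<close> requires it to be finite,
    which the old constant \<open>c\<close> ensures once \<open>G\<close> is finite.\<close>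
  proof (cases "G = top")
    case True
    show ?thesis
    proof (cases "c = 0")
      case True then show ?thesis using 3 by (simp add: S_def \<psi>_def)
    next
      case False then show ?thesis using c0 True by (simp add: G_def[symmetric] ennreal_mult_top)
    qed
  next
    case False
    then obtain gr where gr: "G = ennreal gr" "gr \<ge> 0" by (cases G) auto
    have "S < top" using 3 c0 gr by (metis ennreal_mult_less_top ennreal_less_top order_le_less_trans)
    then obtain sr where sr: "S = ennreal sr" "sr \<ge> 0" by (cases S) auto
    have "W\<^sup>2 \<le> ennreal (c * sr^2)" using 2 c0 sr by (simp add: ennreal_mult[symmetric] power2_eq_square mult_ac)
    then have "W \<noteq> top" by (auto simp: power2_eq_square top_unique)
    then obtain wr where wr: "W = ennreal wr" "wr \<ge> 0" by (cases W) auto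
    have "wr\<^sup>2 \<le> c * sr\<^sup>2" using 2 c0 sr wr
      by (simp add: ennreal_mult[symmetric] ennreal_power ennreal_le_iff power2_eq_square mult_ac)
    then have "wr \<le> sqrt c * sr" using c0 sr wr
      by (intro power2_le_imp_le[of wr "sqrt c * sr"]) (auto simp: power_mult_distrib)
    moreover have "sr\<^sup>2 \<le> gr * (8 * wr)" using 1 gr sr wr
      by (simp add: ennreal_mult[symmetric] ennreal_power ennreal_le_iff ennreal_mult'[symmetric] flip: ennreal_numeral)
    ultimately have "sr * sr \<le> (8 * sqrt c * gr) * sr"
      using gr mult_left_mono[of wr "sqrt c * sr" "gr * 8"] by (simp add: power2_eq_square mult_ac)
    then have "sr \<le> 8 * sqrt c * gr"
      using sr c0 gr by (cases "sr = 0") auto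
    then show ?thesis
      using sr gr c0 unfolding \<psi>_def[symmetric] S_def[symmetric] G_def[symmetric]
      by (simp add: ennreal_mult[symmetric] ennreal_leI)
  qed
qed

text \<open>Instead of iterating, take the infimum of all admissible constants: it is at most
  \<open>8 * sqrt c\<close> for each admissible \<open>c\<close>, so its square is at most 64 times
  itself. The bound 65 leaves room to pick an admissible constant near the infimum.\<close>

theorem poisson_max_L2:
  assumes t: "\<And>j. j < m \<Longrightarrow> 0 < t j \<and> t j \<le> 1" and g: "g \<in> borel_measurable circle"
  shows "(\<integral>\<^sup>+x. (poisson_max m t g x)\<^sup>2 \<partial>circle) \<le> 65 * (\<integral>\<^sup>+x. (g x)\<^sup>2 \<partial>circle)"
proof (cases "m = 0")
  case True
  then show ?thesis by (simp add: poisson_max_def bot_ennreal)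
next
  case False
  define K where "K = {c. poisson_max_bound m t c}"
  have ne: "K \<noteq> {}" using poisson_max_bound_trivial[of m t] t by (auto simp: K_def)
  have bdd: "bdd_below K" by (rule bdd_belowI[of _ 0]) (auto simp: K_def poisson_max_bound_def)
  have le: "Inf K \<le> 8 * sqrt c" if "c \<in> K" for c
    using that False t by (intro cInf_lower bdd) (auto simp: K_def intro!: poisson_max_bound_improve)
  have c0: "Inf K \<ge> 0" by (rule cInf_greatest[OF ne]) (auto simp: K_def poisson_max_bound_def)
  have "(Inf K)\<^sup>2 / 64 \<le> c" if "c \<in> K" for c
  proof -
    have "c \<ge> 0" using that by (simp add: K_def poisson_max_bound_def)
    have "(Inf K)\<^sup>2 \<le> (8 * sqrt c)\<^sup>2" using le[OF that] c0 by (intro power_mono)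
    then show ?thesis using \<open>c \<ge> 0\<close> by (simp add: power_mult_distrib)
  qed
  then have "(Inf K)\<^sup>2 / 64 \<le> Inf K" by (intro cInf_greatest[OF ne])
  then have "Inf K * Inf K \<le> 64 * Inf K" by (simp add: power2_eq_square)
  then have "Inf K \<le> 64" using c0 by (cases "Inf K = 0") auto
  then have "Inf K < 65" by simp
  then obtain c where c: "c \<in> K" "c < 65" using cInf_less_iff[OF ne bdd] by auto
  have "(\<integral>\<^sup>+x. (poisson_max m t g x)\<^sup>2 \<partial>circle) \<le> ennreal c * (\<integral>\<^sup>+x. (g x)\<^sup>2 \<partial>circle)"
    using c g by (auto simp: K_def poisson_max_bound_def)
  also have "\<dots> \<le> 65 * (\<integral>\<^sup>+x. (g x)\<^sup>2 \<partial>circle)"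
    using c(2) by (intro mult_right_mono) (auto simp flip: ennreal_numeral intro: ennreal_leI)
  finally show ?thesis .
qed

section \<open>The square function in one variable\<close>

lemma circle_nn_mean:
  assumes "continuous_on UNIV (\<lambda>q. V (fst q) (snd q))" "\<And>y. V s y \<ge> 0"
  shows "(\<integral>\<^sup>+x. ennreal (V s (2 * pi * x)) \<partial>circle) = ennreal (mean V s)"
  unfolding mean_def by (rule circle_nn_integral[OF continuous_on_slice[OF assms(1)] assms(2)])

lemma geometric_mean_le_sum:
  fixes M R al :: real
  assumes "M \<ge> 0" "R \<ge> 0" "0 < al" "al < 1"
  shows "M powr (1 - al) * R powr al \<le> M + R"
proof -
  have "M powr (1 - al) * R powr al \<le> max M R powr (1 - al) * max M R powr al"
    using assms by (intro mult_mono powr_mono2) auto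
  also have "\<dots> = max M R" using assms by (simp add: powr_add[symmetric])
  finally show ?thesis using assms by auto
qed

text \<open>The negative power of \<open>q k\<close> is compensated by the same power of the largest
  weight \<open>q k0\<close>. Raising to the power \<open>al\<close> leaves a geometric mean of
  \<open>q k0 powr al\<close> and the weighted sum. This separates the maximal function from the
  Hardy-Stein sum.\<close>

lemma weighted_sum_powr_le:
  fixes q r :: "nat \<Rightarrow> real"
  assumes S: "finite S" "k0 \<in> S" and q: "\<And>k. k \<in> S \<Longrightarrow> 0 < q k \<and> q k \<le> q k0" and r: "\<And>k. k \<in> S \<Longrightarrow> r k \<ge> 0"
    and al: "0 < al" "al < 1"
  shows "(\<Sum>k\<in>S. r k) powr al \<le> q k0 powr al + (\<Sum>k\<in>S. q k powr (al - 1) * r k)"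
proof -
  let ?R = "\<Sum>k\<in>S. q k powr (al - 1) * r k"
  have R: "?R \<ge> 0" using r by (intro sum_nonneg) auto
  have q0: "q k0 > 0" using q S by auto
  have "r k \<le> q k0 powr (1 - al) * (q k powr (al - 1) * r k)" if "k \<in> S" for k
  proof -
    have "1 = q k powr (1 - al) * q k powr (al - 1)" using q[OF that] by (simp add: powr_add[symmetric])
    also have "\<dots> \<le> q k0 powr (1 - al) * q k powr (al - 1)"
      using q[OF that] al by (intro mult_right_mono powr_mono2) auto
    finally show ?thesis using mult_right_mono[OF _ r[OF that]] by (fastforce simp: mult.assoc)
  qed
  then have "(\<Sum>k\<in>S. r k) \<le> q k0 powr (1 - al) * ?R"
    unfolding sum_distrib_left by (intro sum_mono)
  then have "(\<Sum>k\<in>S. r k) powr al \<le> (q k0 powr (1 - al) * ?R) powr al"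
    using r al by (intro powr_mono2 sum_nonneg) auto
  also have "\<dots> = (q k0 powr al) powr (1 - al) * ?R powr al"
    using R q0 by (simp add: powr_mult powr_powr mult.commute)
  also have "\<dots> \<le> q k0 powr al + ?R"
    using R al by (intro geometric_mean_le_sum) auto
  finally show ?thesis .
qed

text \<open>The constant is 65 + 16, from the maximal inequality and from
  \<open>hardy_stein\<close>; neither depends on \<open>al\<close>.\<close>

lemma smooth_square_function:
  assumes al: "1/2 \<le> al" "al < 1" and e: "e > 0"
  shows "\<exists>t. (\<forall>k. t k \<in> {1 / 2 ^ (k + 1)..1 / 2 ^ k}) \<and>
    (\<integral>\<^sup>+x. ennreal ((\<Sum>k=1..K. (t k)\<^sup>2 * energy I a zero_coef N (spt (- t k) (2 * pi * x))) powr al) \<partial>circle)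
      \<le> 81 * (\<integral>\<^sup>+x. ennreal (reg_sq I a zero_coef N e (spt 0 (2 * pi * x)) powr al) \<partial>circle)"
proof -
  let ?Q = "\<lambda>s y. reg_sq I a zero_coef N e (spt s y)"
  let ?G = "\<lambda>s y. ?Q s y powr (al - 1) * energy I a zero_coef N (spt s y)"
  obtain t where t: "\<And>k. t k \<in> {1 / 2 ^ (k + 1)..1 / 2 ^ k}"
    and hs: "(\<Sum>k=1..K. (t k)\<^sup>2 * mean ?G (- t k)) \<le> 16 * mean (\<lambda>s y. ?Q s y powr al) 0"
    using hardy_stein[OF al(1) less_imp_le[OF al(2)] e, where K = K and I = I and a = a and N = N] by blast
  have tpos: "0 < t k" "t k \<le> 1" for k
  proof -
    have "0 < (1::real) / 2 ^ (k + 1)" "(1::real) / 2 ^ k \<le> 1" by auto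
    then show "0 < t k" "t k \<le> 1" using t[of k] unfolding atLeastAtMost_iff by linarith+
  qed
  have contE: "continuous_on UNIV (\<lambda>q. energy I a zero_coef N (spt (fst q) (snd q)))"
    unfolding energy_def by (intro continuous_intros)
  have contG: "continuous_on UNIV (\<lambda>q. ?G (fst q) (snd q))" by (intro continuous_intros e contE)
  have contQ: "continuous_on UNIV (\<lambda>q. ?Q (fst q) (snd q) powr be)" for be by (intro continuous_intros e)
  have G0: "?G s y \<ge> 0" for s y by (intro mult_nonneg_nonneg energy_nonneg) auto
  \<comment> \<open>Half of the power, so that the maximal function of \<open>g\<close> enters
    squared.\<close>
  define g where "g x = ennreal (?Q 0 (2 * pi * x) powr (al / 2))" for x
  have [measurable]: "g \<in> borel_measurable circle"
    unfolding g_def using continuous_on_slice[OF contQ]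
    by (intro measurable_compose[OF _ measurable_ennreal] measurable_circle borel_measurable_continuous_onI)
  define R where "R x = (\<Sum>k=1..K. (t k)\<^sup>2 * ?G (- t k) (2 * pi * x))" for x
  have R0: "R x \<ge> 0" for x unfolding R_def by (intro sum_nonneg mult_nonneg_nonneg G0) auto
  have contR: "continuous_on S R" for S
    unfolding R_def by (intro continuous_on_sum continuous_on_mult continuous_on_const continuous_on_slice[OF contG])
  \<comment> \<open>\<open>Suc K\<close> because \<open>poisson_max\<close> runs over the indices
    strictly below its first argument.\<close>
  have pt1: "ennreal ((\<Sum>k=1..K. (t k)\<^sup>2 * energy I a zero_coef N (spt (- t k) (2 * pi * x))) powr al) \<le> (poisson_max (Suc K) t g x)\<^sup>2 + ennreal (R x)" for x
  proof (cases "K = 0")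
    case False
    define q where "q k = ?Q (- t k) (2 * pi * x)" for k
    have "Max (q ` {1..K}) \<in> q ` {1..K}" using False by (intro Max_in) auto
    then obtain k0 where k0: "k0 \<in> {1..K}" "q k0 = Max (q ` {1..K})" by auto
    have "(\<Sum>k=1..K. (t k)\<^sup>2 * energy I a zero_coef N (spt (- t k) (2 * pi * x))) powr al
      \<le> q k0 powr al + (\<Sum>k=1..K. q k powr (al - 1) * ((t k)\<^sup>2 * energy I a zero_coef N (spt (- t k) (2 * pi * x))))"
      using al k0 reg_sq_pos[OF e] energy_nonneg
      by (intro weighted_sum_powr_le) (auto simp: q_def intro!: mult_nonneg_nonneg energy_nonneg)
    also have "(\<Sum>k=1..K. q k powr (al - 1) * ((t k)\<^sup>2 * energy I a zero_coef N (spt (- t k) (2 * pi * x)))) = R x"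
      unfolding R_def q_def by (intro sum.cong) auto
    finally have "ennreal ((\<Sum>k=1..K. (t k)\<^sup>2 * energy I a zero_coef N (spt (- t k) (2 * pi * x))) powr al) \<le> ennreal (q k0 powr al + R x)"
      by (rule ennreal_leI)
    also have "\<dots> = ennreal (q k0 powr al) + ennreal (R x)" using R0 by (simp add: ennreal_plus)
    also have "ennreal (q k0 powr al) \<le> (poisson_max (Suc K) t g x)\<^sup>2"
    proof -
      have "ennreal (q k0 powr (al / 2)) \<le> ennreal (\<integral>z. poisson (t k0) (2 * pi * x - 2 * pi * z) * ?Q 0 (2 * pi * z) powr (al / 2) \<partial>circle)"
        unfolding q_def using al by (intro ennreal_leI poisson_majorant e tpos) auto
      also have "\<dots> = (\<integral>\<^sup>+z. ennreal (poisson (t k0) (2 * pi * x - 2 * pi * z) * ?Q 0 (2 * pi * z) powr (al / 2)) \<partial>circle)"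
        by (rule nn_integral_eq_integral[symmetric])
          (auto intro!: circle_integral continuous_intros e tpos mult_nonneg_nonneg poisson_nonneg)
      also have "\<dots> = poisson_mean (t k0) g x"
        unfolding poisson_mean_def g_def by (simp add: right_diff_distrib ennreal_mult poisson_nonneg tpos)
      also have "\<dots> \<le> poisson_max (Suc K) t g x" unfolding poisson_max_def using k0 by (intro SUP_upper) auto
      finally have "(ennreal (q k0 powr (al / 2)))\<^sup>2 \<le> (poisson_max (Suc K) t g x)\<^sup>2" by (intro power_mono) auto
      moreover have "(q k0 powr (al / 2))\<^sup>2 = q k0 powr al"
        by (simp add: power2_eq_square powr_add[symmetric])
      ultimately show ?thesis by (simp add: ennreal_power)
    qed
    finally show ?thesis by (simp add: add_right_mono)
  qed simp
  have "(\<integral>\<^sup>+x. ennreal ((\<Sum>k=1..K. (t k)\<^sup>2 * energy I a zero_coef N (spt (- t k) (2 * pi * x))) powr al) \<partial>circle)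
     \<le> (\<integral>\<^sup>+x. (poisson_max (Suc K) t g x)\<^sup>2 + ennreal (R x) \<partial>circle)"
    by (intro nn_integral_mono pt1)
  also have "\<dots> = (\<integral>\<^sup>+x. (poisson_max (Suc K) t g x)\<^sup>2 \<partial>circle) + (\<integral>\<^sup>+x. ennreal (R x) \<partial>circle)"
  proof (rule nn_integral_add)
    show "(\<lambda>x. ennreal (R x)) \<in> borel_measurable circle"
      by (intro measurable_compose[OF _ measurable_ennreal] measurable_circle borel_measurable_continuous_onI contR)
  qed measurable
  also have "\<dots> \<le> 65 * (\<integral>\<^sup>+x. (g x)\<^sup>2 \<partial>circle) + 16 * ennreal (mean (\<lambda>s y. ?Q s y powr al) 0)"
  proof (rule add_mono)
    show "(\<integral>\<^sup>+x. (poisson_max (Suc K) t g x)\<^sup>2 \<partial>circle) \<le> 65 * (\<integral>\<^sup>+x. (g x)\<^sup>2 \<partial>circle)"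
      by (rule poisson_max_L2) (auto simp: tpos)
    have "integral {0..1} R = (\<Sum>k=1..K. (t k)\<^sup>2 * mean ?G (- t k))"
      unfolding R_def mean_def
      by (subst Henstock_Kurzweil_Integration.integral_sum)
        (auto intro!: integrable_continuous_interval continuous_on_mult continuous_on_const continuous_on_slice[OF contG])
    then have "(\<integral>\<^sup>+x. ennreal (R x) \<partial>circle) = ennreal (\<Sum>k=1..K. (t k)\<^sup>2 * mean ?G (- t k))"
      using circle_nn_integral[OF contR R0] by simp
    also have "\<dots> \<le> ennreal (16 * mean (\<lambda>s y. ?Q s y powr al) 0)" by (intro ennreal_leI hs)
    also have "\<dots> = 16 * ennreal (mean (\<lambda>s y. ?Q s y powr al) 0)" by (simp add: ennreal_mult')
    finally show "(\<integral>\<^sup>+x. ennreal (R x) \<partial>circle) \<le> 16 * ennreal (mean (\<lambda>s y. ?Q s y powr al) 0)" .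
  qed
  also have "ennreal (mean (\<lambda>s y. ?Q s y powr al) 0) = (\<integral>\<^sup>+x. ennreal (?Q 0 (2 * pi * x) powr al) \<partial>circle)"
    by (rule circle_nn_mean[symmetric]) (auto intro: contQ)
  also have "(\<lambda>x. (g x)\<^sup>2) = (\<lambda>x. ennreal (?Q 0 (2 * pi * x) powr al))"
  proof
    fix x
    have "(?Q 0 (2 * pi * x) powr (al / 2))\<^sup>2 = ?Q 0 (2 * pi * x) powr al"
      by (simp add: power2_eq_square powr_add[symmetric])
    then show "(g x)\<^sup>2 = ennreal (?Q 0 (2 * pi * x) powr al)"
      by (simp add: g_def ennreal_power)
  qed
  also have "65 * (\<integral>\<^sup>+x. ennreal (?Q 0 (2 * pi * x) powr al) \<partial>circle) + 16 * (\<integral>\<^sup>+x. ennreal (?Q 0 (2 * pi * x) powr al) \<partial>circle)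
      = 81 * (\<integral>\<^sup>+x. ennreal (?Q 0 (2 * pi * x) powr al) \<partial>circle)"
    unfolding distrib_right[symmetric] by simp
  finally show ?thesis using t by blast
qed

lemma reg_sq_powr_eps:
  assumes e: "e > 0" and al: "0 < al" "al \<le> 1"
  shows "(\<integral>\<^sup>+x. ennreal (reg_sq I a b N e (spt 0 (2 * pi * x)) powr al) \<partial>circle) \<le>
     (\<integral>\<^sup>+x. ennreal (reg_sq I a b N 0 (spt 0 (2 * pi * x)) powr al) \<partial>circle) + ennreal (e powr al)"
proof -
  have "(\<integral>\<^sup>+x. ennreal (reg_sq I a b N e (spt 0 (2 * pi * x)) powr al) \<partial>circle) \<le>
     (\<integral>\<^sup>+x. ennreal (reg_sq I a b N 0 (spt 0 (2 * pi * x)) powr al) + ennreal (e powr al) \<partial>circle)"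
  proof (intro nn_integral_mono)
    fix x
    have "reg_sq I a b N e (spt 0 (2 * pi * x)) powr al \<le> reg_sq I a b N 0 (spt 0 (2 * pi * x)) powr al + e powr al"
      unfolding reg_sq_def add_0_right using e al by (intro powr_add_le sum_nonneg) auto
    then show "ennreal (reg_sq I a b N e (spt 0 (2 * pi * x)) powr al) \<le> ennreal (reg_sq I a b N 0 (spt 0 (2 * pi * x)) powr al) + ennreal (e powr al)"
      by (simp add: ennreal_plus[symmetric] ennreal_leI del: ennreal_plus)
  qed
  also have "\<dots> = (\<integral>\<^sup>+x. ennreal (reg_sq I a b N 0 (spt 0 (2 * pi * x)) powr al) \<partial>circle) + ennreal (e powr al)"
  proof (subst nn_integral_add)
    have "continuous_on UNIV (\<lambda>x. reg_sq I a b N 0 (spt 0 (2 * pi * x)) powr al)"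
      using al by (intro continuous_on_powr' continuous_on_reg_sq continuous_on_spt continuous_intros)
        (auto simp: reg_sq_def intro!: sum_nonneg)
    then show "(\<lambda>x. ennreal (reg_sq I a b N 0 (spt 0 (2 * pi * x)) powr al)) \<in> borel_measurable circle"
      by (intro measurable_compose[OF _ measurable_ennreal] measurable_circle borel_measurable_continuous_onI)
  qed (auto simp: circle.emeasure_space_1[unfolded space_circle])
  finally show ?thesis .
qed

text \<open>Removes the regularising summand; \<open>A + 1\<close> in the choice of \<open>e\<close>
  avoids a division by 0.\<close>

lemma eps_limit:
  assumes al: "0 < al" and A: "A \<ge> 0" and le: "\<And>e. e > 0 \<Longrightarrow> L \<le> ennreal A * (R + ennreal (e powr al))"
  shows "L \<le> ennreal A * R"
proof (rule ennreal_le_epsilon)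
  fix \<eta> :: real assume \<eta>: "\<eta> > 0"
  define e where "e = (\<eta> / (A + 1)) powr (1 / al)"
  have "e > 0" using \<eta> A by (simp add: e_def)
  have ee: "e powr al = \<eta> / (A + 1)" using \<eta> A al by (simp add: e_def powr_powr)
  have "L \<le> ennreal A * R + ennreal A * ennreal (\<eta> / (A + 1))"
    using le[OF \<open>e > 0\<close>] by (simp add: ee distrib_left)
  also have "ennreal A * ennreal (\<eta> / (A + 1)) = ennreal (A * (\<eta> / (A + 1)))"
    using A \<eta> by (intro ennreal_mult[symmetric]) auto
  also have "\<dots> \<le> ennreal \<eta>" using A \<eta> by (intro ennreal_leI) (simp add: field_simps)
  finally show "L \<le> ennreal A * R + ennreal \<eta>" by (simp add: add_left_mono)
qed

text \<open>The condition \<open>b j 0 = 0\<close> makes the splitting into analytic and conjugate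
  analytic part unique. The index set is arbitrary, so each component may come with its own
  modulation.\<close>

theorem riesz_projection:
  assumes p: "1 < p" "p < 2" and J: "finite J" and b0: "\<And>j. j \<in> J \<Longrightarrow> b j 0 = 0"
  shows "(\<integral>\<^sup>+x. ennreal ((\<Sum>j\<in>J. (cmod (apoly (a j) N (spt 0 (2 * pi * x))))\<^sup>2) powr (p/2)) \<partial>circle)
     \<le> ennreal (2 / (p - 1)) * (\<integral>\<^sup>+x. ennreal (reg_sq J a b N 0 (spt 0 (2 * pi * x)) powr (p/2)) \<partial>circle)"
proof (rule eps_limit[where al = "p/2"])
  fix e :: real assume e: "e > 0"
  have c: "continuous_on UNIV (\<lambda>q. reg_sq J' a' b' N e (spt (fst q) (snd q)) powr (p/2))" for J' :: "'z set" and a' b'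
    by (intro continuous_intros e)
  have "(\<integral>\<^sup>+x. ennreal ((\<Sum>j\<in>J. (cmod (apoly (a j) N (spt 0 (2 * pi * x))))\<^sup>2) powr (p/2)) \<partial>circle)
    \<le> (\<integral>\<^sup>+x. ennreal (reg_sq (J \<times> UNIV) (join_coef a b) zero_coef N e (spt 0 (2 * pi * x)) powr (p/2)) \<partial>circle)"
  proof (intro nn_integral_mono ennreal_leI powr_mono2 sum_nonneg)
    fix x
    show "(\<Sum>j\<in>J. (cmod (apoly (a j) N (spt 0 (2 * pi * x))))\<^sup>2) \<le> reg_sq (J \<times> UNIV) (join_coef a b) zero_coef N e (spt 0 (2 * pi * x))"
      by (subst reg_sq_join_coef) (use e in \<open>auto simp: sum.distrib intro!: add_nonneg_nonneg sum_nonneg\<close>)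
  qed (use p in auto)
  also have "\<dots> = ennreal (mean (\<lambda>s y. reg_sq (J \<times> UNIV) (join_coef a b) zero_coef N e (spt s y) powr (p/2)) 0)"
    by (rule circle_nn_mean[OF c]) auto
  also have "\<dots> \<le> ennreal (2 / (p - 1) * mean (\<lambda>s y. reg_sq J a b N e (spt s y) powr (p/2)) 0)"
    by (intro ennreal_leI riesz_eps p e J b0)
  also have "\<dots> = ennreal (2 / (p - 1)) * ennreal (mean (\<lambda>s y. reg_sq J a b N e (spt s y) powr (p/2)) 0)"
    using p by (intro ennreal_mult') auto
  also have "ennreal (mean (\<lambda>s y. reg_sq J a b N e (spt s y) powr (p/2)) 0) = (\<integral>\<^sup>+x. ennreal (reg_sq J a b N e (spt 0 (2 * pi * x)) powr (p/2)) \<partial>circle)"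
    by (rule circle_nn_mean[OF c, symmetric]) auto
  also have "ennreal (2 / (p - 1)) * \<dots> \<le> ennreal (2 / (p - 1)) * ((\<integral>\<^sup>+x. ennreal (reg_sq J a b N 0 (spt 0 (2 * pi * x)) powr (p/2)) \<partial>circle) + ennreal (e powr (p/2)))"
    using p by (intro mult_left_mono reg_sq_powr_eps e) auto
  finally show "(\<integral>\<^sup>+x. ennreal ((\<Sum>j\<in>J. (cmod (apoly (a j) N (spt 0 (2 * pi * x))))\<^sup>2) powr (p/2)) \<partial>circle)
    \<le> ennreal (2 / (p - 1)) * ((\<integral>\<^sup>+x. ennreal (reg_sq J a b N 0 (spt 0 (2 * pi * x)) powr (p/2)) \<partial>circle) + ennreal (e powr (p/2)))" .
qed (use p in auto)

section \<open>From frequency tails to dyadic blocks\<close>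

definition tail_coef :: "real \<Rightarrow> nat \<Rightarrow> nat \<Rightarrow> (nat \<Rightarrow> complex) \<Rightarrow> nat \<Rightarrow> complex" where
  "tail_coef c j N v = (\<lambda>n. if n + j \<le> N then of_real c * v (n + j) else 0)"
text \<open>Multiplication by \<open>exp (- j z)\<close> moves the frequency \<open>j\<close> to 0.
  On the circle \<open>tail_coef\<close> then describes the analytic part of the product, and
  \<open>head_coef\<close> the conjugate of the rest: frequencies below \<open>j\<close> are
  reflected to positive ones, and the constant term is 0. So the Riesz projection cuts at
  \<open>j\<close>.\<close>

definition head_coef :: "real \<Rightarrow> nat \<Rightarrow> (nat \<Rightarrow> complex) \<Rightarrow> nat \<Rightarrow> complex" where
  "head_coef c j v = (\<lambda>m. if 1 \<le> m \<and> m \<le> j then cnj (of_real c * v (j - m)) else 0)"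

lemma cnj_spt0: "cnj (spt 0 y) = - spt 0 y"
  by (simp add: spt_def)

lemma exp_diff_nat: "j \<le> n \<Longrightarrow> exp (of_nat (n - j) * z) = exp (- (of_nat j * z)) * exp (of_nat n * (z::complex))"
  by (simp add: exp_add[symmetric] of_nat_diff algebra_simps)

lemma apoly_tail_coef:
  assumes "j \<le> N"
  shows "apoly (tail_coef c j N v) N z = exp (- (of_nat j * z)) * (of_real c * (\<Sum>n=j..N. v n * exp (of_nat n * z)))"
proof -
  have "apoly (tail_coef c j N v) N z = (\<Sum>n\<in>{..N - j}. of_real c * v (n + j) * exp (of_nat n * z))"
    unfolding apoly_def tail_coef_def using assms
    by (intro sum.mono_neutral_cong_right) auto
  also have "\<dots> = (\<Sum>n\<in>{j..N}. of_real c * v n * exp (of_nat (n - j) * z))"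
    using assms by (intro sum.reindex_bij_witness[where i = "\<lambda>n. n - j" and j = "\<lambda>n. n + j"]) auto
  also have "\<dots> = (\<Sum>n\<in>{j..N}. exp (- (of_nat j * z)) * (of_real c * (v n * exp (of_nat n * z))))"
  proof (intro sum.cong refl)
    fix n assume "n \<in> {j..N}"
    then show "of_real c * v n * exp (of_nat (n - j) * z) = exp (- (of_nat j * z)) * (of_real c * (v n * exp (of_nat n * z)))"
      by (subst exp_diff_nat) (auto simp only: atLeastAtMost_iff mult_ac)
  qed
  finally show ?thesis by (simp add: sum_distrib_left)
qed

lemma hpoly_tail_head:
  assumes "j \<le> N"
  shows "hpoly (tail_coef c j N v) (head_coef c j v) N (spt 0 y) = exp (- (of_nat j * spt 0 y)) * (of_real c * apoly v N (spt 0 y))"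
proof -
  let ?z = "spt 0 y"
  have "cnj (apoly (head_coef c j v) N ?z) = (\<Sum>m\<in>{1..j}. of_real c * v (j - m) * exp (- (of_nat m * ?z)))"
    unfolding apoly_def head_coef_def cnj_sum using assms
    by (intro sum.mono_neutral_cong_right) (auto simp: exp_cnj cnj_spt0)
  also have "\<dots> = (\<Sum>n\<in>{..<j}. exp (- (of_nat j * ?z)) * (of_real c * (v n * exp (of_nat n * ?z))))"
  proof (rule sum.reindex_bij_witness[where i = "\<lambda>n. j - n" and j = "\<lambda>m. j - m"])
    fix m assume "m \<in> {1..j}"
    then have "exp (- (of_nat j * ?z)) * exp (of_nat (j - m) * ?z) = exp (- (of_nat m * ?z))"
      by (simp add: exp_add[symmetric] of_nat_diff algebra_simps)
    then show "exp (- (of_nat j * ?z)) * (of_real c * (v (j - m) * exp (of_nat (j - m) * ?z))) = of_real c * v (j - m) * exp (- (of_nat m * ?z))"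
      by (metis (no_types, lifting) mult.assoc mult.left_commute)
  qed auto
  also have "\<dots> = exp (- (of_nat j * ?z)) * (of_real c * (\<Sum>n\<in>{..<j}. v n * exp (of_nat n * ?z)))"
    by (simp add: sum_distrib_left)
  moreover have "apoly v N ?z = (\<Sum>n\<in>{..<j}. v n * exp (of_nat n * ?z)) + (\<Sum>n=j..N. v n * exp (of_nat n * ?z))"
  proof -
    have "{..N} = {..<j} \<union> {j..N}" using assms by auto
    then show ?thesis unfolding apoly_def by (simp add: sum.union_disjoint ivl_disj_int)
  qed
  ultimately show ?thesis unfolding hpoly_def apoly_tail_coef[OF assms] by (simp add: distrib_left add.commute)
qed

lemma norm_exp_spt0 [simp]: "cmod (exp (- (of_nat j * spt 0 y))) = 1"
  by (simp add: spt_def)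

text \<open>Summation by parts, with the boundary term at \<open>Suc d\<close> kept on the left so
  that the induction on \<open>d\<close> closes. The last summand makes up for a negative
  \<open>m a\<close> and vanishes otherwise.\<close>

lemma abel_summation_bound:
  fixes T :: "nat \<Rightarrow> complex" and m :: "nat \<Rightarrow> real"
  assumes dec: "\<And>n. a \<le> n \<Longrightarrow> n < d \<Longrightarrow> m (Suc n) \<le> m n" and "a \<le> d"
  shows "cmod ((\<Sum>n=a..d. of_real (m n) * (T n - T (Suc n))) + of_real (m d) * T (Suc d))
     \<le> (\<Sum>j=a..d. (if j = a then m a else m (j - 1) - m j) * cmod (T j)) + (\<bar>m a\<bar> - m a) * cmod (T a)"
  using \<open>a \<le> d\<close> dec
proof (induction d rule: dec_induct)
  case base
  have "of_real (m a) * (T a - T (Suc a)) + of_real (m a) * T (Suc a) = of_real (m a) * T a" by (simp add: algebra_simps)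
  then show ?case by (simp add: norm_mult algebra_simps)
next
  case (step d)
  let ?S = "\<lambda>d. \<Sum>n=a..d. of_real (m n) * (T n - T (Suc n))"
  have eq: "?S (Suc d) + of_real (m (Suc d)) * T (Suc (Suc d)) = (?S d + of_real (m d) * T (Suc d)) + of_real (m (Suc d) - m d) * T (Suc d)"
    using step.hyps by (simp add: algebra_simps)
  have "cmod (?S (Suc d) + of_real (m (Suc d)) * T (Suc (Suc d))) \<le> cmod (?S d + of_real (m d) * T (Suc d)) + cmod (of_real (m (Suc d) - m d) * T (Suc d))"
    unfolding eq by (rule norm_triangle_ineq)
  also have "cmod (of_real (m (Suc d) - m d) * T (Suc d)) = (m d - m (Suc d)) * cmod (T (Suc d))"
    using step.prems[of d] step.hyps unfolding norm_mult norm_of_real by simp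
  finally show ?case using step.IH step.prems step.hyps by (simp add: less_Suc_eq)
qed

text \<open>Summation by parts bounds the sum by a combination of the \<open>cmod (T j)\<close>
  whose coefficients \<open>c j\<close> add up to \<open>2 * m a\<close>. Cauchy-Schwarz with these
  weights gives \<open>\<gamma> j = 2 * m a * c j\<close>, of total \<open>4 * (m a)^2\<close>. The
  weights do not depend on \<open>T\<close>, hence not on the point of the circle.\<close>

lemma abel_weights:
  fixes m :: "nat \<Rightarrow> real"
  assumes dec: "\<And>n. a \<le> n \<Longrightarrow> n < d \<Longrightarrow> m (Suc n) \<le> m n" and pos: "\<And>n. a \<le> n \<Longrightarrow> n \<le> d \<Longrightarrow> m n \<ge> 0" and ad: "a \<le> d"
  shows "\<exists>\<gamma>. (\<forall>j. \<gamma> j \<ge> 0) \<and> (\<forall>j. j \<notin> {a..Suc d} \<longrightarrow> \<gamma> j = 0) \<and> (\<Sum>j=a..Suc d. \<gamma> j) = 4 * (m a)\<^sup>2 \<and>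
    (\<forall>T :: nat \<Rightarrow> complex. (cmod (\<Sum>n=a..d. of_real (m n) * (T n - T (Suc n))))\<^sup>2 \<le> (\<Sum>j=a..Suc d. \<gamma> j * (cmod (T j))\<^sup>2))"
proof -
  define c where "c j = (if j \<notin> {a..Suc d} then 0 else if j = a then m a else if j = Suc d then m d else m (j - 1) - m j)" for j
  have c0: "c j \<ge> 0" for j
    using dec[of "j - 1"] pos[of a] pos[of d] ad by (auto simp: c_def)
  have csum: "(\<Sum>j=a..Suc d. c j) = 2 * m a"
  proof -
    have "(\<Sum>j=a..d. (if j = a then m a else m (j - 1) - m j)) = 2 * m a - m d"
      using ad by (induction d rule: dec_induct) auto
    moreover have "(\<Sum>j=a..d. c j) = (\<Sum>j=a..d. (if j = a then m a else m (j - 1) - m j))"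
      by (intro sum.cong) (auto simp: c_def)
    moreover have "(\<Sum>j=a..Suc d. c j) = (\<Sum>j=a..d. c j) + c (Suc d)" using ad by simp
    moreover have "c (Suc d) = m d" using ad by (simp add: c_def)
    ultimately show ?thesis by simp
  qed
  have main: "(cmod (\<Sum>n=a..d. of_real (m n) * (T n - T (Suc n))))\<^sup>2 \<le> (\<Sum>j=a..Suc d. 2 * m a * c j * (cmod (T j))\<^sup>2)" for T :: "nat \<Rightarrow> complex"
  proof -
    let ?S = "\<Sum>n=a..d. of_real (m n) * (T n - T (Suc n))"
    have "cmod ?S \<le> cmod (?S + of_real (m d) * T (Suc d)) + m d * cmod (T (Suc d))"
      using norm_triangle_ineq4[of "?S + of_real (m d) * T (Suc d)" "of_real (m d) * T (Suc d)"] pos[of d] ad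
      by (simp add: norm_mult)
    also have "cmod (?S + of_real (m d) * T (Suc d)) \<le> (\<Sum>j=a..d. (if j = a then m a else m (j - 1) - m j) * cmod (T j))"
      using abel_summation_bound[of a d m T, OF dec ad] pos[of a] ad by simp
    also have "\<dots> = (\<Sum>j=a..d. c j * cmod (T j))"
      by (intro sum.cong) (auto simp: c_def)
    also have "\<dots> + m d * cmod (T (Suc d)) = (\<Sum>j=a..Suc d. c j * cmod (T j))"
      using ad by (simp add: c_def)
    finally have "cmod ?S \<le> (\<Sum>j=a..Suc d. c j * cmod (T j))" by simp
    also have "\<dots> = (\<Sum>j=a..Suc d. sqrt (c j) * (sqrt (c j) * cmod (T j)))"
      using c0 by (simp add: mult.assoc[symmetric])
    finally have "(cmod ?S)\<^sup>2 \<le> (\<Sum>j=a..Suc d. sqrt (c j) * (sqrt (c j) * cmod (T j)))\<^sup>2"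
      by (intro power_mono) auto
    also have "\<dots> \<le> (\<Sum>j=a..Suc d. (sqrt (c j))\<^sup>2) * (\<Sum>j=a..Suc d. (sqrt (c j) * cmod (T j))\<^sup>2)"
      by (rule Cauchy_Schwarz_ineq_sum)
    also have "\<dots> = 2 * m a * (\<Sum>j=a..Suc d. c j * (cmod (T j))\<^sup>2)"
      using c0 csum by (simp add: power_mult_distrib)
    finally show ?thesis by (simp only: sum_distrib_left mult.assoc)
  qed
  show ?thesis
  proof (intro exI[of _ "\<lambda>j. 2 * m a * c j"] conjI allI impI)
    show "(\<Sum>j=a..Suc d. 2 * m a * c j) = 4 * (m a)\<^sup>2"
      unfolding sum_distrib_left[symmetric] csum by (simp add: power2_eq_square)
  qed (use c0 pos[of a] ad main in \<open>auto simp: c_def\<close>)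
qed

definition nat_block :: "nat \<Rightarrow> nat set" where
  "nat_block k = (if k = 0 then {0} else {2 ^ (k - 1)..2 ^ k - 1})"

text \<open>On the block the multiplier \<open>exp (n t) / (n t)\<close>, which undoes the smoothing, is decreasing since
  \<open>n t \<le> 1\<close>.\<close>

lemma block_weights:
  assumes k: "k \<ge> 1" and t: "t \<in> {1 / 2 ^ (k + 1)..1 / 2 ^ k}"
  shows "\<exists>\<gamma>. (\<forall>j. \<gamma> j \<ge> 0) \<and> (\<forall>j. j > 2 ^ k \<longrightarrow> \<gamma> j = 0) \<and> (\<Sum>j\<le>2 ^ k. \<gamma> j) \<le> 256 \<and>
    (\<forall>(v :: nat \<Rightarrow> complex) N. 2 ^ k \<le> N \<longrightarrow>
      (cmod (\<Sum>n\<in>nat_block k. of_real (exp (real n * t) / (real n * t)) * v n))\<^sup>2 \<le> (\<Sum>j\<le>2 ^ k. \<gamma> j * (cmod (\<Sum>n=j..N. v n))\<^sup>2))"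
proof -
  define a where "a = (2 ^ (k - 1) :: nat)"
  have k2: "(2::nat) ^ k = 2 * a" unfolding a_def using k by (metis Suc_diff_le diff_Suc_1 power_Suc One_nat_def)
  have a1: "a \<ge> 1" by (simp add: a_def)
  define d where "d = 2 * a - 1"
  have d: "a \<le> d" "Suc d = 2 * a" using a1 by (auto simp: d_def)
  have t0: "t > 0"
  proof -
    have "(0::real) < 1 / 2 ^ (k + 1)" by simp
    also have "\<dots> \<le> t" using t by simp
    finally show ?thesis .
  qed
  have tA: "real a * t \<ge> 1 / 4" "real (2 * a) * t \<le> 1"
  proof -
    have r: "real (2 * a) = 2 ^ k" using arg_cong[OF k2, of real] by simp
    have "1 / 2 ^ (k + 1) \<le> t" "t \<le> 1 / 2 ^ k" using t by auto
    then have "2 ^ k * (1 / 2 ^ (k + 1)) \<le> 2 ^ k * t" "2 ^ k * t \<le> 2 ^ k * (1 / 2 ^ k)"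
      by (intro mult_left_mono; simp)+
    then have "1 / 2 \<le> real (2 * a) * t" "real (2 * a) * t \<le> 1" unfolding r by simp_all
    then show "real a * t \<ge> 1 / 4" "real (2 * a) * t \<le> 1" by auto
  qed
  define m where "m n = exp (real n * t) / (real n * t)" for n :: nat
  have dec: "m (Suc n) \<le> m n" if "a \<le> n" "n < d" for n
  proof -
    have n: "real n \<ge> 1" using a1 that by simp
    have "real (Suc n) * t \<le> real (2 * a) * t" using that d t0 by (intro mult_right_mono) auto
    then have nt: "real (Suc n) * t \<le> 1" using tA by linarith
    \<comment> \<open>Consecutive multipliers have the quotient \<open>exp t * n / Suc n\<close>,
      and \<open>n / Suc n <= 1 - t\<close> because \<open>Suc n * t <= 1\<close>.\<close>
    have "exp t * (1 - t) \<le> 1"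
      using exp_ge_add_one_self[of "- t"] by (simp add: exp_minus field_simps)
    moreover have "exp t * (real n / real (Suc n)) \<le> exp t * (1 - t)"
      using nt n by (intro mult_left_mono) (auto simp: field_simps)
    ultimately have "exp t * (real n / real (Suc n)) \<le> 1" by linarith
    then have "exp t * real n \<le> real (Suc n)" using n by (simp add: field_simps)
    then have "exp (real n * t) * (exp t * real n) \<le> exp (real n * t) * real (Suc n)" by (intro mult_left_mono) auto
    then have e: "exp (real (Suc n) * t) * real n \<le> exp (real n * t) * real (Suc n)"
      by (simp add: distrib_right exp_add mult.assoc add.commute)
    have frac: "x / b \<le> y / c" if "x * c \<le> y * b" "b > 0" "c > 0" for x y b c :: real
      using that by (simp add: field_simps)
    have "exp (real (Suc n) * t) * real n * t \<le> exp (real n * t) * real (Suc n) * t"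
      using t0 by (intro mult_right_mono e) auto
    then show ?thesis unfolding m_def using n t0 by (intro frac) (simp_all only: mult.assoc mult_pos_pos of_nat_0_less_iff)
  qed
  have pos: "m n \<ge> 0" for n using t0 by (simp add: m_def)
  \<comment> \<open>On the left end of the block \<open>a * t\<close> lies between
    \<open>1/4\<close> and \<open>1/2\<close>, so the multiplier is at most
    \<open>4 * exp (1/2) <= 8\<close>, and the total weight at most
    \<open>4 * 8^2 = 256\<close>.\<close>
  have ma: "m a \<le> 8"
  proof -
    have "real a * t \<le> 1 / 2" using tA by auto
    then have "exp (real a * t) \<le> exp (1 / 2)" by simp
    also have "\<dots> \<le> 2"
    proof -
      have "(exp (1 / 2 :: real))\<^sup>2 \<le> 2\<^sup>2" using exp_le by (simp add: power2_eq_square exp_add[symmetric])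
      then show ?thesis by (rule power2_le_imp_le) simp
    qed
    finally have "exp (real a * t) / (real a * t) \<le> 2 / (1 / 4)" using tA by (intro frac_le) auto
    then show ?thesis by (simp add: m_def)
  qed
  obtain \<gamma> where \<gamma>: "\<And>j. \<gamma> j \<ge> 0" "\<And>j. j \<notin> {a..Suc d} \<Longrightarrow> \<gamma> j = 0" "(\<Sum>j=a..Suc d. \<gamma> j) = 4 * (m a)\<^sup>2"
    and \<gamma>T: "\<And>T :: nat \<Rightarrow> complex. (cmod (\<Sum>n=a..d. of_real (m n) * (T n - T (Suc n))))\<^sup>2 \<le> (\<Sum>j=a..Suc d. \<gamma> j * (cmod (T j))\<^sup>2)"
    using abel_weights[of a d m, OF dec pos d(1)] by blast
  have ext: "(\<Sum>j\<le>2 ^ k. \<gamma> j * f j) = (\<Sum>j=a..Suc d. \<gamma> j * f j)" for f :: "nat \<Rightarrow> real"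
    using \<gamma>(2) d k2 by (intro sum.mono_neutral_right) auto
  have "(m a)\<^sup>2 \<le> 8\<^sup>2" using ma pos by (intro power_mono) auto
  then have sum_le: "(\<Sum>j\<le>2 ^ k. \<gamma> j) \<le> 256" using ext[of "\<lambda>_. 1"] \<gamma>(3) by simp
  have "(cmod (\<Sum>n\<in>nat_block k. of_real (exp (real n * t) / (real n * t)) * v n))\<^sup>2 \<le> (\<Sum>j\<le>2 ^ k. \<gamma> j * (cmod (\<Sum>n=j..N. v n))\<^sup>2)"
    if N: "2 ^ k \<le> N" for v :: "nat \<Rightarrow> complex" and N
  proof -
    define T where "T j = (\<Sum>n=j..N. v n)" for j
    have "T n - T (Suc n) = v n" if "n \<le> d" for n
      using that N d k2 unfolding T_def by (subst sum.atLeast_Suc_atMost[of n]) auto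
    moreover have "nat_block k = {a..d}" using k k2 by (simp add: nat_block_def a_def d_def)
    ultimately have "(\<Sum>n\<in>nat_block k. of_real (exp (real n * t) / (real n * t)) * v n) = (\<Sum>n=a..d. of_real (m n) * (T n - T (Suc n)))"
      by (auto simp: m_def intro!: sum.cong)
    then show ?thesis using \<gamma>T[of T] unfolding ext T_def by simp
  qed
  note main = this
  have z: "\<gamma> j = 0" if "j > 2 ^ k" for j
    using that d k2 by (intro \<gamma>(2)) simp
  show ?thesis
    by (rule exI[of _ \<gamma>], intro conjI allI impI; (rule \<gamma>(1) z sum_le main; assumption?)?)
qed


lemma apoly_smoothed:
  "apoly (\<lambda>n. of_real (t * (real n * exp (- (real n * t)))) * a n) N (spt 0 y) = of_real t * apoly (dcoef 1 a) N (spt (- t) y)"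
proof -
  have "exp (of_nat n * spt (- t) y) = of_real (exp (- (real n * t))) * exp (of_nat n * spt 0 y)" for n
    by (simp add: spt_def exp_of_real[symmetric] exp_add[symmetric] algebra_simps)
  then show ?thesis
    unfolding apoly_def dcoef_def sum_distrib_left by (intro sum.cong) (auto simp: mult_ac)
qed

text \<open>The constant is \<open>2 * 256 * 81\<close>, from the Riesz projection, the weights of
  the blocks and the smooth square function. Only the first of these carries
  \<open>1 / (p - 1)\<close>.\<close>

lemma square_function_1d_eps:
  fixes a :: "'i \<Rightarrow> nat \<Rightarrow> complex"
  assumes p: "1 < p" "p < 2" and I: "finite I" and N: "2 ^ K \<le> N" and e: "e > 0"
  shows "(\<integral>\<^sup>+x. ennreal ((\<Sum>i\<in>I. \<Sum>k=1..K. (cmod (\<Sum>n\<in>nat_block k. a i n * exp (of_nat n * spt 0 (2 * pi * x))))\<^sup>2) powr (p/2)) \<partial>circle)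
    \<le> ennreal (41472 / (p - 1)) * (\<integral>\<^sup>+x. ennreal (reg_sq I a zero_coef N e (spt 0 (2 * pi * x)) powr (p/2)) \<partial>circle)"
proof -
  obtain t where t: "\<And>k. t k \<in> {1 / 2 ^ (k + 1)..1 / 2 ^ k}" and
    sq: "(\<integral>\<^sup>+x. ennreal ((\<Sum>k=1..K. (t k)\<^sup>2 * energy I a zero_coef N (spt (- t k) (2 * pi * x))) powr (p/2)) \<partial>circle)
      \<le> 81 * (\<integral>\<^sup>+x. ennreal (reg_sq I a zero_coef N e (spt 0 (2 * pi * x)) powr (p/2)) \<partial>circle)"
    using smooth_square_function[of "p/2", OF _ _ e, where K = K and I = I and a = a and N = N] p by auto
  have tpos: "t k > 0" for k
  proof -
    have "(0::real) < 1 / 2 ^ (k + 1)" by simp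
    also have "\<dots> \<le> t k" using t[of k] by simp
    finally show ?thesis .
  qed
  let ?P = "\<lambda>k \<gamma>. (\<forall>j. \<gamma> j \<ge> 0) \<and> (\<forall>j. j > 2 ^ k \<longrightarrow> \<gamma> j = 0) \<and> (\<Sum>j\<le>2 ^ k. \<gamma> j) \<le> 256 \<and>
    (\<forall>(v :: nat \<Rightarrow> complex) N. 2 ^ k \<le> N \<longrightarrow>
      (cmod (\<Sum>n\<in>nat_block k. of_real (exp (real n * t k) / (real n * t k)) * v n))\<^sup>2 \<le> (\<Sum>j\<le>2 ^ k. \<gamma> j * (cmod (\<Sum>n=j..N. v n))\<^sup>2))"
  have "\<forall>k\<in>{1..K}. \<exists>\<gamma>. ?P k \<gamma>" using block_weights t by simp
  from bchoice[OF this] obtain \<gamma> where \<gamma>: "\<forall>k\<in>{1..K}. ?P k (\<gamma> k)" ..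
  have \<gamma>0: "\<gamma> k j \<ge> 0" if "k \<in> {1..K}" for k j using \<gamma> that by blast
  have \<gamma>z: "\<gamma> k j = 0" if "k \<in> {1..K}" "j > 2 ^ k" for k j using \<gamma> that by blast
  have \<gamma>s: "(\<Sum>j\<le>2 ^ k. \<gamma> k j) \<le> 256" if "k \<in> {1..K}" for k using \<gamma> that by blast
  have \<gamma>b: "(cmod (\<Sum>n\<in>nat_block k. of_real (exp (real n * t k) / (real n * t k)) * v n))\<^sup>2 \<le> (\<Sum>j\<le>2 ^ k. \<gamma> k j * (cmod (\<Sum>n=j..N. v n))\<^sup>2)"
    if "k \<in> {1..K}" "2 ^ k \<le> N" for k N and v :: "nat \<Rightarrow> complex" using \<gamma> that by blast
  have kN: "2 ^ k \<le> N" if "k \<in> {1..K}" for k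
  proof -
    have "(2::nat) ^ k \<le> 2 ^ K" using that by (intro power_increasing) auto
    then show ?thesis using N by (rule order_trans)
  qed
  have ext: "(\<Sum>j\<le>2 ^ k. \<gamma> k j * f j) = (\<Sum>j\<le>N. \<gamma> k j * f j)" if "k \<in> {1..K}" for k and f :: "nat \<Rightarrow> real"
    using kN[OF that] \<gamma>z[OF that] by (intro sum.mono_neutral_left) auto
  define v where "v i k = (\<lambda>n. of_real (t k * (real n * exp (- (real n * t k)))) * a i n)" for i k
  \<comment> \<open>One vector for all cuts: a component for each member \<open>i\<close>, block
    \<open>k\<close> and cut \<open>j\<close>, scaled by the square root of its weight.
    \<open>A\<close> holds the analytic parts, \<open>B\<close> the conjugated rest.\<close>
  define J where "J = I \<times> ({1..K} \<times> {..N})"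
  define A where "A = (\<lambda>(i, k, j). tail_coef (sqrt (\<gamma> k j)) j N (v i k))"
  define B where "B = (\<lambda>(i, k, j). head_coef (sqrt (\<gamma> k j)) j (v i k))"
  have [simp]: "finite J" using I by (simp add: J_def)
  have Jsum: "(\<Sum>q\<in>J. g q) = (\<Sum>i\<in>I. \<Sum>k=1..K. \<Sum>j\<le>N. g (i, k, j))" for g :: "_ \<Rightarrow> real"
    unfolding J_def by (simp add: sum.cartesian_product' split_def)
  have low: "(\<Sum>i\<in>I. \<Sum>k=1..K. (cmod (\<Sum>n\<in>nat_block k. a i n * exp (of_nat n * spt 0 y)))\<^sup>2)
    \<le> (\<Sum>q\<in>J. (cmod (apoly (A q) N (spt 0 y)))\<^sup>2)" for y
    unfolding Jsum
  proof (intro sum_mono)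
    fix i k assume k: "k \<in> {1..K}"
    define w where "w n = v i k n * exp (of_nat n * spt 0 y)" for n
    have "a i n * exp (of_nat n * spt 0 y) = of_real (exp (real n * t k) / (real n * t k)) * w n" if "n \<in> nat_block k" for n
    proof -
      have "(0::nat) < 2 ^ (k - 1)" by simp
      also have "\<dots> \<le> n" using that k by (simp add: nat_block_def)
      finally have "n \<noteq> 0" by simp
      then have "(exp (real n * t k) / (real n * t k)) * (t k * (real n * exp (- (real n * t k)))) = 1"
        using tpos[of k] by (simp add: exp_minus)
      then have "complex_of_real (exp (real n * t k) / (real n * t k)) * of_real (t k * (real n * exp (- (real n * t k)))) = 1"
        by (metis of_real_1 of_real_mult)
      then show ?thesis unfolding w_def v_def by (simp only: mult.assoc[symmetric] mult_1_left)
    qed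
    then have "(\<Sum>n\<in>nat_block k. a i n * exp (of_nat n * spt 0 y)) = (\<Sum>n\<in>nat_block k. of_real (exp (real n * t k) / (real n * t k)) * w n)"
      by (intro sum.cong) auto
    then have "(cmod (\<Sum>n\<in>nat_block k. a i n * exp (of_nat n * spt 0 y)))\<^sup>2 \<le> (\<Sum>j\<le>N. \<gamma> k j * (cmod (\<Sum>n=j..N. w n))\<^sup>2)"
      using \<gamma>b[OF k kN[OF k], of w] ext[OF k] by simp
    also have "\<dots> = (\<Sum>j\<le>N. (cmod (apoly (A (i, k, j)) N (spt 0 y)))\<^sup>2)"
    proof (rule sum.cong[OF refl])
      fix j assume "j \<in> {..N}"
      then have "apoly (A (i, k, j)) N (spt 0 y) = exp (- (of_nat j * spt 0 y)) * (of_real (sqrt (\<gamma> k j)) * (\<Sum>n=j..N. w n))"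
        unfolding A_def w_def prod.case by (intro apoly_tail_coef) auto
      then have "cmod (apoly (A (i, k, j)) N (spt 0 y)) = sqrt (\<gamma> k j) * cmod (\<Sum>n=j..N. w n)"
        using \<gamma>0[OF k, of j] by (simp only: norm_mult norm_exp_spt0 norm_of_real) simp
      then show "\<gamma> k j * (cmod (\<Sum>n=j..N. w n))\<^sup>2 = (cmod (apoly (A (i, k, j)) N (spt 0 y)))\<^sup>2"
        using \<gamma>0[OF k, of j] by (simp add: power_mult_distrib)
    qed
    finally show "(cmod (\<Sum>n\<in>nat_block k. a i n * exp (of_nat n * spt 0 y)))\<^sup>2 \<le> (\<Sum>j\<le>N. (cmod (apoly (A (i, k, j)) N (spt 0 y)))\<^sup>2)" .
  qed
  \<comment> \<open>Before projection the modulation is unimodular, so the component (i, k, j) has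
    the modulus of the smooth piece times \<open>sqrt (\<gamma> k j)\<close>. Summing over
    \<open>j\<close> gives just the total weight, however many cuts there are.\<close>
  have up: "reg_sq J A B N 0 (spt 0 y) \<le> 256 * (\<Sum>k=1..K. (t k)\<^sup>2 * energy I a zero_coef N (spt (- t k) y))" for y
  proof -
    have "reg_sq J A B N 0 (spt 0 y) = (\<Sum>i\<in>I. \<Sum>k=1..K. \<Sum>j\<le>N. (cmod (hpoly (A (i, k, j)) (B (i, k, j)) N (spt 0 y)))\<^sup>2)"
      unfolding reg_sq_def Jsum by simp
    also have "\<dots> \<le> (\<Sum>i\<in>I. \<Sum>k=1..K. 256 * ((t k)\<^sup>2 * (cmod (apoly (dcoef 1 (a i)) N (spt (- t k) y)))\<^sup>2))"
    proof (intro sum_mono)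
      fix i k assume k: "k \<in> {1..K}"
      have "(\<Sum>j\<le>N. (cmod (hpoly (A (i, k, j)) (B (i, k, j)) N (spt 0 y)))\<^sup>2) = (\<Sum>j\<le>N. \<gamma> k j * (cmod (apoly (v i k) N (spt 0 y)))\<^sup>2)"
      proof (rule sum.cong[OF refl])
        fix j assume "j \<in> {..N}"
        then have "hpoly (A (i, k, j)) (B (i, k, j)) N (spt 0 y) = exp (- (of_nat j * spt 0 y)) * (of_real (sqrt (\<gamma> k j)) * apoly (v i k) N (spt 0 y))"
          unfolding A_def B_def prod.case by (intro hpoly_tail_head) auto
        then have "cmod (hpoly (A (i, k, j)) (B (i, k, j)) N (spt 0 y)) = sqrt (\<gamma> k j) * cmod (apoly (v i k) N (spt 0 y))"
          using \<gamma>0[OF k, of j] by (simp only: norm_mult norm_exp_spt0 norm_of_real) simp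
        then show "(cmod (hpoly (A (i, k, j)) (B (i, k, j)) N (spt 0 y)))\<^sup>2 = \<gamma> k j * (cmod (apoly (v i k) N (spt 0 y)))\<^sup>2"
          using \<gamma>0[OF k, of j] by (simp add: power_mult_distrib)
      qed
      also have "\<dots> = (\<Sum>j\<le>2 ^ k. \<gamma> k j) * (cmod (apoly (v i k) N (spt 0 y)))\<^sup>2"
        unfolding sum_distrib_right by (rule ext[OF k, symmetric])
      also have "\<dots> \<le> 256 * (cmod (apoly (v i k) N (spt 0 y)))\<^sup>2"
        by (intro mult_right_mono \<gamma>s k) auto
      also have "\<dots> = 256 * ((t k)\<^sup>2 * (cmod (apoly (dcoef 1 (a i)) N (spt (- t k) y)))\<^sup>2)"
        unfolding v_def apoly_smoothed by (simp add: norm_mult power_mult_distrib)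
      finally show "(\<Sum>j\<le>N. (cmod (hpoly (A (i, k, j)) (B (i, k, j)) N (spt 0 y)))\<^sup>2) \<le> 256 * ((t k)\<^sup>2 * (cmod (apoly (dcoef 1 (a i)) N (spt (- t k) y)))\<^sup>2)" .
    qed
    also have "\<dots> = 256 * (\<Sum>k=1..K. (t k)\<^sup>2 * energy I a zero_coef N (spt (- t k) y))"
      by (subst sum.swap) (simp add: energy_def sum_distrib_left)
    finally show ?thesis .
  qed
  let ?X = "\<lambda>x. \<Sum>k=1..K. (t k)\<^sup>2 * energy I a zero_coef N (spt (- t k) (2 * pi * x))"
  have X0: "?X x \<ge> 0" for x by (intro sum_nonneg mult_nonneg_nonneg energy_nonneg) auto
  have "(\<integral>\<^sup>+x. ennreal ((\<Sum>i\<in>I. \<Sum>k=1..K. (cmod (\<Sum>n\<in>nat_block k. a i n * exp (of_nat n * spt 0 (2 * pi * x))))\<^sup>2) powr (p/2)) \<partial>circle)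
     \<le> (\<integral>\<^sup>+x. ennreal ((\<Sum>q\<in>J. (cmod (apoly (A q) N (spt 0 (2 * pi * x))))\<^sup>2) powr (p/2)) \<partial>circle)"
    using p by (intro nn_integral_mono ennreal_leI powr_mono2 low sum_nonneg) auto
  also have "\<dots> \<le> ennreal (2 / (p - 1)) * (\<integral>\<^sup>+x. ennreal (reg_sq J A B N 0 (spt 0 (2 * pi * x)) powr (p/2)) \<partial>circle)"
    by (rule riesz_projection[OF p]) (auto simp: B_def head_coef_def)
  also have "\<dots> \<le> ennreal (2 / (p - 1)) * (\<integral>\<^sup>+x. 256 * ennreal (?X x powr (p/2)) \<partial>circle)"
  proof (intro mult_left_mono nn_integral_mono)
    fix x
    have "reg_sq J A B N 0 (spt 0 (2 * pi * x)) powr (p/2) \<le> (256 * ?X x) powr (p/2)"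
      using p by (intro powr_mono2 up) (auto simp: reg_sq_def intro!: sum_nonneg)
    also have "\<dots> = 256 powr (p/2) * ?X x powr (p/2)" using X0 by (simp add: powr_mult)
    also have "\<dots> \<le> 256 * ?X x powr (p/2)"
      using p powr_mono[of "p/2" 1 "256::real"] by (intro mult_right_mono) auto
    finally have "ennreal (reg_sq J A B N 0 (spt 0 (2 * pi * x)) powr (p/2)) \<le> ennreal (256 * ?X x powr (p/2))"
      by (rule ennreal_leI)
    also have "\<dots> = 256 * ennreal (?X x powr (p/2))"
      by (subst ennreal_mult') auto
    finally show "ennreal (reg_sq J A B N 0 (spt 0 (2 * pi * x)) powr (p/2)) \<le> 256 * ennreal (?X x powr (p/2))" .
  qed simp
  also have "(\<integral>\<^sup>+x. 256 * ennreal (?X x powr (p/2)) \<partial>circle) = 256 * (\<integral>\<^sup>+x. ennreal (?X x powr (p/2)) \<partial>circle)"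
  proof (rule nn_integral_cmult)
    have "continuous_on UNIV (\<lambda>x. ?X x powr (p/2))"
      using p X0 unfolding energy_def by (intro continuous_on_powr' continuous_on_sum continuous_intros) auto
    then show "(\<lambda>x. ennreal (?X x powr (p/2))) \<in> borel_measurable circle"
      by (intro measurable_compose[OF _ measurable_ennreal] measurable_circle borel_measurable_continuous_onI)
  qed
  also have "ennreal (2 / (p - 1)) * (256 * (\<integral>\<^sup>+x. ennreal (?X x powr (p/2)) \<partial>circle))
     \<le> ennreal (2 / (p - 1)) * (256 * (81 * (\<integral>\<^sup>+x. ennreal (reg_sq I a zero_coef N e (spt 0 (2 * pi * x)) powr (p/2)) \<partial>circle)))"
    by (intro mult_left_mono sq) auto
  also have "\<dots> = (ennreal (2 / (p - 1)) * ennreal 20736) * (\<integral>\<^sup>+x. ennreal (reg_sq I a zero_coef N e (spt 0 (2 * pi * x)) powr (p/2)) \<partial>circle)"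
    by (simp add: mult.assoc[symmetric])
  also have "ennreal (2 / (p - 1)) * ennreal 20736 = ennreal (41472 / (p - 1))"
    using p by (subst ennreal_mult[symmetric]) auto
  finally show ?thesis .
qed

text \<open>The constant term is the Riesz projection of the conjugate of \<open>f\<close>.\<close>

lemma mean_value_1d:
  fixes a :: "'i \<Rightarrow> nat \<Rightarrow> complex"
  assumes p: "1 < p" "p < 2" and I: "finite I"
  shows "(\<integral>\<^sup>+x. ennreal ((\<Sum>i\<in>I. (cmod (a i 0))\<^sup>2) powr (p/2)) \<partial>circle)
    \<le> ennreal (2 / (p - 1)) * (\<integral>\<^sup>+x. ennreal (reg_sq I a zero_coef N 0 (spt 0 (2 * pi * x)) powr (p/2)) \<partial>circle)"
proof -
  define c where "c i n = (if n = 0 then cnj (a i 0) else 0)" for i and n :: nat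
  define b where "b i n = (if n = 0 then 0 else a i n)" for i n
  have c: "apoly (c i) N z = cnj (a i 0)" for i z
    unfolding apoly_def c_def by (simp add: if_distrib[where f = "\<lambda>x. x * _"] cong: if_cong)
  have "apoly (a i) N z = a i 0 + apoly (b i) N z" for i z
    unfolding apoly_def b_def by (simp add: sum.atMost_shift)
  then have h: "cmod (hpoly (c i) (b i) N z) = cmod (apoly (a i) N z)" for i z
    unfolding hpoly_def c by (metis complex_cnj_add complex_mod_cnj)
  have "reg_sq I c b N 0 z = reg_sq I a zero_coef N 0 z" for z
    unfolding reg_sq_def hpoly_zero h ..
  then show ?thesis
    using riesz_projection[OF p I, of b c N] unfolding c b_def by simp
qed

text \<open>The constant term is treated separately, since the smoothing multiplier
  \<open>n * t * exp (- n * t)\<close> kills it. 50000 is a round number above 41472 + 2.\<close>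

theorem square_function_1d:
  fixes a :: "'i \<Rightarrow> nat \<Rightarrow> complex"
  assumes p: "1 < p" "p < 2" and I: "finite I" and N: "2 ^ K \<le> N"
  shows "(\<integral>\<^sup>+x. ennreal ((\<Sum>i\<in>I. \<Sum>k\<le>K. (cmod (\<Sum>n\<in>nat_block k. a i n * exp (of_nat n * spt 0 (2 * pi * x))))\<^sup>2) powr (p/2)) \<partial>circle)
    \<le> ennreal (50000 / (p - 1)) * (\<integral>\<^sup>+x. ennreal ((\<Sum>i\<in>I. (cmod (apoly (a i) N (spt 0 (2 * pi * x))))\<^sup>2) powr (p/2)) \<partial>circle)"
proof -
  let ?R = "\<integral>\<^sup>+x. ennreal (reg_sq I a zero_coef N 0 (spt 0 (2 * pi * x)) powr (p/2)) \<partial>circle"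
  let ?X0 = "\<Sum>i\<in>I. (cmod (a i 0))\<^sup>2"
  let ?X1 = "\<lambda>x. \<Sum>i\<in>I. \<Sum>k=1..K. (cmod (\<Sum>n\<in>nat_block k. a i n * exp (of_nat n * spt 0 (2 * pi * x))))\<^sup>2"
  have split: "(\<Sum>i\<in>I. \<Sum>k\<le>K. (cmod (\<Sum>n\<in>nat_block k. a i n * exp (of_nat n * spt 0 (2 * pi * x))))\<^sup>2) = ?X0 + ?X1 x" for x
  proof -
    have "{..K} = insert 0 {1..K}" by auto
    then show ?thesis by (simp add: sum.distrib nat_block_def)
  qed
  have X1: "?X1 x \<ge> 0" for x by (intro sum_nonneg) auto
  have x1: "(\<integral>\<^sup>+x. ennreal (?X1 x powr (p/2)) \<partial>circle) \<le> ennreal (41472 / (p - 1)) * ?R"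
  proof (rule eps_limit[where al = "p/2"])
    fix e :: real assume e: "e > 0"
    show "(\<integral>\<^sup>+x. ennreal (?X1 x powr (p/2)) \<partial>circle) \<le> ennreal (41472 / (p - 1)) * (?R + ennreal (e powr (p/2)))"
      using p by (intro order_trans[OF square_function_1d_eps[OF p I N e]] mult_left_mono reg_sq_powr_eps e) auto
  qed (use p in auto)
  have x0: "(\<integral>\<^sup>+x. ennreal (?X0 powr (p/2)) \<partial>circle) \<le> ennreal (2 / (p - 1)) * ?R"
    by (rule mean_value_1d[OF p I])
  have "(\<integral>\<^sup>+x. ennreal ((?X0 + ?X1 x) powr (p/2)) \<partial>circle)
     \<le> (\<integral>\<^sup>+x. ennreal (?X0 powr (p/2)) + ennreal (?X1 x powr (p/2)) \<partial>circle)"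
  proof (intro nn_integral_mono)
    fix x
    have "(?X0 + ?X1 x) powr (p/2) \<le> ?X0 powr (p/2) + ?X1 x powr (p/2)"
      using p X1 by (intro powr_add_le) (auto intro!: sum_nonneg)
    then show "ennreal ((?X0 + ?X1 x) powr (p/2)) \<le> ennreal (?X0 powr (p/2)) + ennreal (?X1 x powr (p/2))"
      by (simp add: ennreal_plus[symmetric] ennreal_leI del: ennreal_plus)
  qed
  also have "\<dots> = (\<integral>\<^sup>+x. ennreal (?X0 powr (p/2)) \<partial>circle) + (\<integral>\<^sup>+x. ennreal (?X1 x powr (p/2)) \<partial>circle)"
  proof (rule nn_integral_add)
    have "continuous_on UNIV (\<lambda>x. ?X1 x powr (p/2))"
      using p X1 by (intro continuous_on_powr' continuous_on_sum continuous_intros) auto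
    then show "(\<lambda>x. ennreal (?X1 x powr (p/2))) \<in> borel_measurable circle"
      by (intro measurable_compose[OF _ measurable_ennreal] measurable_circle borel_measurable_continuous_onI)
  qed simp
  also have "\<dots> \<le> ennreal (2 / (p - 1)) * ?R + ennreal (41472 / (p - 1)) * ?R"
    by (intro add_mono x0 x1)
  also have "\<dots> = ennreal (2 / (p - 1) + 41472 / (p - 1)) * ?R"
    using p by (subst ennreal_plus) (auto simp: distrib_right)
  also have "\<dots> \<le> ennreal (50000 / (p - 1)) * ?R"
    using p by (intro mult_right_mono ennreal_leI) (auto simp: add_divide_distrib[symmetric] divide_right_mono)
  finally show ?thesis unfolding split by (simp add: reg_sq_def)
qed

section \<open>Iteration over the variables\<close>

interpretation pc: product_sigma_finite "\<lambda>_::nat. circle"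
  by standard

section \<open>Characters on the circle and on the torus\<close>

definition echar :: "int \<Rightarrow> real \<Rightarrow> complex" where
  "echar n t = exp (\<i> * of_real (2 * pi * of_int n * t))"

definition echar_d :: "nat \<Rightarrow> (nat \<Rightarrow> int) \<Rightarrow> (nat \<Rightarrow> real) \<Rightarrow> complex" where
  "echar_d d n x = (\<Prod>j<d. echar (n j) (x j))"

lemma echar_nat: "exp (of_nat m * spt 0 (2 * pi * t)) = echar (int m) t"
  by (simp add: echar_def spt_def mult_ac)

lemma measurable_echar [measurable (raw)]:
  "f \<in> borel_measurable M \<Longrightarrow> (\<lambda>x. echar n (f x)) \<in> borel_measurable M"
  unfolding echar_def
  by (rule measurable_compose[where g = "\<lambda>t. exp (\<i> * of_real (2 * pi * of_int n * t))"])
    (auto intro!: borel_measurable_continuous_onI continuous_intros)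

lemma norm_echar [simp]: "cmod (echar n t) = 1"
  by (simp add: echar_def)

lemma measurable_torus_component [measurable]:
  "j < d \<Longrightarrow> (\<lambda>x. x j) \<in> borel_measurable (torus d)"
  unfolding torus_def
  by (rule measurable_compose[OF measurable_component_singleton[of j "{..<d}" "\<lambda>_. circle"] measurable_ident_circle]) simp

lemma measurable_echar_d:
  "d' \<le> d \<Longrightarrow> echar_d d' n \<in> borel_measurable (torus d)"
  unfolding echar_d_def[abs_def] by (intro borel_measurable_prod measurable_echar measurable_torus_component) auto

lemma echar_d_Suc_upd: "echar_d (Suc d) n (x(d := t)) = echar_d d n x * echar (n d) t"
proof -
  have "(\<Prod>j<d. echar (n j) ((x(d := t)) j)) = (\<Prod>j<d. echar (n j) (x j))"
    by (intro prod.cong) auto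
  then show ?thesis by (simp add: echar_d_def)
qed

lemma norm_echar_d [simp]: "cmod (echar_d d n x) = 1"
  by (simp add: echar_d_def prod_norm[symmetric])

definition in_blocks :: "nat \<Rightarrow> (nat \<Rightarrow> nat) \<Rightarrow> (nat \<Rightarrow> int) \<Rightarrow> bool" where
  "in_blocks d k n \<longleftrightarrow> (\<forall>j<d. n j \<in> int ` nat_block (k j))"

lemma finite_nat_block [simp]: "finite (nat_block k)"
  by (simp add: nat_block_def)

lemma torus_Suc: "torus (Suc d) = Pi\<^sub>M (insert d {..<d}) (\<lambda>_. circle)"
  by (simp add: torus_def lessThan_Suc)

lemma nn_integral_torus_Suc:
  assumes "f \<in> borel_measurable (torus (Suc d))"
  shows "(\<integral>\<^sup>+x. f x \<partial>torus (Suc d)) = (\<integral>\<^sup>+x. \<integral>\<^sup>+t. f (x(d := t)) \<partial>circle \<partial>torus d)"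
    and "(\<integral>\<^sup>+x. f x \<partial>torus (Suc d)) = (\<integral>\<^sup>+t. \<integral>\<^sup>+x. f (x(d := t)) \<partial>torus d \<partial>circle)"
  using pc.product_nn_integral_insert[of "{..<d}" d f] pc.product_nn_integral_insert_rev[of "{..<d}" d f] assms
  unfolding torus_Suc by (simp_all add: torus_def)

lemma sum_PiE_lessThan_Suc:
  "(\<Sum>k\<in>PiE {..<Suc d} B. g k) = (\<Sum>k\<in>PiE {..<d} B. \<Sum>l\<in>B d. g (k(d := l)))"
proof -
  have inj: "inj_on (\<lambda>(y, g). g(d := y)) (B d \<times> PiE {..<d} B)"
    by (rule inj_combinator) simp
  have "PiE {..<Suc d} B = (\<lambda>(y, g). g(d := y)) ` (B d \<times> PiE {..<d} B)"
    unfolding lessThan_Suc by (rule PiE_insert_eq)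
  then have "(\<Sum>k\<in>PiE {..<Suc d} B. g k) = (\<Sum>(y, h)\<in>B d \<times> PiE {..<d} B. g (h(d := y)))"
    using inj by (simp add: sum.reindex case_prod_unfold)
  also have "\<dots> = (\<Sum>y\<in>B d. \<Sum>h\<in>PiE {..<d} B. g (h(d := y)))"
    by (rule sum.cartesian_product[symmetric])
  finally show ?thesis by (subst (asm) sum.swap)
qed

text \<open>With the other coordinates fixed, the one-variable inequality is applied in the last
  coordinate to the vector indexed by the blocks of the others. With the last coordinate fixed, the
  induction hypothesis treats what is left.\<close>

theorem square_function_polynomial:
  fixes A :: "(nat \<Rightarrow> int) \<Rightarrow> complex"
  assumes p: "1 < p" "p < 2" and F: "finite F" and pos: "\<And>n j. n \<in> F \<Longrightarrow> j < d \<Longrightarrow> n j \<ge> 0"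
  shows "(\<integral>\<^sup>+x. ennreal ((\<Sum>k\<in>({..<d} \<rightarrow>\<^sub>E {..K}). (cmod (\<Sum>n\<in>{n\<in>F. in_blocks d k n}. A n * echar_d d n x))\<^sup>2) powr (p/2)) \<partial>torus d)
    \<le> ennreal (50000 / (p - 1)) ^ d * (\<integral>\<^sup>+x. ennreal ((cmod (\<Sum>n\<in>F. A n * echar_d d n x))\<^sup>2 powr (p/2)) \<partial>torus d)"
  using pos
proof (induction d arbitrary: A)
  case 0
  then show ?case by (simp add: in_blocks_def)
next
  case (Suc d)
  let ?C = "ennreal (50000 / (p - 1))"
  let ?B = "{..<d} \<rightarrow>\<^sub>E {..K}"
  have [simp]: "finite ?B" by (intro finite_PiE) auto
  \<comment> \<open>The intermediate quantity: blocks in the first \<open>d\<close> variables, no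
    block in the last one.\<close>
  define H where "H x = ennreal ((\<Sum>k\<in>?B. (cmod (\<Sum>n\<in>{n\<in>F. in_blocks d k n}. A n * echar_d (Suc d) n x))\<^sup>2) powr (p/2))" for x
  define L where "L x = ennreal ((\<Sum>k\<in>({..<Suc d} \<rightarrow>\<^sub>E {..K}). (cmod (\<Sum>n\<in>{n\<in>F. in_blocks (Suc d) k n}. A n * echar_d (Suc d) n x))\<^sup>2) powr (p/2))" for x
  define G where "G x = ennreal ((cmod (\<Sum>n\<in>F. A n * echar_d (Suc d) n x))\<^sup>2 powr (p/2))" for x
  have [measurable]: "echar_d (Suc d) n \<in> borel_measurable (torus (Suc d))" for n by (rule measurable_echar_d) simp
  have [measurable]: "H \<in> borel_measurable (torus (Suc d))" "L \<in> borel_measurable (torus (Suc d))" "G \<in> borel_measurable (torus (Suc d))"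
    unfolding H_def L_def G_def by measurable
  \<comment> \<open>A crude bound for the degrees in the last variable, made at least
    \<open>2 ^ K\<close> as \<open>square_function_1d\<close> asks.\<close>
  define N where "N = 2 ^ K + (\<Sum>n\<in>F. nat (n d))"
  have N: "2 ^ K \<le> N" "nat (n d) \<le> N" if "n \<in> F" for n
    using member_le_sum[of n F "\<lambda>n. nat (n d)"] F that by (auto simp: N_def)
  have N1: "2 ^ K \<le> N" by (simp add: N_def)
  have inner: "(\<integral>\<^sup>+t. L (x(d := t)) \<partial>circle) \<le> ?C * (\<integral>\<^sup>+t. H (x(d := t)) \<partial>circle)" for x
  proof -
    define a where "a k m = (\<Sum>n\<in>{n\<in>F. in_blocks d k n \<and> nat (n d) = m}. A n * echar_d d n x)" for k and m :: nat
    have grp: "(\<Sum>m\<in>T. a k m * exp (of_nat m * spt 0 (2 * pi * t))) = (\<Sum>n\<in>{n\<in>F. in_blocks d k n \<and> nat (n d) \<in> T}. A n * echar_d (Suc d) n (x(d := t)))"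
      if T: "finite T" for T k t
    proof -
      have "(\<Sum>m\<in>T. a k m * exp (of_nat m * spt 0 (2 * pi * t))) =
        (\<Sum>m\<in>T. \<Sum>n\<in>{n\<in>{n\<in>F. in_blocks d k n \<and> nat (n d) \<in> T}. nat (n d) = m}. A n * echar_d (Suc d) n (x(d := t)))"
      proof (rule sum.cong[OF refl])
        fix m assume m: "m \<in> T"
        have "a k m * exp (of_nat m * spt 0 (2 * pi * t)) = (\<Sum>n\<in>{n\<in>F. in_blocks d k n \<and> nat (n d) = m}. A n * echar_d (Suc d) n (x(d := t)))"
          unfolding a_def sum_distrib_right echar_nat
          by (rule sum.cong) (use Suc.prems[of _ d] in \<open>auto simp: echar_d_Suc_upd mult.assoc\<close>)
        also have "{n\<in>F. in_blocks d k n \<and> nat (n d) = m} = {n\<in>{n\<in>F. in_blocks d k n \<and> nat (n d) \<in> T}. nat (n d) = m}"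
          using m by auto
        finally show "a k m * exp (of_nat m * spt 0 (2 * pi * t)) = (\<Sum>n\<in>{n\<in>{n\<in>F. in_blocks d k n \<and> nat (n d) \<in> T}. nat (n d) = m}. A n * echar_d (Suc d) n (x(d := t)))" .
      qed
      also have "\<dots> = (\<Sum>n\<in>{n\<in>F. in_blocks d k n \<and> nat (n d) \<in> T}. A n * echar_d (Suc d) n (x(d := t)))"
        using F T by (intro sum.group) auto
      finally show ?thesis .
    qed
    have Leq: "L (x(d := t)) = ennreal ((\<Sum>k\<in>?B. \<Sum>l\<le>K. (cmod (\<Sum>m\<in>nat_block l. a k m * exp (of_nat m * spt 0 (2 * pi * t))))\<^sup>2) powr (p/2))" for t
    proof -
      have "{n\<in>F. in_blocks (Suc d) (k(d := l)) n} = {n\<in>F. in_blocks d k n \<and> nat (n d) \<in> nat_block l}" if "k \<in> ?B" for k l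
      proof -
        have "in_blocks (Suc d) (k(d := l)) n \<longleftrightarrow> in_blocks d k n \<and> n d \<in> int ` nat_block l" for n
          unfolding in_blocks_def by (auto simp: less_Suc_eq)
        moreover have "n d \<in> int ` nat_block l \<longleftrightarrow> nat (n d) \<in> nat_block l" if "n \<in> F" for n
          using Suc.prems[OF that, of d] by (auto simp: image_iff intro: bexI[of _ "nat (n d)"])
        ultimately show ?thesis by auto
      qed
      then show ?thesis unfolding L_def sum_PiE_lessThan_Suc grp[OF finite_nat_block] by simp
    qed
    have Heq: "H (x(d := t)) = ennreal ((\<Sum>k\<in>?B. (cmod (apoly (a k) N (spt 0 (2 * pi * t))))\<^sup>2) powr (p/2))" for t
    proof -
      have "apoly (a k) N (spt 0 (2 * pi * t)) = (\<Sum>n\<in>{n\<in>F. in_blocks d k n}. A n * echar_d (Suc d) n (x(d := t)))" for k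
        unfolding apoly_def grp[OF finite_atMost] by (rule sum.cong) (use N in auto)
      then show ?thesis by (simp add: H_def)
    qed
    show ?thesis unfolding Leq Heq by (rule square_function_1d[OF p \<open>finite ?B\<close> N1])
  qed
  \<comment> \<open>At fixed \<open>t\<close> the character of the last variable is a constant
    absorbed into the coefficients, which is why the induction generalises over
    \<open>A\<close>.\<close>
  have outer: "(\<integral>\<^sup>+x. H (x(d := t)) \<partial>torus d) \<le> ?C ^ d * (\<integral>\<^sup>+x. G (x(d := t)) \<partial>torus d)" for t
    using Suc.IH[of "\<lambda>n. A n * echar (n d) t"] Suc.prems unfolding H_def G_def echar_d_Suc_upd by (simp add: mult_ac)
  have "(\<integral>\<^sup>+x. L x \<partial>torus (Suc d)) = (\<integral>\<^sup>+x. \<integral>\<^sup>+t. L (x(d := t)) \<partial>circle \<partial>torus d)"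
    by (rule nn_integral_torus_Suc) measurable
  also have "\<dots> \<le> (\<integral>\<^sup>+x. ?C * (\<integral>\<^sup>+t. H (x(d := t)) \<partial>circle) \<partial>torus d)"
    by (intro nn_integral_mono inner)
  also have "\<dots> = ?C * (\<integral>\<^sup>+x. \<integral>\<^sup>+t. H (x(d := t)) \<partial>circle \<partial>torus d)"
  proof (rule nn_integral_cmult)
    have "(\<lambda>(x, t). H (x(d := t))) \<in> borel_measurable (torus d \<Otimes>\<^sub>M circle)"
      using measurable_compose[OF measurable_add_dim[of d "{..<d}" "\<lambda>_. circle"], of H borel]
      by (simp add: torus_Suc[symmetric] torus_def[symmetric] case_prod_unfold)
    then show "(\<lambda>x. \<integral>\<^sup>+t. H (x(d := t)) \<partial>circle) \<in> borel_measurable (torus d)"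
      by (rule circle.borel_measurable_nn_integral)
  qed
  also have "(\<integral>\<^sup>+x. \<integral>\<^sup>+t. H (x(d := t)) \<partial>circle \<partial>torus d) = (\<integral>\<^sup>+t. \<integral>\<^sup>+x. H (x(d := t)) \<partial>torus d \<partial>circle)"
    using nn_integral_torus_Suc[of H d] by simp
  also have "\<dots> \<le> (\<integral>\<^sup>+t. ?C ^ d * (\<integral>\<^sup>+x. G (x(d := t)) \<partial>torus d) \<partial>circle)"
    by (intro nn_integral_mono outer)
  also have "\<dots> = ?C ^ d * (\<integral>\<^sup>+t. \<integral>\<^sup>+x. G (x(d := t)) \<partial>torus d \<partial>circle)"
  proof (rule nn_integral_cmult)
    have sf: "sigma_finite_measure (torus d)" unfolding torus_def by (rule pc.sigma_finite) simp
    have "(\<lambda>(t, x). G (x(d := t))) \<in> borel_measurable (circle \<Otimes>\<^sub>M torus d)"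
      using measurable_compose[OF measurable_compose[OF measurable_pair_swap' measurable_add_dim[of d "{..<d}" "\<lambda>_. circle"]], of G borel]
      by (simp add: torus_Suc[symmetric] torus_def[symmetric] case_prod_unfold)
    then show "(\<lambda>t. \<integral>\<^sup>+x. G (x(d := t)) \<partial>torus d) \<in> borel_measurable circle"
      by (rule sigma_finite_measure.borel_measurable_nn_integral[OF sf])
  qed
  also have "(\<integral>\<^sup>+t. \<integral>\<^sup>+x. G (x(d := t)) \<partial>torus d \<partial>circle) = (\<integral>\<^sup>+x. G x \<partial>torus (Suc d))"
    using nn_integral_torus_Suc[of G d] by simp
  finally have "(\<integral>\<^sup>+x. L x \<partial>torus (Suc d)) \<le> ?C * (?C ^ d * (\<integral>\<^sup>+x. G x \<partial>torus (Suc d)))"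
    by (simp add: mult_left_mono)
  then show ?case unfolding L_def G_def by (simp add: mult.assoc)
qed

section \<open>Littlewood-Paley projections and Fourier coefficients\<close>

lemma prob_space_torus: "prob_space (torus d)"
  unfolding torus_def by (rule prob_space_PiM) (rule prob_space_circle)

lemma torus_fubini:
  fixes h :: "(nat \<Rightarrow> real) \<Rightarrow> complex"
  assumes "integrable (torus (Suc m)) h"
  shows "AE t in circle. integrable (torus m) (\<lambda>y. h (y(m := t)))"
    and "integrable circle (\<lambda>t. \<integral>y. h (y(m := t)) \<partial>torus m)"
    and "(\<integral>t. (\<integral>y. h (y(m := t)) \<partial>torus m) \<partial>circle) = (\<integral>x. h x \<partial>torus (Suc m))"
proof -
  interpret T: prob_space "torus m" by (rule prob_space_torus)
  interpret P: pair_sigma_finite circle "torus m" by standard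
  let ?u = "\<lambda>(t, X). X(m := t)"
  have d: "distr (circle \<Otimes>\<^sub>M torus m) (torus (Suc m)) ?u = torus (Suc m)"
    unfolding torus_Suc torus_def[of m] by (rule distr_pair_PiM_eq_PiM) (rule prob_space_circle)+
  have u: "?u \<in> measurable (circle \<Otimes>\<^sub>M torus m) (torus (Suc m))"
    unfolding torus_Suc torus_def[of m] case_prod_unfold
    by (rule measurable_fun_upd[where J = "{..<m}"]) auto
  have h: "h \<in> borel_measurable (torus (Suc m))" using assms by auto
  have int: "integrable (circle \<Otimes>\<^sub>M torus m) (\<lambda>(t, y). h (y(m := t)))"
    using integrable_distr_eq[OF u, of h] h assms unfolding d by (simp add: case_prod_unfold)
  show "AE t in circle. integrable (torus m) (\<lambda>y. h (y(m := t)))"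
    by (rule P.AE_integrable_fst'[OF int, unfolded prod.case])
  show "integrable circle (\<lambda>t. \<integral>y. h (y(m := t)) \<partial>torus m)"
    by (rule P.integrable_fst'[OF int, unfolded prod.case])
  have "(\<integral>t. (\<integral>y. h (y(m := t)) \<partial>torus m) \<partial>circle) = (\<integral>q. (\<lambda>(t, y). h (y(m := t))) q \<partial>(circle \<Otimes>\<^sub>M torus m))"
    using P.integral_fst'[OF int] by simp
  also have "\<dots> = (\<integral>x. h x \<partial>torus (Suc m))"
    using integral_distr[OF u h] unfolding d by (simp add: case_prod_unfold)
  finally show "(\<integral>t. (\<integral>y. h (y(m := t)) \<partial>torus m) \<partial>circle) = (\<integral>x. h x \<partial>torus (Suc m))" .
qed

lemma borel_measurable_cnj [measurable (raw)]:
  "f \<in> borel_measurable M \<Longrightarrow> (\<lambda>x. cnj (f x)) \<in> borel_measurable M"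
  by (rule measurable_compose[where g = cnj]) (auto intro!: borel_measurable_continuous_onI continuous_intros)

lemma cnj_echar: "exp (- (\<i> * of_real (2 * pi * of_int n * t))) = cnj (echar n t)"
  by (simp add: echar_def exp_cnj)

lemma cnj_echar_d: "exp (- (\<i> * of_real (2 * pi * (\<Sum>j<d. of_int (n j) * x j)))) = cnj (echar_d d n x)"
proof -
  have "echar_d d n x = exp (\<i> * of_real (2 * pi * (\<Sum>j<d. of_int (n j) * x j)))"
    unfolding echar_d_def echar_def
    by (simp add: exp_sum[symmetric] sum_distrib_left mult_ac)
  then show ?thesis by (simp add: exp_cnj)
qed

lemma LP_proj_echar: "LP_proj k g x = (\<Sum>l\<in>dyadic_block k. (\<integral>t. g t * cnj (echar l t) \<partial>circle) * echar l x)"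
  unfolding LP_proj_def circle_fourier_coeff_def cnj_echar echar_def[symmetric] ..

lemma fourier_coeff_echar_d: "fourier_coeff d f n = (\<integral>x. f x * cnj (echar_d d n x) \<partial>torus d)"
  unfolding fourier_coeff_def cnj_echar_d ..

lemma measurable_torus_upd:
  assumes "j < D"
  shows "(\<lambda>(x, t). x(j := t)) \<in> measurable (torus D \<Otimes>\<^sub>M circle) (torus D)"
  unfolding torus_def case_prod_unfold
  by (rule measurable_fun_upd[where J = "{..<D}"]) (use assms in auto)

lemma measurable_LP_proj_tensor:
  assumes f: "f \<in> borel_measurable (torus D)" and "m \<le> D"
  shows "LP_proj_tensor m k f \<in> borel_measurable (torus D)"
  using assms(2)
proof (induction m)
  case 0
  have "LP_proj_tensor 0 k f = f" by auto
  then show ?case using f by simp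
next
  case (Suc m)
  let ?g = "LP_proj_tensor m k f"
  have g: "?g \<in> borel_measurable (torus D)" using Suc by simp
  have [measurable]: "(\<lambda>(x, t). ?g (x(m := t))) \<in> borel_measurable (torus D \<Otimes>\<^sub>M circle)"
    using measurable_compose[OF measurable_torus_upd g] Suc.prems by (simp add: case_prod_unfold)
  have "(\<lambda>(x, t). ?g (x(m := t)) * cnj (echar l t)) \<in> borel_measurable (torus D \<Otimes>\<^sub>M circle)" for l
    by measurable
  then have *: "(\<lambda>x. \<integral>t. ?g (x(m := t)) * cnj (echar l t) \<partial>circle) \<in> borel_measurable (torus D)" for l
    by (rule circle.borel_measurable_lebesgue_integral)
  have [measurable]: "(\<lambda>x. x m) \<in> borel_measurable (torus D)" using Suc.prems by (intro measurable_torus_component) simp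
  have "LP_proj_tensor (Suc m) k f = (\<lambda>x. \<Sum>l\<in>dyadic_block (k m). (\<integral>t. ?g (x(m := t)) * cnj (echar l t) \<partial>circle) * echar l (x m))"
    by (auto simp: LP_proj_var_def LP_proj_echar)
  then show ?case using * by simp
qed

lemma finite_dyadic_block [simp]: "finite (dyadic_block k)"
  by (simp add: dyadic_block_def)

text \<open>The first \<open>m\<close> coordinates are free and the others frozen at
  \<open>x\<close>. At the point \<open>x\<close> the first \<open>m\<close> projections only see
  this function.\<close>

definition slice :: "nat \<Rightarrow> ((nat \<Rightarrow> real) \<Rightarrow> complex) \<Rightarrow> (nat \<Rightarrow> real) \<Rightarrow> (nat \<Rightarrow> real) \<Rightarrow> complex" where
  "slice m f x y = f (\<lambda>j. if j < m then y j else x j)"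

lemma echar_d_upd: "m \<le> i \<Longrightarrow> echar_d m n (x(i := t)) = echar_d m n x" "m \<le> i \<Longrightarrow> echar_d m (n(i := l)) x = echar_d m n x"
  unfolding echar_d_def by (auto intro!: prod.cong)

lemma integrable_mult_echar_d:
  assumes "integrable (torus m) g"
  shows "integrable (torus m) (\<lambda>y. g y * cnj (echar_d m n y))"
proof (rule Bochner_Integration.integrable_bound[OF assms])
  have [measurable]: "echar_d m n \<in> borel_measurable (torus m)" by (rule measurable_echar_d) simp
  have [measurable]: "g \<in> borel_measurable (torus m)" using assms by auto
  show "(\<lambda>y. g y * cnj (echar_d m n y)) \<in> borel_measurable (torus m)" by measurable
qed (simp add: norm_mult)

text \<open>Non-integrable slices contribute the junk value 0, but they form a null set, which disappears in the
  next integration. Measurability on all slices is what makes this legitimate, since a Bochner integral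
  of a non-measurable function is 0 as well.\<close>

lemma LP_proj_tensor_slice:
  assumes f: "f \<in> borel_measurable (torus D)" and "m \<le> D" and "x \<in> space (torus D)"
    and "integrable (torus m) (slice m f x)"
  shows "LP_proj_tensor m k f x =
     (\<Sum>n\<in>PiE {..<m} (\<lambda>j. dyadic_block (k j)). (\<integral>y. slice m f x y * cnj (echar_d m n y) \<partial>torus m) * echar_d m n x)"
  using assms(2-4)
proof (induction m arbitrary: x)
  case 0
  interpret prob_space "torus 0" by (rule prob_space_torus)
  show ?case by (simp add: slice_def echar_d_def prob_space)
next
  case (Suc m)
  let ?B = "PiE {..<m} (\<lambda>j. dyadic_block (k j))"
  let ?g = "slice (Suc m) f x"
  have sl: "?g (y(m := t)) = slice m f (x(m := t)) y" for y t
    unfolding slice_def by (rule arg_cong[where f = f]) auto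
  define c where "c n t = (\<integral>y. slice m f (x(m := t)) y * cnj (echar_d m n y) \<partial>torus m)" for n t
  have h_int: "integrable (torus (Suc m)) (\<lambda>y. ?g y * cnj (echar_d (Suc m) (n(m := l)) y))" for n l
    by (rule integrable_mult_echar_d[OF Suc.prems(3)])
  have h_eq: "(\<integral>y. ?g (y(m := t)) * cnj (echar_d (Suc m) (n(m := l)) (y(m := t))) \<partial>torus m) = c n t * cnj (echar l t)" for n l t
  proof -
    have "(\<lambda>y. ?g (y(m := t)) * cnj (echar_d (Suc m) (n(m := l)) (y(m := t)))) = (\<lambda>y. slice m f (x(m := t)) y * cnj (echar_d m n y) * cnj (echar l t))"
      unfolding sl echar_d_Suc_upd by (auto simp: echar_d_upd)
    then show ?thesis by (simp add: c_def)
  qed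
  have c_int: "integrable circle (\<lambda>t. c n t * cnj (echar l t))" for n l
    using torus_fubini(2)[OF h_int[of n l]] unfolding h_eq .
  have c_eq: "(\<integral>t. c n t * cnj (echar l t) \<partial>circle) = (\<integral>y. ?g y * cnj (echar_d (Suc m) (n(m := l)) y) \<partial>torus (Suc m))" for n l
    using torus_fubini(3)[OF h_int[of n l]] unfolding h_eq .
  have AE: "AE t in circle. LP_proj_tensor m k f (x(m := t)) = (\<Sum>n\<in>?B. c n t * echar_d m n x)"
    using torus_fubini(1)[OF Suc.prems(3)] AE_space
  proof eventually_elim
    case (elim t)
    have A: "x(m := t) \<in> space (torus D)"
      using elim(2) Suc.prems(1,2) by (auto simp: torus_def space_PiM PiE_iff extensional_def)
    have B: "integrable (torus m) (slice m f (x(m := t)))" using elim(1) unfolding sl .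
    have "LP_proj_tensor m k f (x(m := t)) = (\<Sum>n\<in>?B. c n t * echar_d m n (x(m := t)))"
      unfolding c_def using Suc.prems(1) by (intro Suc.IH[OF _ A B]) simp
    then show ?case unfolding echar_d_upd(1)[OF order_refl] .
  qed
  have mt: "(\<lambda>t. x(m := t)) \<in> measurable circle (torus D)"
    using measurable_compose[OF measurable_Pair1'[OF Suc.prems(2)] measurable_torus_upd[of m D]] Suc.prems(1)
    by (simp add: case_prod_unfold)
  have m1: "(\<lambda>t. LP_proj_tensor m k f (x(m := t))) \<in> borel_measurable circle"
    using measurable_compose[OF mt measurable_LP_proj_tensor[OF f, of m]] Suc.prems(1) by simp
  have "(\<integral>t. LP_proj_tensor m k f (x(m := t)) * cnj (echar l t) \<partial>circle) = (\<Sum>n\<in>?B. (\<integral>y. ?g y * cnj (echar_d (Suc m) (n(m := l)) y) \<partial>torus (Suc m)) * echar_d m n x)" for l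
  proof -
    have "(\<integral>t. LP_proj_tensor m k f (x(m := t)) * cnj (echar l t) \<partial>circle) = (\<integral>t. (\<Sum>n\<in>?B. c n t * cnj (echar l t) * echar_d m n x) \<partial>circle)"
    proof (rule integral_cong_AE)
      show "(\<lambda>t. LP_proj_tensor m k f (x(m := t)) * cnj (echar l t)) \<in> borel_measurable circle"
        using m1 by measurable
      show "(\<lambda>t. \<Sum>n\<in>?B. c n t * cnj (echar l t) * echar_d m n x) \<in> borel_measurable circle"
        by (intro borel_measurable_integrable Bochner_Integration.integrable_sum integrable_mult_left c_int)
      show "AE t in circle. LP_proj_tensor m k f (x(m := t)) * cnj (echar l t) = (\<Sum>n\<in>?B. c n t * cnj (echar l t) * echar_d m n x)"
        using AE
      proof eventually_elim
        case (elim t)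
        show ?case unfolding elim sum_distrib_right by (intro sum.cong refl) (simp only: mult_ac)
      qed
    qed
    also have "\<dots> = (\<Sum>n\<in>?B. (\<integral>t. c n t * cnj (echar l t) * echar_d m n x \<partial>circle))"
      by (intro Bochner_Integration.integral_sum integrable_mult_left c_int)
    also have "\<dots> = (\<Sum>n\<in>?B. (\<integral>t. c n t * cnj (echar l t) \<partial>circle) * echar_d m n x)"
      by (intro sum.cong refl integral_mult_left_zero)
    finally show ?thesis unfolding c_eq .
  qed
  then have "LP_proj_tensor (Suc m) k f x = (\<Sum>l\<in>dyadic_block (k m). (\<Sum>n\<in>?B. (\<integral>y. ?g y * cnj (echar_d (Suc m) (n(m := l)) y) \<partial>torus (Suc m)) * echar_d m n x) * echar l (x m))"
    by (simp add: LP_proj_var_def LP_proj_echar)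
  also have "\<dots> = (\<Sum>l\<in>dyadic_block (k m). \<Sum>n\<in>?B. (\<integral>y. ?g y * cnj (echar_d (Suc m) (n(m := l)) y) \<partial>torus (Suc m)) * echar_d (Suc m) (n(m := l)) x)"
  proof -
    have "echar_d (Suc m) (n(m := l)) x = echar_d m n x * echar l (x m)" for n l
      using echar_d_Suc_upd[of m "n(m := l)" x "x m"] by (simp add: echar_d_upd)
    then show ?thesis by (simp add: sum_distrib_right mult.assoc)
  qed
  also have "\<dots> = (\<Sum>n\<in>PiE {..<Suc m} (\<lambda>j. dyadic_block (k j)). (\<integral>y. ?g y * cnj (echar_d (Suc m) n y) \<partial>torus (Suc m)) * echar_d (Suc m) n x)"
    unfolding sum_PiE_lessThan_Suc by (rule sum.swap)
  finally show ?case .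
qed

text \<open>With all coordinates free the slice is \<open>f\<close> itself, so integrability of
  \<open>f\<close> gives the formula at every point of the torus and not merely almost
  everywhere.\<close>

theorem LP_proj_tensor_eq:
  assumes f: "integrable (torus d) f" and x: "x \<in> space (torus d)"
  shows "LP_proj_tensor d k f x = (\<Sum>n\<in>PiE {..<d} (\<lambda>j. dyadic_block (k j)). fourier_coeff d f n * echar_d d n x)"
proof -
  have sl: "slice d f x y = f y" if "y \<in> space (torus d)" for y
  proof -
    have "(\<lambda>j. if j < d then y j else x j) = y"
      using that x by (auto simp: torus_def space_PiM PiE_iff extensional_def fun_eq_iff)
    then show ?thesis by (simp add: slice_def)
  qed
  have "integrable (torus d) (slice d f x)"
    using f by (subst Bochner_Integration.integrable_cong[OF refl sl]) auto
  then have "LP_proj_tensor d k f x = (\<Sum>n\<in>PiE {..<d} (\<lambda>j. dyadic_block (k j)). (\<integral>y. slice d f x y * cnj (echar_d d n y) \<partial>torus d) * echar_d d n x)"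
    using f x by (intro LP_proj_tensor_slice[of f d]) auto
  moreover have "(\<integral>y. slice d f x y * cnj (echar_d d n y) \<partial>torus d) = fourier_coeff d f n" for n
    unfolding fourier_coeff_echar_d by (rule Bochner_Integration.integral_cong) (auto simp: sl)
  ultimately show ?thesis by simp
qed

section \<open>Fejer means\<close>

lemma epowr_ennreal: "r \<ge> 0 \<Longrightarrow> epowr (ennreal r) a = ennreal (r powr a)"
  by (simp add: epowr_def)

lemma epowr_top [simp]: "epowr top a = top"
  by (simp add: epowr_def)

lemma epowr_mono:
  assumes "x \<le> y" "a > 0"
  shows "epowr x a \<le> epowr y a"
proof (cases "y = top")
  case False
  then obtain s where s: "y = ennreal s" "s \<ge> 0" by (cases y) auto
  then obtain r where r: "x = ennreal r" "r \<ge> 0" using assms by (cases x) (auto simp: top_unique)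
  have "r \<le> s" using assms r s by (simp add: ennreal_le_iff)
  then show ?thesis using r s assms by (auto simp: epowr_ennreal intro!: ennreal_leI powr_mono2)
qed (use assms in simp)

lemma epowr_epowr: "epowr (epowr x a) b = epowr x (a * b)"
  by (cases x) (auto simp: epowr_ennreal powr_powr)

lemma epowr_one [simp]: "epowr x 1 = x"
  by (cases x) (auto simp: epowr_ennreal)

text \<open>Taking the inverse power on both sides reduces the claim to the least upper bound
  property.\<close>

lemma epowr_Sup_le:
  assumes a: "a > 0" and le: "\<And>i. i \<in> I \<Longrightarrow> epowr (f i) a \<le> y"
  shows "epowr (SUP i\<in>I. f i) a \<le> y"
proof -
  have "f i \<le> epowr y (1 / a)" if "i \<in> I" for i
    using epowr_mono[OF le[OF that], of "1 / a"] a by (simp add: epowr_epowr)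
  then have "(SUP i\<in>I. f i) \<le> epowr y (1 / a)" by (rule SUP_least)
  from epowr_mono[OF this a] show ?thesis using a by (simp add: epowr_epowr)
qed

lemma echar_add: "echar m t * echar n t = echar (m + n) t"
  by (simp add: echar_def exp_add[symmetric] algebra_simps)

lemma echar_minus: "echar (- n) t = cnj (echar n t)"
  by (simp add: echar_def exp_cnj)

lemma echar_diff_arg: "echar n (a - b) = echar n a * cnj (echar n b)"
  by (simp add: echar_def exp_cnj exp_add[symmetric] algebra_simps)

lemma echar_0 [simp]: "echar 0 t = 1"
  by (simp add: echar_def)

lemma circle_integral_echar: "(\<integral>t. echar n (a - t) \<partial>circle) = (if n = 0 then 1 else 0)"
proof -
  have c: "continuous_on {0..1} (\<lambda>t. echar n (a - t))" unfolding echar_def by (intro continuous_intros)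
  have R: "Re (echar n (a - t)) = cos (2 * pi * of_int (- n) * t + 2 * pi * of_int n * a)" for t
    by (simp add: echar_def Re_exp algebra_simps)
  have I: "Im (echar n (a - t)) = cos (2 * pi * of_int (- n) * t + (2 * pi * of_int n * a - pi / 2))" for t
  proof -
    have "cos (2 * pi * of_int (- n) * t + (2 * pi * of_int n * a - pi / 2)) = cos (2 * pi * of_int n * (a - t) - pi / 2)"
      by (simp add: algebra_simps)
    also have "\<dots> = sin (2 * pi * of_int n * (a - t))" by (simp add: cos_diff)
    finally show ?thesis by (simp add: echar_def Im_exp)
  qed
  have "Re (\<integral>t. echar n (a - t) \<partial>circle) = (\<integral>t. Re (echar n (a - t)) \<partial>circle)"
    "Im (\<integral>t. echar n (a - t) \<partial>circle) = (\<integral>t. Im (echar n (a - t)) \<partial>circle)"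
    using circle_integral(1)[OF c] by simp_all
  then show ?thesis unfolding R I circle_integral_cos by (auto simp: complex_eq_iff cos_diff)
qed

text \<open>The difference \<open>n\<close> occurs \<open>N - |n|\<close> times in a square of side
  \<open>N\<close>. Enlarging the square adds a row, a column and a corner, which together contain
  each difference from \<open>- N\<close> to \<open>N\<close> exactly once.\<close>

lemma sum_differences:
  fixes g :: "int \<Rightarrow> 'a::comm_ring_1"
  shows "(\<Sum>i<N. \<Sum>j<N. g (int i - int j)) = (\<Sum>n\<in>{- int N<..<int N}. of_int (int N - \<bar>n\<bar>) * g n)"
proof (induction N)
  case (Suc N)
  let ?S = "{- int N<..<int N}"
  have row: "(\<Sum>i<N. g (int i - int N)) + (\<Sum>j<N. g (int N - int j)) + g 0 = (\<Sum>n\<in>{- int N..int N}. g n)"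
  proof -
    have "(\<Sum>i<N. g (int i - int N)) = (\<Sum>n\<in>{- int N..-1}. g n)"
      by (rule sum.reindex_bij_witness[where i = "\<lambda>n. nat (n + int N)" and j = "\<lambda>i. int i - int N"]) auto
    moreover have "(\<Sum>j<N. g (int N - int j)) = (\<Sum>n\<in>{1..int N}. g n)"
      by (rule sum.reindex_bij_witness[where i = "\<lambda>n. nat (int N - n)" and j = "\<lambda>j. int N - int j"]) auto
    moreover have "{- int N..int N} = {- int N..-1} \<union> ({1..int N} \<union> {0})" by auto
    moreover have "(\<Sum>n\<in>{- int N..-1} \<union> ({1..int N} \<union> {0}). g n) = (\<Sum>n\<in>{- int N..-1}. g n) + ((\<Sum>n\<in>{1..int N}. g n) + g 0)"
    proof -
      have "(\<Sum>n\<in>{1..int N} \<union> {0}. g n) = (\<Sum>n\<in>{1..int N}. g n) + (\<Sum>n\<in>{0}. g n)"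
        by (rule sum.union_disjoint) auto
      moreover have "(\<Sum>n\<in>{- int N..-1} \<union> ({1..int N} \<union> {0}). g n) = (\<Sum>n\<in>{- int N..-1}. g n) + (\<Sum>n\<in>{1..int N} \<union> {0}. g n)"
        by (rule sum.union_disjoint) auto
      ultimately show ?thesis by simp
    qed
    ultimately show ?thesis by (simp add: add.assoc)
  qed
  have T: "{- int (Suc N)<..<int (Suc N)} = {- int N..int N}" by auto
  have "(\<Sum>n\<in>{- int (Suc N)<..<int (Suc N)}. of_int (int (Suc N) - \<bar>n\<bar>) * g n) = (\<Sum>n\<in>{- int N..int N}. of_int (int N - \<bar>n\<bar>) * g n) + (\<Sum>n\<in>{- int N..int N}. g n)"
    unfolding T sum.distrib[symmetric] by (intro sum.cong) (auto simp: algebra_simps)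
  also have "(\<Sum>n\<in>{- int N..int N}. of_int (int N - \<bar>n\<bar>) * g n) = (\<Sum>n\<in>?S. of_int (int N - \<bar>n\<bar>) * g n)"
    by (rule sum.mono_neutral_right) auto
  also have "\<dots> = (\<Sum>i<N. \<Sum>j<N. g (int i - int j))" by (rule Suc.IH[symmetric])
  finally show ?case using row by (simp add: sum.distrib algebra_simps)
qed simp

definition fejer_weight :: "nat \<Rightarrow> int \<Rightarrow> real" where
  "fejer_weight N n = (if \<bar>n\<bar> < int N then 1 - \<bar>real_of_int n\<bar> / real N else 0)"

definition fejer :: "nat \<Rightarrow> real \<Rightarrow> real" where
  "fejer N t = (cmod (\<Sum>j<N. echar (int j) t))\<^sup>2 / real N"

lemma fejer_nonneg: "fejer N t \<ge> 0"
  by (simp add: fejer_def)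

lemma fejer_eq:
  assumes "N > 0"
  shows "of_real (fejer N t) = (\<Sum>n\<in>{- int N<..<int N}. of_real (fejer_weight N n) * echar n t)"
proof -
  have "of_real ((cmod (\<Sum>j<N. echar (int j) t))\<^sup>2) = (\<Sum>i<N. echar (int i) t) * cnj (\<Sum>j<N. echar (int j) t)"
    by (simp only: complex_norm_square)
  also have "\<dots> = (\<Sum>i<N. \<Sum>j<N. echar (int i - int j) t)"
    unfolding cnj_sum sum_product
    by (intro sum.cong refl) (simp add: echar_minus[symmetric] echar_add)
  also have "\<dots> = (\<Sum>n\<in>{- int N<..<int N}. of_int (int N - \<bar>n\<bar>) * echar n t)"
    by (rule sum_differences)
  finally have "of_real (fejer N t) = (\<Sum>n\<in>{- int N<..<int N}. of_int (int N - \<bar>n\<bar>) * echar n t) / of_real (real N)"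
    by (simp add: fejer_def)
  also have "\<dots> = (\<Sum>n\<in>{- int N<..<int N}. of_real (fejer_weight N n) * echar n t)"
    unfolding sum_divide_distrib
  proof (rule sum.cong[OF refl])
    fix n assume "n \<in> {- int N<..<int N}"
    then have "\<bar>n\<bar> < int N" by auto
    then show "of_int (int N - \<bar>n\<bar>) * echar n t / of_real (real N) = of_real (fejer_weight N n) * echar n t"
    proof -
      have "complex_of_real \<bar>real_of_int n\<bar> = of_int \<bar>n\<bar>" by (metis of_int_abs of_real_of_int_eq)
      then show ?thesis using assms \<open>\<bar>n\<bar> < int N\<close> by (simp add: fejer_weight_def field_simps)
    qed
  qed
  finally show ?thesis .
qed

lemma measurable_fejer [measurable (raw)]:
  "f \<in> borel_measurable M \<Longrightarrow> (\<lambda>x. fejer N (f x)) \<in> borel_measurable M"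
  unfolding fejer_def
  by (intro borel_measurable_divide borel_measurable_power measurable_compose[OF _ borel_measurable_norm] borel_measurable_sum measurable_echar borel_measurable_const)

lemma fejer_integral:
  assumes "N > 0"
  shows "(\<integral>\<^sup>+t. ennreal (fejer N (a - t)) \<partial>circle) = 1"
proof -
  have c: "continuous_on {0..1} (\<lambda>t. fejer N (a - t))"
    unfolding fejer_def echar_def by (intro continuous_intros) (use assms in auto)
  have cc: "integrable circle (\<lambda>t. echar n (a - t))" for n
    unfolding echar_def by (intro circle_integral continuous_intros)
  have "complex_of_real (\<integral>t. fejer N (a - t) \<partial>circle) = (\<integral>t. of_real (fejer N (a - t)) \<partial>circle)" by simp
  also have "\<dots> = (\<Sum>n\<in>{- int N<..<int N}. of_real (fejer_weight N n) * (\<integral>t. echar n (a - t) \<partial>circle))"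
    unfolding fejer_eq[OF assms] by (subst Bochner_Integration.integral_sum) (auto intro: cc)
  also have "\<dots> = 1" unfolding circle_integral_echar using assms
    by (simp add: if_distrib[where f = "\<lambda>x. _ * x"] fejer_weight_def cong: if_cong)
  finally have "(\<integral>t. fejer N (a - t) \<partial>circle) = 1" by (simp only: of_real_eq_1_iff)
  then show ?thesis using circle_integral(1)[OF c] by (subst nn_integral_eq_integral) (auto simp: fejer_nonneg)
qed

lemma fejer_minus: "fejer N (- t) = fejer N t"
proof -
  have "(\<Sum>j<N. echar (int j) (- t)) = cnj (\<Sum>j<N. echar (int j) t)"
    by (simp add: echar_def exp_cnj)
  then show ?thesis unfolding fejer_def by (simp only: complex_mod_cnj)
qed

definition fejer_d :: "nat \<Rightarrow> nat \<Rightarrow> (nat \<Rightarrow> real) \<Rightarrow> (nat \<Rightarrow> real) \<Rightarrow> real" where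
  "fejer_d N d x y = (\<Prod>j<d. fejer N (x j - y j))"

lemma fejer_d_nonneg: "fejer_d N d x y \<ge> 0"
  unfolding fejer_d_def by (intro prod_nonneg) (auto simp: fejer_nonneg)

lemma fejer_d_sym: "fejer_d N d x y = fejer_d N d y x"
  unfolding fejer_d_def
proof (intro prod.cong refl)
  fix j
  show "fejer N (x j - y j) = fejer N (y j - x j)" using fejer_minus[of N "x j - y j"] by simp
qed

lemma fejer_d_integral:
  assumes "N > 0"
  shows "(\<integral>\<^sup>+y. ennreal (fejer_d N d x y) \<partial>torus d) = 1"
proof -
  have "(\<integral>\<^sup>+y. ennreal (fejer_d N d x y) \<partial>torus d) = (\<integral>\<^sup>+y. (\<Prod>j\<in>{..<d}. ennreal (fejer N (x j - y j))) \<partial>torus d)"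
    unfolding fejer_d_def by (subst prod_ennreal) (auto simp: fejer_nonneg)
  also have "\<dots> = (\<Prod>j\<in>{..<d}. (\<integral>\<^sup>+t. ennreal (fejer N (x j - t)) \<partial>circle))"
    unfolding torus_def by (rule pc.product_nn_integral_prod) auto
  finally show ?thesis by (simp add: fejer_integral[OF assms])
qed

lemma fejer_d_eq:
  assumes "N > 0"
  shows "of_real (fejer_d N d x y) = (\<Sum>n\<in>({..<d} \<rightarrow>\<^sub>E {- int N<..<int N}). of_real (\<Prod>j<d. fejer_weight N (n j)) * (echar_d d n x * cnj (echar_d d n y)))"
proof -
  have "of_real (fejer_d N d x y) = (\<Prod>j<d. \<Sum>n\<in>{- int N<..<int N}. of_real (fejer_weight N n) * echar n (x j - y j))"
    unfolding fejer_d_def of_real_prod fejer_eq[OF assms] ..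
  also have "\<dots> = (\<Sum>n\<in>({..<d} \<rightarrow>\<^sub>E {- int N<..<int N}). \<Prod>j<d. of_real (fejer_weight N (n j)) * echar (n j) (x j - y j))"
    by (rule prod_sum_PiE) auto
  also have "\<dots> = (\<Sum>n\<in>({..<d} \<rightarrow>\<^sub>E {- int N<..<int N}). of_real (\<Prod>j<d. fejer_weight N (n j)) * (echar_d d n x * cnj (echar_d d n y)))"
    by (simp add: prod.distrib echar_diff_arg echar_d_def)
  finally show ?thesis .
qed

definition fejer_mean :: "nat \<Rightarrow> nat \<Rightarrow> ((nat \<Rightarrow> real) \<Rightarrow> complex) \<Rightarrow> (nat \<Rightarrow> real) \<Rightarrow> complex" where
  "fejer_mean N d f x = (\<Sum>n\<in>({..<d} \<rightarrow>\<^sub>E {- int N<..<int N}). of_real (\<Prod>j<d. fejer_weight N (n j)) * fourier_coeff d f n * echar_d d n x)"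

lemma fejer_mean_integral:
  assumes "N > 0" "integrable (torus d) f"
  shows "fejer_mean N d f x = (\<integral>y. f y * of_real (fejer_d N d x y) \<partial>torus d)"
proof -
  have "(\<integral>y. f y * of_real (fejer_d N d x y) \<partial>torus d) =
     (\<integral>y. (\<Sum>n\<in>({..<d} \<rightarrow>\<^sub>E {- int N<..<int N}). (of_real (\<Prod>j<d. fejer_weight N (n j)) * echar_d d n x) * (f y * cnj (echar_d d n y))) \<partial>torus d)"
    unfolding fejer_d_eq[OF assms(1)] by (simp add: sum_distrib_left mult_ac)
  also have "\<dots> = (\<Sum>n\<in>({..<d} \<rightarrow>\<^sub>E {- int N<..<int N}). (of_real (\<Prod>j<d. fejer_weight N (n j)) * echar_d d n x) * (\<integral>y. f y * cnj (echar_d d n y) \<partial>torus d))"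
    by (subst Bochner_Integration.integral_sum) (auto intro!: integrable_mult_right integrable_mult_echar_d assms)
  finally show ?thesis unfolding fejer_mean_def fourier_coeff_echar_d by (simp add: mult_ac)
qed

text \<open>The convex function \<open>u powr p\<close> lies above its tangent at \<open>l\<close>.
  This linearised form serves as Jensen's inequality twice: for Fejer means and in the lower
  bound.\<close>

lemma tangent_powr:
  fixes u l p :: real
  assumes "u \<ge> 0" "l > 0" "p > 1"
  shows "p * l powr (p - 1) * u \<le> u powr p + (p - 1) * l powr p"
proof (cases "u = 0")
  case False
  have "(u powr p) powr (1 / p) * (l powr p) powr (1 - 1 / p) \<le> (1 / p) * u powr p + (1 - 1 / p) * l powr p"
    using assms False by (intro Youngs_inequality_0) auto
  moreover have "(u powr p) powr (1 / p) = u" using assms by (simp add: powr_powr)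
  moreover have "(l powr p) powr (1 - 1 / p) = l powr (p - 1)"
    using assms by (simp add: powr_powr right_diff_distrib)
  ultimately have "u * l powr (p - 1) \<le> (1 / p) * u powr p + (1 - 1 / p) * l powr p" by simp
  then have "p * (u * l powr (p - 1)) \<le> p * ((1 / p) * u powr p + (1 - 1 / p) * l powr p)"
    using assms by (intro mult_left_mono) auto
  also have "\<dots> = u powr p + (p - 1) * l powr p" using assms by (simp add: field_simps)
  finally show ?thesis by (simp add: mult_ac)
qed (use assms in auto)

text \<open>Jensen's inequality for the probability density \<open>fejer_d\<close>. The tangent is
  taken at the very number \<open>U\<close> to be estimated, so that the finite term
  \<open>(p - 1) * U powr p\<close> cancels in the end.\<close>

lemma fejer_mean_pointwise:
  assumes N: "N > 0" and f: "integrable (torus d) f" and p: "p > 1" and x: "x \<in> space (torus d)"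
  shows "ennreal (cmod (fejer_mean N d f x) powr p) \<le> (\<integral>\<^sup>+y. ennreal (cmod (f y) powr p) * ennreal (fejer_d N d x y) \<partial>torus d)"
proof -
  have [measurable]: "f \<in> borel_measurable (torus d)" using f by auto
  have mk [measurable]: "(\<lambda>y. fejer_d N d x y) \<in> borel_measurable (torus d)"
    unfolding fejer_d_def by (intro borel_measurable_prod measurable_fejer borel_measurable_diff measurable_torus_component) auto
  define U where "U = cmod (fejer_mean N d f x)"
  let ?R = "\<integral>\<^sup>+y. ennreal (cmod (f y) powr p) * ennreal (fejer_d N d x y) \<partial>torus d"
  have U: "ennreal U \<le> (\<integral>\<^sup>+y. ennreal (cmod (f y)) * ennreal (fejer_d N d x y) \<partial>torus d)"
  proof (cases "integrable (torus d) (\<lambda>y. f y * of_real (fejer_d N d x y))")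
    case True
    have "ennreal U \<le> (\<integral>\<^sup>+y. ennreal (norm (f y * of_real (fejer_d N d x y))) \<partial>torus d)"
      unfolding U_def fejer_mean_integral[OF N f] by (rule integral_norm_bound_ennreal[OF True])
    then show ?thesis by (simp add: norm_mult ennreal_mult fejer_d_nonneg abs_of_nonneg)
  next
    case False
    then show ?thesis unfolding U_def fejer_mean_integral[OF N f] by (simp add: not_integrable_integral_eq)
  qed
  show ?thesis
  proof (cases "U = 0")
    case False
    then have U0: "U > 0" by (simp add: U_def)
    have "ennreal (p * U powr p) = ennreal (p * U powr (p - 1)) * ennreal U"
      using U0 p by (subst ennreal_mult[symmetric]) (auto simp: powr_diff)
    also have "\<dots> \<le> ennreal (p * U powr (p - 1)) * (\<integral>\<^sup>+y. ennreal (cmod (f y)) * ennreal (fejer_d N d x y) \<partial>torus d)"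
      by (intro mult_left_mono U) auto
    also have "\<dots> = (\<integral>\<^sup>+y. ennreal (p * U powr (p - 1)) * (ennreal (cmod (f y)) * ennreal (fejer_d N d x y)) \<partial>torus d)"
      by (rule nn_integral_cmult[symmetric]) measurable
    also have "\<dots> \<le> (\<integral>\<^sup>+y. ennreal (cmod (f y) powr p) * ennreal (fejer_d N d x y) + ennreal ((p - 1) * U powr p) * ennreal (fejer_d N d x y) \<partial>torus d)"
    proof (intro nn_integral_mono)
      fix y
      have "ennreal (p * U powr (p - 1)) * ennreal (cmod (f y)) = ennreal (p * U powr (p - 1) * cmod (f y))"
        using p by (intro ennreal_mult[symmetric]) auto
      also have "\<dots> \<le> ennreal (cmod (f y) powr p + (p - 1) * U powr p)"
        using tangent_powr[of "cmod (f y)" U p] U0 p by (intro ennreal_leI) auto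
      also have "\<dots> = ennreal (cmod (f y) powr p) + ennreal ((p - 1) * U powr p)"
        using p by (intro ennreal_plus) auto
      finally have "(ennreal (p * U powr (p - 1)) * ennreal (cmod (f y))) * ennreal (fejer_d N d x y) \<le> (ennreal (cmod (f y) powr p) + ennreal ((p - 1) * U powr p)) * ennreal (fejer_d N d x y)"
        by (intro mult_right_mono) auto
      then show "ennreal (p * U powr (p - 1)) * (ennreal (cmod (f y)) * ennreal (fejer_d N d x y)) \<le> ennreal (cmod (f y) powr p) * ennreal (fejer_d N d x y) + ennreal ((p - 1) * U powr p) * ennreal (fejer_d N d x y)"
        by (simp only: mult.assoc distrib_right)
    qed
    also have "\<dots> = ?R + (\<integral>\<^sup>+y. ennreal ((p - 1) * U powr p) * ennreal (fejer_d N d x y) \<partial>torus d)"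
      by (rule nn_integral_add) measurable
    also have "(\<integral>\<^sup>+y. ennreal ((p - 1) * U powr p) * ennreal (fejer_d N d x y) \<partial>torus d) = ennreal ((p - 1) * U powr p) * (\<integral>\<^sup>+y. ennreal (fejer_d N d x y) \<partial>torus d)"
      by (rule nn_integral_cmult) measurable
    also have "\<dots> = ennreal ((p - 1) * U powr p)" by (simp add: fejer_d_integral[OF N])
    finally have main: "ennreal (p * U powr p) \<le> ?R + ennreal ((p - 1) * U powr p)" .
    show ?thesis
    proof (cases ?R)
      case (real r)
      then have "p * U powr p \<le> r + (p - 1) * U powr p"
        using main p by (simp add: ennreal_plus[symmetric] ennreal_le_iff del: ennreal_plus)
      then have "U powr p \<le> r" by (simp add: algebra_simps)
      then show ?thesis unfolding U_def[symmetric] real(2) by (rule ennreal_leI)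
    qed simp
  qed (simp add: U_def[symmetric])
qed

lemma fejer_mean_norm:
  assumes N: "N > 0" and f: "integrable (torus d) f" and p: "p > 1"
  shows "(\<integral>\<^sup>+x. ennreal (cmod (fejer_mean N d f x) powr p) \<partial>torus d) \<le> (\<integral>\<^sup>+y. ennreal (cmod (f y) powr p) \<partial>torus d)"
proof -
  interpret T: prob_space "torus d" by (rule prob_space_torus)
  interpret P: pair_sigma_finite "torus d" "torus d" by standard
  have [measurable]: "f \<in> borel_measurable (torus d)" using f by auto
  have mk [measurable]: "(\<lambda>(x, y). fejer_d N d x y) \<in> borel_measurable (torus d \<Otimes>\<^sub>M torus d)"
    unfolding fejer_d_def case_prod_unfold
    by (intro borel_measurable_prod measurable_fejer borel_measurable_diff
        measurable_compose[OF measurable_fst measurable_torus_component] measurable_compose[OF measurable_snd measurable_torus_component]) auto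
  have "(\<integral>\<^sup>+x. ennreal (cmod (fejer_mean N d f x) powr p) \<partial>torus d) \<le> (\<integral>\<^sup>+x. \<integral>\<^sup>+y. ennreal (cmod (f y) powr p) * ennreal (fejer_d N d x y) \<partial>torus d \<partial>torus d)"
    by (intro nn_integral_mono fejer_mean_pointwise N f p)
  also have "\<dots> = (\<integral>\<^sup>+y. \<integral>\<^sup>+x. ennreal (cmod (f y) powr p) * ennreal (fejer_d N d x y) \<partial>torus d \<partial>torus d)"
    by (rule P.Fubini') measurable
  also have "\<dots> = (\<integral>\<^sup>+y. ennreal (cmod (f y) powr p) * (\<integral>\<^sup>+x. ennreal (fejer_d N d y x) \<partial>torus d) \<partial>torus d)"
  proof (rule nn_integral_cong)
    fix y
    have "(\<lambda>x. fejer_d N d y x) \<in> borel_measurable (torus d)"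
      unfolding fejer_d_def by (intro borel_measurable_prod measurable_fejer borel_measurable_diff measurable_torus_component) auto
    then show "(\<integral>\<^sup>+x. ennreal (cmod (f y) powr p) * ennreal (fejer_d N d x y) \<partial>torus d) = ennreal (cmod (f y) powr p) * (\<integral>\<^sup>+x. ennreal (fejer_d N d y x) \<partial>torus d)"
      by (subst fejer_d_sym) (intro nn_integral_cmult measurable_compose[OF _ measurable_ennreal])
  qed
  finally show ?thesis by (simp add: fejer_d_integral[OF N])
qed

section \<open>The upper bound\<close>

lemma dyadic_block_nonneg: "k \<ge> 0 \<Longrightarrow> dyadic_block k = int ` nat_block (nat k)"
proof -
  assume k: "k \<ge> 0"
  show ?thesis
  proof (cases "k = 0")
    case False
    have "int (2 ^ nat k - 1) = 2 ^ nat k - 1" by (simp add: of_nat_diff)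
    then show ?thesis using k False
      by (simp add: dyadic_block_def nat_block_def image_int_atLeastAtMost)
  qed (simp add: dyadic_block_def nat_block_def)
qed

lemma dyadic_block_neg: "k < 0 \<Longrightarrow> n \<in> dyadic_block k \<Longrightarrow> n < 0"
proof -
  assume "k < 0" "n \<in> dyadic_block k"
  then have "n \<le> - (2 ^ (nat (- k) - 1))" by (simp add: dyadic_block_def)
  moreover have "(0::int) < 2 ^ (nat (- k) - 1)" by simp
  ultimately show "n < 0" by linarith
qed

lemma nat_block_less: "m \<in> nat_block k \<Longrightarrow> m < 2 ^ k"
proof -
  assume "m \<in> nat_block k"
  then have "m \<le> 2 ^ k - 1" by (auto simp: nat_block_def split: if_splits)
  moreover have "(0::nat) < 2 ^ k" by simp
  ultimately show ?thesis by linarith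
qed

lemma analytic_Hardy_integrable:
  assumes f: "f \<in> Lp_space (torus d) p" and p: "p > 1" and le: "cLp_norm (torus d) p f \<le> 1"
  shows "(\<integral>\<^sup>+x. ennreal (cmod (f x) powr p) \<partial>torus d) \<le> 1" "integrable (torus d) f"
proof -
  interpret T: prob_space "torus d" by (rule prob_space_torus)
  have [measurable]: "f \<in> borel_measurable (torus d)" using f by (simp add: Lp_space_def)
  have "epowr (cLp_norm (torus d) p f) p \<le> epowr (ennreal 1) p"
    using le p by (intro epowr_mono) auto
  then show le1: "(\<integral>\<^sup>+x. ennreal (cmod (f x) powr p) \<partial>torus d) \<le> 1"
    using p by (subst (asm) epowr_ennreal) (simp_all add: Lp_norm_def epowr_epowr epowr_ennreal)
  have "(\<integral>\<^sup>+x. ennreal (cmod (f x)) \<partial>torus d) \<le> (\<integral>\<^sup>+x. 1 + ennreal (cmod (f x) powr p) \<partial>torus d)"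
  proof (intro nn_integral_mono)
    fix x
    have "cmod (f x) \<le> 1 + cmod (f x) powr p"
    proof (cases "cmod (f x) \<le> 1")
      case False
      then have "cmod (f x) powr 1 \<le> cmod (f x) powr p" using p by (intro powr_mono) auto
      then show ?thesis using False by simp
    qed (simp add: add_increasing2)
    then have "ennreal (cmod (f x)) \<le> ennreal (1 + cmod (f x) powr p)" by (rule ennreal_leI)
    then show "ennreal (cmod (f x)) \<le> 1 + ennreal (cmod (f x) powr p)" by simp
  qed
  also have "\<dots> = 1 + (\<integral>\<^sup>+x. ennreal (cmod (f x) powr p) \<partial>torus d)"
    by (subst nn_integral_add) (auto simp: T.emeasure_space_1)
  also have "\<dots> < top" using le1 by (simp add: order_le_less_trans)
  finally show "integrable (torus d) f" by (simp add: integrable_iff_bounded)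
qed

definition freq_box :: "nat \<Rightarrow> (nat \<Rightarrow> nat) \<Rightarrow> (nat \<Rightarrow> int) set" where
  "freq_box d k = PiE {..<d} (\<lambda>j. int ` nat_block (k j))"

definition partial_square :: "nat \<Rightarrow> nat \<Rightarrow> ((nat \<Rightarrow> real) \<Rightarrow> complex) \<Rightarrow> (nat \<Rightarrow> real) \<Rightarrow> real" where
  "partial_square d K f x = (\<Sum>k\<in>({..<d} \<rightarrow>\<^sub>E {..K}). (cmod (\<Sum>n\<in>freq_box d k. fourier_coeff d f n * echar_d d n x))\<^sup>2)"

lemma partial_square_nonneg: "partial_square d K f x \<ge> 0"
  unfolding partial_square_def by (intro sum_nonneg) auto

lemma measurable_partial_square: "partial_square d K f \<in> borel_measurable (torus d)"
proof -
  have [measurable]: "echar_d d n \<in> borel_measurable (torus d)" for n by (rule measurable_echar_d) simp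
  show ?thesis unfolding partial_square_def[abs_def] by measurable
qed

lemma fejer_weight_tendsto: "(\<lambda>N. fejer_weight (N + M) n) \<longlonglongrightarrow> 1"
proof -
  have "(\<lambda>N. fejer_weight N n) \<longlonglongrightarrow> 1"
  proof (rule Lim_transform_eventually)
    have "(\<lambda>N. \<bar>real_of_int n\<bar> / real N) \<longlonglongrightarrow> 0" by (rule lim_const_over_n)
    from tendsto_diff[OF tendsto_const this, of 1] show "(\<lambda>N. 1 - \<bar>real_of_int n\<bar> / real N) \<longlonglongrightarrow> 1" by simp
    show "\<forall>\<^sub>F N in sequentially. 1 - \<bar>real_of_int n\<bar> / real N = fejer_weight N n"
      using eventually_gt_at_top[of "nat \<bar>n\<bar>"] by eventually_elim (auto simp: fejer_weight_def)
  qed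
  then show ?thesis by (rule LIMSEQ_ignore_initial_segment)
qed

text \<open>Fejer means are polynomials, analytic with \<open>f\<close>, and their norm is at most
  that of \<open>f\<close>. Only finitely many coefficients enter \<open>partial_square\<close>, so
  the convergence of the weights to 1 gives convergence at every point, and Fatou's lemma
  applies.\<close>

lemma partial_square_bound:
  assumes p: "1 < p" "p < 2" and f: "f \<in> analytic_Hardy d p" and le: "cLp_norm (torus d) p f \<le> 1"
  shows "(\<integral>\<^sup>+x. ennreal (partial_square d K f x powr (p/2)) \<partial>torus d) \<le> ennreal (50000 / (p - 1)) ^ d"
proof -
  let ?C = "ennreal (50000 / (p - 1))"
  let ?B = "{..<d} \<rightarrow>\<^sub>E {..K}"
  have fL: "f \<in> Lp_space (torus d) p" using f by (simp add: analytic_Hardy_def)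
  note f1 = analytic_Hardy_integrable[OF fL p(1) le]
  have neg: "fourier_coeff d f n = 0" if "n \<in> freqs d" "j < d" "n j < 0" for n j
    using f that by (force simp: analytic_Hardy_def fourier_support_def)
  \<comment> \<open>The shift makes the degree exceed all frequencies of the blocks up to
    \<open>K\<close>, so every box lies inside the spectrum for each \<open>N\<close>.\<close>
  define M where "M = 2 ^ K + (1::nat)"
  define W where "W N n = (\<Prod>j<d. fejer_weight (N + M) (n j))" for N n
  define g where "g N x = (\<Sum>k\<in>?B. (cmod (\<Sum>n\<in>freq_box d k. of_real (W N n) * fourier_coeff d f n * echar_d d n x))\<^sup>2)" for N x
  have g0: "g N x \<ge> 0" for N x unfolding g_def by (intro sum_nonneg) auto
  have bound: "(\<integral>\<^sup>+x. ennreal (g N x powr (p/2)) \<partial>torus d) \<le> ?C ^ d" for N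
  proof -
    let ?N = "N + M"
    \<comment> \<open>Frequencies with a negative entry have coefficient 0 and are dropped, as the
      polynomial inequality needs nonnegative ones.\<close>
    define F where "F = {n \<in> ({..<d} \<rightarrow>\<^sub>E {- int ?N<..<int ?N}). \<forall>j<d. n j \<ge> 0}"
    have finF: "finite F" unfolding F_def by (intro finite_subset[OF _ finite_PiE[of "{..<d}" "\<lambda>_. {- int ?N<..<int ?N}"]]) auto
    have box: "{n\<in>F. in_blocks d k n} = freq_box d k" if k: "k \<in> ?B" for k
    proof -
      have "- int ?N < i \<and> i < int ?N \<and> 0 \<le> i" if "j < d" "i \<in> int ` nat_block (k j)" for i j
      proof -
        have "i \<in> int ` nat_block (k j)" by (rule that(2))
        then obtain m where m: "i = int m" "m \<in> nat_block (k j)" by blast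
        have "m < 2 ^ k j" using m by (intro nat_block_less)
        also have "(2::nat) ^ k j \<le> 2 ^ K" using k that by (intro power_increasing) (auto simp: PiE_iff)
        finally have "m < ?N" by (simp add: M_def)
        then have "int m < int ?N" by (simp only: of_nat_less_iff)
        moreover have "int m \<ge> 0" by (rule of_nat_0_le_iff)
        ultimately show ?thesis unfolding m by linarith
      qed
      note inside = this
      show ?thesis
      proof (rule set_eqI)
        fix n
        show "n \<in> {n\<in>F. in_blocks d k n} \<longleftrightarrow> n \<in> freq_box d k"
          unfolding F_def in_blocks_def freq_box_def PiE_iff mem_Collect_eq greaterThanLessThan_iff lessThan_iff Ball_def
          using inside by blast
      qed
    qed
    have "fejer_mean ?N d f x = (\<Sum>n\<in>F. (of_real (W N n) * fourier_coeff d f n) * echar_d d n x)" for x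
      unfolding fejer_mean_def W_def
    proof (rule sum.mono_neutral_right)
      show "\<forall>n\<in>({..<d} \<rightarrow>\<^sub>E {- int ?N<..<int ?N}) - F. of_real (\<Prod>j<d. fejer_weight ?N (n j)) * fourier_coeff d f n * echar_d d n x = 0"
      proof
        fix n assume n: "n \<in> ({..<d} \<rightarrow>\<^sub>E {- int ?N<..<int ?N}) - F"
        then obtain j where "j < d" "n j < 0" by (auto simp: F_def not_le)
        moreover have "n \<in> freqs d" using n by (auto simp: freqs_def PiE_iff)
        ultimately show "of_real (\<Prod>j<d. fejer_weight ?N (n j)) * fourier_coeff d f n * echar_d d n x = 0" using neg by simp
      qed
    qed (auto simp: F_def intro!: finite_PiE)
    then have "(\<integral>\<^sup>+x. ennreal ((cmod (\<Sum>n\<in>F. (of_real (W N n) * fourier_coeff d f n) * echar_d d n x))\<^sup>2 powr (p/2)) \<partial>torus d) = (\<integral>\<^sup>+x. ennreal (cmod (fejer_mean ?N d f x) powr p) \<partial>torus d)"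
      by (simp add: powr_powr flip: powr_numeral)
    also have "\<dots> \<le> 1" by (rule order_trans[OF fejer_mean_norm[OF _ f1(2) p(1)] f1(1)]) (simp add: M_def)
    finally have 1: "(\<integral>\<^sup>+x. ennreal ((cmod (\<Sum>n\<in>F. (of_real (W N n) * fourier_coeff d f n) * echar_d d n x))\<^sup>2 powr (p/2)) \<partial>torus d) \<le> 1" .
    have "(\<integral>\<^sup>+x. ennreal (g N x powr (p/2)) \<partial>torus d) =
      (\<integral>\<^sup>+x. ennreal ((\<Sum>k\<in>?B. (cmod (\<Sum>n\<in>{n\<in>F. in_blocks d k n}. of_real (W N n) * fourier_coeff d f n * echar_d d n x))\<^sup>2) powr (p/2)) \<partial>torus d)"
      unfolding g_def by (simp add: box cong: sum.cong)
    also have "\<dots> \<le> ?C ^ d * (\<integral>\<^sup>+x. ennreal ((cmod (\<Sum>n\<in>F. (of_real (W N n) * fourier_coeff d f n) * echar_d d n x))\<^sup>2 powr (p/2)) \<partial>torus d)"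
      by (rule square_function_polynomial[OF p finF]) (auto simp: F_def)
    also have "\<dots> \<le> ?C ^ d * 1" by (intro mult_left_mono 1) auto
    finally show ?thesis by simp
  qed
  have [measurable]: "echar_d d n \<in> borel_measurable (torus d)" for n by (rule measurable_echar_d) simp
  have gm: "(\<lambda>x. ennreal (g N x powr (p/2))) \<in> borel_measurable (torus d)" for N
    unfolding g_def by measurable
  have lim: "(\<lambda>N. ennreal (g N x powr (p/2))) \<longlonglongrightarrow> ennreal (partial_square d K f x powr (p/2))" for x
  proof -
    have "(\<lambda>N. W N n) \<longlonglongrightarrow> (\<Prod>j<d. 1)" for n unfolding W_def by (intro tendsto_prod fejer_weight_tendsto)
    then have "(\<lambda>N. g N x) \<longlonglongrightarrow> (\<Sum>k\<in>?B. (cmod (\<Sum>n\<in>freq_box d k. of_real 1 * fourier_coeff d f n * echar_d d n x))\<^sup>2)"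
      unfolding g_def by (intro tendsto_intros) simp
    then have "(\<lambda>N. g N x) \<longlonglongrightarrow> partial_square d K f x" by (simp add: partial_square_def)
    then show ?thesis using p g0 by (intro tendsto_ennrealI tendsto_powr') auto
  qed
  have "(\<integral>\<^sup>+x. ennreal (partial_square d K f x powr (p/2)) \<partial>torus d) = (\<integral>\<^sup>+x. liminf (\<lambda>N. ennreal (g N x powr (p/2))) \<partial>torus d)"
    using lim_imp_Liminf[OF _ lim] by simp
  also have "\<dots> \<le> liminf (\<lambda>N. \<integral>\<^sup>+x. ennreal (g N x powr (p/2)) \<partial>torus d)"
    by (rule nn_integral_liminf[OF gm])
  also have "\<dots> \<le> liminf (\<lambda>N::nat. ?C ^ d)" by (intro Liminf_mono always_eventually allI bound)
  finally show ?thesis by (simp add: Liminf_const)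
qed

text \<open>The sum over all integer indices is the supremum of its finite subsums. By analyticity
  the terms with a negative index vanish, and the rest of a finite subsum is contained in the cube
  of indices up to some \<open>K\<close>.\<close>

lemma LP_square_le:
  assumes p: "p > 1" and f: "f \<in> analytic_Hardy d p" and fi: "integrable (torus d) f" and x: "x \<in> space (torus d)"
  shows "epowr (LP_square d f x) p \<le> (SUP K. ennreal (partial_square d K f x powr (p/2)))"
proof -
  let ?y = "SUP K. ennreal (partial_square d K f x powr (p/2))"
  let ?g = "\<lambda>k. ennreal ((cmod (LP_proj_tensor d k f x))\<^sup>2)"
  have neg: "fourier_coeff d f n = 0" if "n \<in> freqs d" "j < d" "n j < 0" for n j
    using f that by (force simp: analytic_Hardy_def fourier_support_def)
  have zero: "LP_proj_tensor d k f x = 0" if "j < d" "k j < 0" for k j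
    unfolding LP_proj_tensor_eq[OF fi x]
  proof (intro sum.neutral ballI)
    fix n assume n: "n \<in> PiE {..<d} (\<lambda>j. dyadic_block (k j))"
    then have "n j \<in> dyadic_block (k j)" using that by auto
    then have "n j < 0" using that dyadic_block_neg by blast
    moreover have "n \<in> freqs d" using n by (auto simp: freqs_def PiE_iff)
    ultimately show "fourier_coeff d f n * echar_d d n x = 0" using neg that by simp
  qed
  have fin: "epowr (sum ?g F) (p / 2) \<le> ?y" if F: "finite F" "F \<subseteq> freqs d" for F
  proof -
    define F' where "F' = {k\<in>F. \<forall>j<d. k j \<ge> 0}"
    have F': "finite F'" "F' \<subseteq> freqs d" using F by (auto simp: F'_def)
    define K where "K = (\<Sum>k\<in>F'. \<Sum>j<d. nat (k j))"
    define r where "r k = (\<lambda>j\<in>{..<d}. nat (k j))" for k :: "nat \<Rightarrow> int"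
    have K: "nat (k j) \<le> K" if "k \<in> F'" "j < d" for k j
    proof -
      have "nat (k j) \<le> (\<Sum>j<d. nat (k j))" using that by (intro member_le_sum) auto
      also have "\<dots> \<le> K" unfolding K_def using that F' by (intro member_le_sum[of k]) auto
      finally show ?thesis .
    qed
    have inj: "inj_on r F'"
    proof (rule inj_onI)
      fix k l assume kl: "k \<in> F'" "l \<in> F'" "r k = r l"
      show "k = l"
      proof (rule PiE_ext[of k "{..<d}" "\<lambda>_. UNIV" l])
        fix j assume j: "j \<in> {..<d}"
        then have "nat (k j) = nat (l j)" using fun_cong[OF kl(3), of j] by (simp add: r_def)
        moreover have "k j \<ge> 0" "l j \<ge> 0" using kl j by (auto simp: F'_def)
        ultimately show "k j = l j" by simp
      qed (use kl F' in \<open>auto simp: freqs_def\<close>)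
    qed
    have "sum ?g F = sum ?g F'"
      unfolding F'_def
    proof (intro sum.mono_neutral_right F ballI)
      fix k assume "k \<in> F - {k\<in>F. \<forall>j<d. k j \<ge> 0}"
      then obtain j where "j < d" "k j < 0" by (auto simp: not_le)
      then show "?g k = 0" by (simp add: zero)
    qed auto
    also have "\<dots> = ennreal (\<Sum>k\<in>F'. (cmod (LP_proj_tensor d k f x))\<^sup>2)"
      by (rule sum_ennreal) auto
    also have "(\<Sum>k\<in>F'. (cmod (LP_proj_tensor d k f x))\<^sup>2) = (\<Sum>k\<in>F'. (cmod (\<Sum>n\<in>freq_box d (r k). fourier_coeff d f n * echar_d d n x))\<^sup>2)"
    proof (rule sum.cong[OF refl])
      fix k assume k: "k \<in> F'"
      have "PiE {..<d} (\<lambda>j. dyadic_block (k j)) = freq_box d (r k)"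
        unfolding freq_box_def using k by (intro PiE_cong) (auto simp: F'_def r_def dyadic_block_nonneg)
      then show "(cmod (LP_proj_tensor d k f x))\<^sup>2 = (cmod (\<Sum>n\<in>freq_box d (r k). fourier_coeff d f n * echar_d d n x))\<^sup>2"
        unfolding LP_proj_tensor_eq[OF fi x] by simp
    qed
    also have "\<dots> = (\<Sum>l\<in>r ` F'. (cmod (\<Sum>n\<in>freq_box d l. fourier_coeff d f n * echar_d d n x))\<^sup>2)"
      by (simp add: sum.reindex[OF inj])
    finally have eq: "sum ?g F = ennreal (\<Sum>l\<in>r ` F'. (cmod (\<Sum>n\<in>freq_box d l. fourier_coeff d f n * echar_d d n x))\<^sup>2)" .
    have "(\<Sum>l\<in>r ` F'. (cmod (\<Sum>n\<in>freq_box d l. fourier_coeff d f n * echar_d d n x))\<^sup>2) \<le> partial_square d K f x"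
      unfolding partial_square_def
    proof (rule sum_mono2)
      show "r ` F' \<subseteq> ({..<d} \<rightarrow>\<^sub>E {..K})" by (auto simp: r_def K PiE_iff extensional_def split: if_splits)
    qed (auto intro: finite_PiE)
    then have "epowr (sum ?g F) (p / 2) \<le> epowr (ennreal (partial_square d K f x)) (p / 2)"
      unfolding eq using p by (intro epowr_mono ennreal_leI) auto
    also have "\<dots> = ennreal (partial_square d K f x powr (p / 2))"
      by (rule epowr_ennreal[OF partial_square_nonneg])
    also have "\<dots> \<le> ?y" by (rule SUP_upper) simp
    finally show ?thesis .
  qed
  have "epowr (LP_square d f x) p = epowr (\<Sum>\<^sub>\<infinity>k\<in>freqs d. ?g k) (p / 2)"
    unfolding LP_square_def epowr_epowr by simp
  also have "(\<Sum>\<^sub>\<infinity>k\<in>freqs d. ?g k) = (SUP F\<in>{F. finite F \<and> F \<subseteq> freqs d}. sum ?g F)"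
    by (rule nonneg_infsum_complete) auto
  also have "epowr \<dots> (p / 2) \<le> ?y"
    using p by (intro epowr_Sup_le fin) auto
  finally show ?thesis .
qed

theorem LP_square_upper_bound:
  assumes p: "1 < p" "p < 2" and f: "f \<in> analytic_Hardy d p" and le: "cLp_norm (torus d) p f \<le> 1"
  shows "Lp_norm (torus d) p (LP_square d f) \<le> ennreal (50000 ^ d * (p - 1) powi (- int d))"
proof -
  let ?c = "50000 / (p - 1)"
  have fL: "f \<in> Lp_space (torus d) p" using f by (simp add: analytic_Hardy_def)
  note f1 = analytic_Hardy_integrable[OF fL p(1) le]
  have "(\<integral>\<^sup>+x. epowr (LP_square d f x) p \<partial>torus d) \<le> (\<integral>\<^sup>+x. (SUP K. ennreal (partial_square d K f x powr (p/2))) \<partial>torus d)"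
    by (intro nn_integral_mono LP_square_le p f f1)
  also have "\<dots> = (SUP K. \<integral>\<^sup>+x. ennreal (partial_square d K f x powr (p/2)) \<partial>torus d)"
  proof (rule nn_integral_monotone_convergence_SUP)
    have "partial_square d K f x \<le> partial_square d L f x" if "K \<le> L" for K L x
      unfolding partial_square_def using that
      by (intro sum_mono2 finite_PiE PiE_mono) auto
    then show "incseq (\<lambda>K x. ennreal (partial_square d K f x powr (p/2)))"
      using p by (intro incseq_SucI le_funI ennreal_leI powr_mono2 partial_square_nonneg) auto
    show "(\<lambda>x. ennreal (partial_square d K f x powr (p/2))) \<in> borel_measurable (torus d)" for K
      using measurable_partial_square[of d K f] by measurable
  qed
  also have "\<dots> \<le> ennreal ?c ^ d"
    by (intro SUP_least partial_square_bound p f le)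
  also have "\<dots> = ennreal (?c ^ d)" using p by (simp add: ennreal_power)
  finally have "Lp_norm (torus d) p (LP_square d f) \<le> epowr (ennreal (?c ^ d)) (1 / p)"
    unfolding Lp_norm_def using p by (intro epowr_mono) auto
  also have "\<dots> = ennreal ((?c ^ d) powr (1 / p))" using p by (intro epowr_ennreal) auto
  also have "\<dots> \<le> ennreal (?c ^ d)"
  \<comment> \<open>The bound is at least 1, so the exponent \<open>1 / p < 1\<close> does not
    increase it.\<close>
  proof (rule ennreal_leI)
    have "1 \<le> ?c ^ d" using p by (intro one_le_power) (auto simp: field_simps)
    then have "(?c ^ d) powr (1 / p) \<le> (?c ^ d) powr 1" using p by (intro powr_mono) auto
    then show "(?c ^ d) powr (1 / p) \<le> ?c ^ d" using p by simp
  qed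
  also have "?c ^ d = 50000 ^ d * (p - 1) powi (- int d)"
    by (simp add: power_divide power_int_minus divide_inverse power_inverse)
  finally show ?thesis .
qed

section \<open>The lower bound\<close>

lemma echar_at_1 [simp]: "echar n 1 = 1"
proof -
  have "echar n 1 = exp (of_real (2 * of_int n * pi) * \<i>)" by (simp add: echar_def mult_ac)
  also have "\<dots> = cis (2 * pi * of_int n)" by (simp add: cis_conv_exp mult_ac)
  also have "\<dots> = 1" by (rule cis_multiple_2pi) simp
  finally show ?thesis .
qed

lemma echar_at_0 [simp]: "echar n 0 = 1"
  by (simp add: echar_def)

lemma continuous_on_echar [continuous_intros]: "continuous_on S f \<Longrightarrow> continuous_on S (\<lambda>x. echar n (f x))"
  unfolding echar_def by (intro continuous_intros)

lemma echar_has_vector_derivative: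
  "(echar n has_vector_derivative (2 * pi * of_int n * \<i>) * echar n t) (at t within S)"
proof -
  have "((\<lambda>t. (2 * pi * of_int n * \<i>) * of_real t) has_vector_derivative 2 * pi * of_int n * \<i>) (at t)"
    by (auto intro!: derivative_eq_intros)
  from field_vector_diff_chain_at[OF this DERIV_exp]
  have "((\<lambda>t. exp ((2 * pi * of_int n * \<i>) * of_real t)) has_vector_derivative (2 * pi * of_int n * \<i>) * exp ((2 * pi * of_int n * \<i>) * of_real t)) (at t)"
    by (simp only: o_def)
  moreover have "echar n = (\<lambda>t. exp ((2 * pi * of_int n * \<i>) * of_real t))"
    by (simp add: echar_def fun_eq_iff mult_ac)
  ultimately show ?thesis by (simp only: has_vector_derivative_at_within)
qed

lemma circle_integral_echar_mult:
  "(\<integral>t. echar l t * cnj (echar m t) \<partial>circle) = (if l = m then 1 else 0)"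
proof -
  have "echar l t * cnj (echar m t) = echar (m - l) (0 - t)" for t
  proof -
    have "echar (m - l) (0 - t) = echar (l - m) t" by (simp add: echar_def algebra_simps)
    also have "\<dots> = echar l t * echar (- m) t" by (simp add: echar_add)
    finally show ?thesis by (simp add: echar_minus)
  qed
  note eq = this
  show ?thesis unfolding eq circle_integral_echar by auto
qed

text \<open>Integration by parts. The coefficients of this bounded function decay only like
  \<open>1 / m\<close> with constant phase for \<open>m > 0\<close>; pairing half of a Fejer kernel
  with it therefore produces a harmonic sum.\<close>

lemma circle_integral_echar_sawtooth:
  "(\<integral>t. echar m t * of_real (t - 1/2) \<partial>circle) = (if m = 0 then 0 else 1 / (2 * pi * of_int m * \<i>))"
proof -
  have c: "continuous_on {0..1} (\<lambda>t. echar m t * of_real (t - 1/2))" by (intro continuous_intros)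
  show ?thesis
  proof (cases "m = 0")
    case True
    have r: "((\<lambda>t::real. t - 1/2) has_integral ((1 - 1/2)\<^sup>2 / 2 - (0 - 1/2)\<^sup>2 / 2)) {0..1}"
      by (rule fundamental_theorem_of_calculus)
        (auto intro!: derivative_eq_intros simp: has_real_derivative_iff_has_vector_derivative[symmetric])
    have "((\<lambda>t. complex_of_real (t - 1/2)) has_integral of_real ((1 - 1/2)\<^sup>2 / 2 - (0 - 1/2)\<^sup>2 / 2)) {0..1}"
      using has_integral_linear[OF r bounded_linear_of_real] by (simp only: o_def)
    then show ?thesis unfolding circle_integral(2)[OF c] using True by (simp add: integral_unique)
  next
    case False
    define w where "w = 2 * pi * of_int m * \<i>"
    have w: "w \<noteq> 0" using False by (simp add: w_def)
    let ?G = "\<lambda>t. of_real (t - 1/2) * (echar m t / w) - echar m t / w\<^sup>2"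
    have "((\<lambda>t. echar m t * of_real (t - 1/2)) has_integral (?G 1 - ?G 0)) {0..1}"
    proof (rule fundamental_theorem_of_calculus)
      fix t :: real
      have 1: "((\<lambda>t. complex_of_real (t - 1/2)) has_vector_derivative 1) (at t within {0..1})"
        by (auto intro!: derivative_eq_intros simp: has_vector_derivative_def scaleR_conv_of_real)
      have 2: "(echar m has_vector_derivative w * echar m t) (at t within {0..1})"
        unfolding w_def by (rule echar_has_vector_derivative)
      have "(?G has_vector_derivative (of_real (t - 1/2) * (w * echar m t / w) + 1 * (echar m t / w)) - w * echar m t / w\<^sup>2) (at t within {0..1})"
        by (intro has_vector_derivative_diff has_vector_derivative_mult 1 has_vector_derivative_divide 2)
      moreover have "(of_real (t - 1/2) * (w * echar m t / w) + 1 * (echar m t / w)) - w * echar m t / w\<^sup>2 = echar m t * of_real (t - 1/2)"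
        using w by (simp add: field_simps power2_eq_square)
      ultimately show "(?G has_vector_derivative echar m t * of_real (t - 1/2)) (at t within {0..1})" by simp
    qed simp
    moreover have "?G 1 - ?G 0 = 1 / w" by (simp add: field_simps)
    ultimately show ?thesis unfolding circle_integral(2)[OF c] using False by (simp add: integral_unique w_def)
  qed
qed

lemma harmonic_sum_ge: "1 + real N / 2 \<le> (\<Sum>m=1..2 ^ N. 1 / real m)"
proof (induction N)
  case (Suc N)
  have "{1..2 ^ Suc N} = {1..2 ^ N} \<union> {2 ^ N<..2 ^ Suc N :: nat}" by auto
  then have e1: "(\<Sum>m=1..2 ^ Suc N. 1 / real m) = (\<Sum>m=1..2 ^ N. 1 / real m) + (\<Sum>m\<in>{2 ^ N<..2 ^ Suc N}. 1 / real m)"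
    by (simp only:) (rule sum.union_disjoint, auto)
  have e2: "(\<Sum>m\<in>{2 ^ N<..2 ^ Suc N :: nat}. 1 / real m) \<ge> (\<Sum>m\<in>{2 ^ N<..2 ^ Suc N :: nat}. 1 / 2 ^ Suc N)"
  proof (rule sum_mono)
    fix m :: nat assume m: "m \<in> {2 ^ N<..2 ^ Suc N}"
    then have "real m \<le> real (2 ^ Suc N)" by (intro of_nat_mono) auto
    then show "1 / 2 ^ Suc N \<le> 1 / real m" using m by (intro divide_left_mono) auto
  qed
  have e3: "(\<Sum>m\<in>{2 ^ N<..2 ^ Suc N :: nat}. 1 / 2 ^ Suc N :: real) = 1 / 2" by simp
  have e4: "real (Suc N) = real N + 1" by simp
  show ?case unfolding e1 e4 using e2[unfolded e3] Suc.IH by argo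
qed simp

text \<open>The shift by \<open>2 ^ N\<close> makes all frequencies positive. The factor
  \<open>1/4\<close> normalises: the kernel is at most \<open>2 ^ N\<close>, so its power
  \<open>p - 1\<close> is at most 4 when \<open>N * (p - 1) <= 2\<close>.\<close>

definition extremal1 :: "nat \<Rightarrow> real \<Rightarrow> complex" where
  "extremal1 N t = of_real (fejer (2 ^ N) t / 4) * echar (2 ^ N) t"

definition extremal :: "nat \<Rightarrow> nat \<Rightarrow> (nat \<Rightarrow> real) \<Rightarrow> complex" where
  "extremal N d x = (\<Prod>j<d. extremal1 N (x j))"

text \<open>The block with index \<open>N + 1\<close> starts at \<open>2 ^ N\<close>, the centre of
  the shifted spectrum, and so keeps the nonnegative half of the Fejer kernel.\<close>

definition extremal_block :: "nat \<Rightarrow> real \<Rightarrow> complex" where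
  "extremal_block N t = (\<Sum>l\<in>dyadic_block (int N + 1). of_real (fejer_weight (2 ^ N) (l - 2 ^ N) / 4) * echar l t)"

lemma measurable_extremal1 [measurable]: "extremal1 N \<in> borel_measurable circle"
  unfolding extremal1_def[abs_def]
  by (intro borel_measurable_times measurable_compose[OF _ borel_measurable_of_real] borel_measurable_divide measurable_fejer
      measurable_echar measurable_ident_circle borel_measurable_const)

lemma measurable_extremal_block [measurable]: "extremal_block N \<in> borel_measurable circle"
  unfolding extremal_block_def[abs_def]
  by (intro borel_measurable_sum borel_measurable_times measurable_echar measurable_ident_circle borel_measurable_const)

lemma fejer_le: "fejer N t \<le> real N"
proof (cases "N = 0")
  case False
  have "cmod (\<Sum>j<N. echar (int j) t) \<le> (\<Sum>j<N. 1)" by (rule order_trans[OF norm_sum]) simp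
  then have "(cmod (\<Sum>j<N. echar (int j) t))\<^sup>2 \<le> (real N)\<^sup>2" by (intro power_mono) auto
  then show ?thesis using False by (simp add: fejer_def divide_le_eq power2_eq_square)
qed (simp add: fejer_def)

lemma extremal1_norm:
  assumes p: "1 < p" "p < 2" and N: "real N * (p - 1) \<le> 2"
  shows "(\<integral>\<^sup>+t. ennreal (cmod (extremal1 N t) powr p) \<partial>circle) \<le> 1"
proof -
  have "cmod (extremal1 N t) powr p \<le> fejer (2 ^ N) t" for t
  proof (cases "fejer (2 ^ N) t = 0")
    case False
    then have f0: "fejer (2 ^ N) t > 0" using fejer_nonneg[of "2 ^ N" t] by linarith
    have "cmod (extremal1 N t) powr p = (fejer (2 ^ N) t) powr p * (1 / 4) powr p"
      using f0 by (simp add: extremal1_def norm_mult powr_divide)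
    also have "(fejer (2 ^ N) t) powr p = (fejer (2 ^ N) t) powr (p - 1) * fejer (2 ^ N) t"
      using f0 by (simp add: powr_diff)
    also have "\<dots> * (1 / 4) powr p \<le> (4 * fejer (2 ^ N) t) * (1 / 4) powr 1"
    proof (intro mult_mono)
      have "(fejer (2 ^ N) t) powr (p - 1) \<le> (2 ^ N) powr (p - 1)"
        using fejer_le[of "2 ^ N" t] f0 p by (intro powr_mono2) auto
      also have "\<dots> = 2 powr (real N * (p - 1))" by (simp add: powr_powr flip: powr_realpow)
      also have "\<dots> \<le> 2 powr 2" using N by (intro powr_mono) auto
      finally show "(fejer (2 ^ N) t) powr (p - 1) \<le> 4" by simp
      show "(1 / 4) powr p \<le> (1 / 4 :: real) powr 1" using p by (intro powr_mono') auto
    qed (use f0 in auto)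
    finally show ?thesis by simp
  qed (simp add: extremal1_def)
  then have "(\<integral>\<^sup>+t. ennreal (cmod (extremal1 N t) powr p) \<partial>circle) \<le> (\<integral>\<^sup>+t. ennreal (fejer (2 ^ N) (0 - t)) \<partial>circle)"
    by (intro nn_integral_mono ennreal_leI) (simp add: fejer_minus)
  also have "\<dots> = 1" by (rule fejer_integral) simp
  finally show ?thesis .
qed

lemma extremal1_coeff: "(\<integral>t. extremal1 N t * cnj (echar m t) \<partial>circle) = of_real (fejer_weight (2 ^ N) (m - 2 ^ N) / 4)"
proof -
  let ?M = "2 ^ N :: nat"
  have M: "?M > 0" by simp
  have "extremal1 N t * cnj (echar m t) = (\<Sum>n\<in>{- int ?M<..<int ?M}. of_real (fejer_weight ?M n / 4) * (echar (n + 2 ^ N) t * cnj (echar m t)))" for t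
    unfolding extremal1_def of_real_divide fejer_eq[OF M] sum_divide_distrib sum_distrib_right
    by (intro sum.cong refl) (simp add: echar_add[symmetric] mult_ac)
  then have "(\<integral>t. extremal1 N t * cnj (echar m t) \<partial>circle) = (\<Sum>n\<in>{- int ?M<..<int ?M}. of_real (fejer_weight ?M n / 4) * (\<integral>t. echar (n + 2 ^ N) t * cnj (echar m t) \<partial>circle))"
    by (simp only:, subst Bochner_Integration.integral_sum)
      (auto intro!: integrable_mult_right circle_integral continuous_intros)
  also have "\<dots> = (\<Sum>n\<in>{- int ?M<..<int ?M}. if n = m - 2 ^ N then of_real (fejer_weight ?M (m - 2 ^ N) / 4) else 0)"
    unfolding circle_integral_echar_mult by (intro sum.cong) auto
  also have "\<dots> = of_real (fejer_weight ?M (m - 2 ^ N) / 4)"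
    by (auto simp: fejer_weight_def)
  finally show ?thesis .
qed

lemma extremal_coeff:
  "fourier_coeff d (extremal N d) n = (\<Prod>j<d. of_real (fejer_weight (2 ^ N) (n j - 2 ^ N) / 4))"
proof -
  have "integrable circle (\<lambda>t. extremal1 N t * cnj (echar m t))" for m
    unfolding extremal1_def fejer_def by (intro circle_integral continuous_intros) auto
  then have "(\<integral>x. (\<Prod>j\<in>{..<d}. extremal1 N (x j) * cnj (echar (n j) (x j))) \<partial>torus d) = (\<Prod>j\<in>{..<d}. (\<integral>t. extremal1 N t * cnj (echar (n j) t) \<partial>circle))"
    unfolding torus_def by (intro pc.product_integral_prod) auto
  then show ?thesis
    by (simp add: fourier_coeff_echar_d extremal_def echar_d_def prod.distrib extremal1_coeff)
qed

lemma extremal_analytic: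
  assumes p: "1 < p" "p < 2" and N: "real N * (p - 1) \<le> 2"
  shows "extremal N d \<in> analytic_Hardy d p" "cLp_norm (torus d) p (extremal N d) \<le> 1"
proof -
  have m: "extremal N d \<in> borel_measurable (torus d)"
    unfolding extremal_def[abs_def] torus_def
    by (intro borel_measurable_prod measurable_compose[OF measurable_component_singleton[of _ "{..<d}" "\<lambda>_. circle"] measurable_extremal1]) auto
  have "(\<integral>\<^sup>+x. epowr (ennreal (cmod (extremal N d x))) p \<partial>torus d) = (\<integral>\<^sup>+x. (\<Prod>j\<in>{..<d}. ennreal (cmod (extremal1 N (x j)) powr p)) \<partial>torus d)"
    by (simp add: epowr_ennreal extremal_def prod_norm[symmetric] prod_powr_distrib prod_ennreal prod_nonneg)
  also have "\<dots> = (\<Prod>j\<in>{..<d}. (\<integral>\<^sup>+t. ennreal (cmod (extremal1 N t) powr p) \<partial>circle))"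
    unfolding torus_def by (rule pc.product_nn_integral_prod) auto
  also have "\<dots> \<le> 1" using extremal1_norm[OF p N] by (simp add: power_le_one)
  finally have "epowr (\<integral>\<^sup>+x. epowr (ennreal (cmod (extremal N d x))) p \<partial>torus d) (1 / p) \<le> epowr (ennreal 1) (1 / p)"
    using p by (intro epowr_mono) auto
  then show n: "cLp_norm (torus d) p (extremal N d) \<le> 1"
    by (subst (asm) epowr_ennreal) (auto simp: Lp_norm_def)
  have "n j \<ge> 0" if n: "n \<in> fourier_support d (extremal N d)" "j < d" for n j
  proof (rule ccontr)
    assume "\<not> n j \<ge> 0"
    moreover have "(0::int) < 2 ^ N" by simp
    ultimately have "\<not> \<bar>n j - 2 ^ N\<bar> < (2::int) ^ N" by linarith
    then have "fejer_weight (2 ^ N) (n j - 2 ^ N) = 0" by (simp add: fejer_weight_def)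
    then have "(\<Prod>j<d. complex_of_real (fejer_weight (2 ^ N) (n j - 2 ^ N) / 4)) = 0"
      using that(2) by (intro prod_zero) auto
    then show False using n(1) by (simp add: fourier_support_def extremal_coeff)
  qed
  moreover have "cLp_norm (torus d) p (extremal N d) < top" using n by (rule order_le_less_trans) simp
  ultimately show "extremal N d \<in> analytic_Hardy d p"
    using m by (auto simp: analytic_Hardy_def Lp_space_def)
qed

text \<open>A single term of the square function is kept, with all indices equal to
  \<open>N + 1\<close>; the projection of a tensor product factorises.\<close>

lemma LP_square_extremal_ge:
  assumes p: "1 < p" "p < 2" and N: "real N * (p - 1) \<le> 2" and x: "x \<in> space (torus d)"
  shows "LP_square d (extremal N d) x \<ge> ennreal (\<Prod>j<d. cmod (extremal_block N (x j)))"
proof -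
  define k where "k = (\<lambda>j\<in>{..<d}. int N + 1)"
  have k: "k \<in> freqs d" by (simp add: k_def freqs_def)
  have int: "integrable (torus d) (extremal N d)"
    using analytic_Hardy_integrable(2)[of "extremal N d" d p] extremal_analytic[OF p N, of d] p by (simp add: analytic_Hardy_def)
  let ?g = "\<lambda>k. ennreal ((cmod (LP_proj_tensor d k (extremal N d) x))\<^sup>2)"
  have "LP_proj_tensor d k (extremal N d) x = (\<Sum>n\<in>PiE {..<d} (\<lambda>j. dyadic_block (k j)). \<Prod>j<d. of_real (fejer_weight (2 ^ N) (n j - 2 ^ N) / 4) * echar (n j) (x j))"
    unfolding LP_proj_tensor_eq[OF int x] extremal_coeff echar_d_def prod.distrib ..
  also have "\<dots> = (\<Prod>j<d. \<Sum>l\<in>dyadic_block (k j). of_real (fejer_weight (2 ^ N) (l - 2 ^ N) / 4) * echar l (x j))"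
    by (rule prod_sum_PiE[symmetric]) auto
  also have "\<dots> = (\<Prod>j<d. extremal_block N (x j))" by (intro prod.cong) (auto simp: extremal_block_def k_def)
  finally have eq: "?g k = ennreal ((\<Prod>j<d. cmod (extremal_block N (x j)))\<^sup>2)" by (simp add: prod_norm)
  have "sum ?g {k} \<le> (\<Sum>\<^sub>\<infinity>k\<in>freqs d. ?g k)"
    by (subst nonneg_infsum_complete, simp, rule SUP_upper) (use k in auto)
  then have "epowr (ennreal ((\<Prod>j<d. cmod (extremal_block N (x j)))\<^sup>2)) (1 / 2) \<le> LP_square d (extremal N d) x"
    unfolding LP_square_def by (intro epowr_mono) (simp_all add: eq)
  moreover have "epowr (ennreal ((\<Prod>j<d. cmod (extremal_block N (x j)))\<^sup>2)) (1 / 2) = ennreal (\<Prod>j<d. cmod (extremal_block N (x j)))"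
    by (simp add: epowr_ennreal powr_half_sqrt prod_nonneg)
  ultimately show ?thesis by simp
qed

text \<open>Sawtooth coefficients and the factor \<open>1/4\<close> give \<open>1 / (8 * pi)\<close>
  times the harmonic sum minus 1, which is at least \<open>N / 2\<close>. The sawtooth is bounded by
  \<open>1/2\<close>, so the two halves cancel.\<close>

lemma extremal_block_L1: "real N / (8 * pi) \<le> (\<integral>t. cmod (extremal_block N t) \<partial>circle)"
proof -
  let ?M = "2 ^ N :: nat"
  have ce: "continuous_on {0..1} (extremal_block N)" unfolding extremal_block_def[abs_def] by (intro continuous_intros)
  have nat_block: "dyadic_block (int N + 1) = (\<lambda>m. int m + 2 ^ N) ` {..<?M}"
  proof -
    have "dyadic_block (int N + 1) = {2 ^ N..2 * 2 ^ N - 1}"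
      by (simp add: dyadic_block_def nat_add_distrib)
    also have "\<dots> = (\<lambda>m. int m + 2 ^ N) ` {..<?M}"
    proof (rule set_eqI)
      fix l :: int
      show "l \<in> {2 ^ N..2 * 2 ^ N - 1} \<longleftrightarrow> l \<in> (\<lambda>m. int m + 2 ^ N) ` {..<?M}"
      proof
        assume l: "l \<in> {2 ^ N..2 * 2 ^ N - 1}"
        then have "nat (l - 2 ^ N) < ?M" by (simp add: nat_less_iff)
        moreover have "l = int (nat (l - 2 ^ N)) + 2 ^ N" using l by simp
        ultimately show "l \<in> (\<lambda>m. int m + 2 ^ N) ` {..<?M}" by blast
      next
        assume "l \<in> (\<lambda>m. int m + 2 ^ N) ` {..<?M}"
        then obtain m where m: "m < ?M" "l = int m + 2 ^ N" by auto
        have "int m < int ?M" using m(1) by (simp only: of_nat_less_iff)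
        then show "l \<in> {2 ^ N..2 * 2 ^ N - 1}" using m(2) by simp
      qed
    qed
    finally show ?thesis .
  qed
  have eg: "extremal_block N t = (\<Sum>m<?M. of_real (fejer_weight ?M (int m) / 4) * echar (int m + 2 ^ N) t)" for t
    unfolding extremal_block_def nat_block by (subst sum.reindex) (auto simp: inj_on_def)
  have "(\<integral>t. extremal_block N t * (cnj (echar (2 ^ N) t) * of_real (t - 1/2)) \<partial>circle) =
     (\<integral>t. (\<Sum>m<?M. of_real (fejer_weight ?M (int m) / 4) * (echar (int m) t * of_real (t - 1/2))) \<partial>circle)"
  proof (rule Bochner_Integration.integral_cong[OF refl])
    fix t
    have "echar (int m + 2 ^ N) t * cnj (echar (2 ^ N) t) = echar (int m) t" for m
      unfolding echar_minus[symmetric] echar_add by simp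
    then show "extremal_block N t * (cnj (echar (2 ^ N) t) * of_real (t - 1/2)) = (\<Sum>m<?M. of_real (fejer_weight ?M (int m) / 4) * (echar (int m) t * of_real (t - 1/2)))"
      unfolding eg sum_distrib_right by (intro sum.cong refl) (metis (no_types, lifting) mult.assoc)
  qed
  also have "\<dots> = (\<Sum>m<?M. of_real (fejer_weight ?M (int m) / 4) * (\<integral>t. echar (int m) t * of_real (t - 1/2) \<partial>circle))"
    by (subst Bochner_Integration.integral_sum) (auto intro!: integrable_mult_right circle_integral continuous_intros)
  also have "\<dots> = (\<Sum>m<?M. of_real (if m = 0 then 0 else (1 / real m - 1 / real ?M)) * (1 / (8 * pi * \<i>)))"
    unfolding circle_integral_echar_sawtooth
    by (intro sum.cong refl) (auto simp: fejer_weight_def field_simps)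
  also have "\<dots> = of_real (\<Sum>m<?M. if m = 0 then 0 else (1 / real m - 1 / real ?M)) * (1 / (8 * pi * \<i>))"
    by (simp only: sum_distrib_right of_real_sum)
  \<comment> \<open>The term with \<open>m = 2 ^ N\<close> is 0 and may be included; the subtracted
    fractions then add up to 1.\<close>
  also have "(\<Sum>m<?M. if m = 0 then 0 else (1 / real m - 1 / real ?M)) = (\<Sum>m=1..?M. 1 / real m) - 1"
  proof -
    have "(\<Sum>m<?M. if m = 0 then 0 else (1 / real m - 1 / real ?M)) = (\<Sum>m\<in>{1..?M}. (1 / real m - 1 / real ?M))"
      by (rule sum.mono_neutral_cong) auto
    then show ?thesis by (simp add: sum_subtractf)
  qed
  finally have eq: "(\<integral>t. extremal_block N t * (cnj (echar (2 ^ N) t) * of_real (t - 1/2)) \<partial>circle) = of_real ((\<Sum>m=1..?M. 1 / real m) - 1) * (1 / (8 * pi * \<i>))" .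
  have "real N / 2 / (8 * pi) \<le> ((\<Sum>m=1..?M. 1 / real m) - 1) / (8 * pi)"
    using harmonic_sum_ge[of N] by (intro divide_right_mono) auto
  also have "\<dots> = cmod (\<integral>t. extremal_block N t * (cnj (echar (2 ^ N) t) * of_real (t - 1/2)) \<partial>circle)"
  proof -
    have "(\<Sum>m=1..?M. 1 / real m) - 1 \<ge> 0" using harmonic_sum_ge[of N] by (smt (verit) divide_nonneg_nonneg of_nat_0_le_iff)
    then show ?thesis unfolding eq norm_mult norm_of_real by (simp add: norm_divide norm_mult)
  qed
  also have "\<dots> \<le> (\<integral>t. cmod (extremal_block N t) * (1 / 2) \<partial>circle)"
  proof (rule order_trans[OF integral_norm_bound integral_mono])
    show "integrable circle (\<lambda>t. cmod (extremal_block N t * (cnj (echar (2 ^ N) t) * of_real (t - 1/2))))"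
      "integrable circle (\<lambda>t. cmod (extremal_block N t) * (1 / 2))"
      by (intro circle_integral continuous_intros ce)+
    fix t assume "t \<in> space circle"
    then have "\<bar>t - 1/2\<bar> \<le> 1/2" unfolding abs_le_iff space_circle atLeastLessThan_iff by argo
    then show "cmod (extremal_block N t * (cnj (echar (2 ^ N) t) * of_real (t - 1/2))) \<le> cmod (extremal_block N t) * (1 / 2)"
      unfolding norm_mult norm_of_real complex_mod_cnj norm_echar by (intro mult_left_mono) simp_all
  qed
  finally show ?thesis by simp
qed

text \<open>On a probability space the \<open>L^1\<close> bound passes to \<open>L^p\<close>:
  integrate the tangent inequality at \<open>B\<close>.\<close>

lemma extremal_block_Lp:
  assumes p: "1 < p" and B: "0 < B" "B \<le> (\<integral>t. cmod (extremal_block N t) \<partial>circle)"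
  shows "ennreal (B powr p) \<le> (\<integral>\<^sup>+t. ennreal (cmod (extremal_block N t) powr p) \<partial>circle)"
proof -
  have ce: "continuous_on {0..1} (extremal_block N)" unfolding extremal_block_def[abs_def] by (intro continuous_intros)
  have i1: "integrable circle (\<lambda>t. cmod (extremal_block N t))" by (intro circle_integral continuous_intros ce)
  have i2: "integrable circle (\<lambda>t. cmod (extremal_block N t) powr p)"
    using p by (intro circle_integral continuous_on_powr' continuous_intros ce) auto
  have "p * B powr (p - 1) * B \<le> p * B powr (p - 1) * (\<integral>t. cmod (extremal_block N t) \<partial>circle)"
    using p B by (intro mult_left_mono) auto
  also have "\<dots> = (\<integral>t. p * B powr (p - 1) * cmod (extremal_block N t) \<partial>circle)" by simp
  also have "\<dots> \<le> (\<integral>t. cmod (extremal_block N t) powr p + (p - 1) * B powr p \<partial>circle)"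
    using p B by (intro integral_mono tangent_powr integrable_mult_right i1 Bochner_Integration.integrable_add i2) auto
  also have "\<dots> = (\<integral>t. cmod (extremal_block N t) powr p \<partial>circle) + (p - 1) * B powr p"
    using i2 by simp
  finally have "p * B powr p \<le> (\<integral>t. cmod (extremal_block N t) powr p \<partial>circle) + (p - 1) * B powr p"
    using B by (simp add: powr_diff)
  then have "B powr p \<le> (\<integral>t. cmod (extremal_block N t) powr p \<partial>circle)" by (simp add: algebra_simps)
  then show ?thesis using i2 by (subst nn_integral_eq_integral) (auto intro: ennreal_leI)
qed

theorem LP_square_lower_bound:
  assumes p: "1 < p" "p < 2"
  shows "\<exists>f\<in>analytic_Hardy d p. cLp_norm (torus d) p f \<le> 1 \<and>
    ennreal ((1 / (8 * pi)) ^ d * (p - 1) powi (- int d)) \<le> Lp_norm (torus d) p (LP_square d f)"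
proof -
  \<comment> \<open>Rounding up gives \<open>N >= 1 / (p - 1)\<close> for the size of the block,
    while \<open>N * (p - 1) <= 1 + (p - 1) <= 2\<close> keeps the norm of the extremal function at
    most 1.\<close>
  define N where "N = nat \<lceil>1 / (p - 1)\<rceil>"
  have "1 / (p - 1) > 0" using p by simp
  then have N1: "1 / (p - 1) \<le> real N" "real N \<le> 1 / (p - 1) + 1" unfolding N_def by linarith+
  have "real N * (p - 1) \<le> (1 / (p - 1) + 1) * (p - 1)" using N1 p by (intro mult_right_mono) auto
  also have "\<dots> = 1 + (p - 1)" using p by (simp add: field_simps)
  finally have N: "real N * (p - 1) \<le> 2" using p by simp
  define B where "B = 1 / (8 * pi * (p - 1))"
  have B: "B > 0" using p by (simp add: B_def)
  have "B = (1 / (p - 1)) / (8 * pi)" by (simp add: B_def)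
  also have "\<dots> \<le> real N / (8 * pi)" using N1 by (intro divide_right_mono) auto
  also have "\<dots> \<le> (\<integral>t. cmod (extremal_block N t) \<partial>circle)" by (rule extremal_block_L1)
  finally have BL: "B \<le> (\<integral>t. cmod (extremal_block N t) \<partial>circle)" .
  have "ennreal ((B ^ d) powr p) = (\<Prod>j\<in>{..<d}. ennreal (B powr p))"
    using B by (simp add: prod_constant ennreal_power powr_powr mult.commute flip: powr_realpow)
  also have "\<dots> \<le> (\<Prod>j\<in>{..<d}. (\<integral>\<^sup>+t. ennreal (cmod (extremal_block N t) powr p) \<partial>circle))"
    using extremal_block_Lp[OF p(1) B BL] by (simp add: power_mono)
  also have "\<dots> = (\<integral>\<^sup>+x. (\<Prod>j\<in>{..<d}. ennreal (cmod (extremal_block N (x j)) powr p)) \<partial>torus d)"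
    unfolding torus_def by (rule pc.product_nn_integral_prod[symmetric]) auto
  also have "\<dots> = (\<integral>\<^sup>+x. epowr (ennreal (\<Prod>j<d. cmod (extremal_block N (x j)))) p \<partial>torus d)"
    by (simp add: epowr_ennreal prod_nonneg prod_powr_distrib prod_ennreal)
  also have "\<dots> \<le> (\<integral>\<^sup>+x. epowr (LP_square d (extremal N d) x) p \<partial>torus d)"
    using p by (intro nn_integral_mono epowr_mono LP_square_extremal_ge[OF p N]) auto
  finally have "epowr (ennreal ((B ^ d) powr p)) (1 / p) \<le> Lp_norm (torus d) p (LP_square d (extremal N d))"
    unfolding Lp_norm_def using p by (intro epowr_mono) auto
  moreover have "epowr (ennreal ((B ^ d) powr p)) (1 / p) = ennreal (B ^ d)"
    using p B by (simp add: epowr_ennreal powr_powr)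
  ultimately have le: "ennreal (B ^ d) \<le> Lp_norm (torus d) p (LP_square d (extremal N d))" by (simp only:)
  have eq: "B ^ d = (1 / (8 * pi)) ^ d * (p - 1) powi (- int d)"
  proof -
    have "B = (1 / (8 * pi)) * inverse (p - 1)"
      unfolding B_def by (simp only: divide_inverse mult_1_left inverse_mult_distrib)
    moreover have "(p - 1) powi (- int d) = inverse (p - 1) ^ d" by (simp add: power_int_minus power_inverse)
    ultimately show ?thesis by (simp only: power_mult_distrib)
  qed
  show ?thesis
    by (rule bexI[OF _ extremal_analytic(1)[OF p N, of d]], rule conjI[OF extremal_analytic(2)[OF p N, of d]], rule le[unfolded eq])
qed

theorem corollary2:
  fixes d :: nat
  assumes "d \<ge> 1"
  shows "\<exists>(p0::real) (c::real) (C::real). 1 < p0 \<and> 0 < c \<and> c \<le> C \<and>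
    (\<forall>p. 1 < p \<and> p < p0 \<longrightarrow>
      ennreal (c * (p - 1) powi (- int d))
        \<le> (SUP f\<in>{f \<in> analytic_Hardy d p. cLp_norm (torus d) p f \<le> 1}.
             Lp_norm (torus d) p (LP_square d f)) \<and>
      (SUP f\<in>{f \<in> analytic_Hardy d p. cLp_norm (torus d) p f \<le> 1}.
         Lp_norm (torus d) p (LP_square d f))
        \<le> ennreal (C * (p - 1) powi (- int d)))"
proof (intro exI conjI allI impI)
  show "1 < (2::real)" "0 < (1 / (8 * pi)) ^ d" by simp_all
  have "1 / (8 * pi) \<le> 50000" using pi_gt3 by (simp add: field_simps)
  then show "(1 / (8 * pi)) ^ d \<le> (50000::real) ^ d" by (intro power_mono) auto
next
  fix p :: real assume "1 < p \<and> p < 2"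
  then have p: "1 < p" "p < 2" by auto
  obtain f where f: "f \<in> analytic_Hardy d p" "cLp_norm (torus d) p f \<le> 1"
    "ennreal ((1 / (8 * pi)) ^ d * (p - 1) powi (- int d)) \<le> Lp_norm (torus d) p (LP_square d f)"
    using LP_square_lower_bound[OF p] by blast
  then show "ennreal ((1 / (8 * pi)) ^ d * (p - 1) powi (- int d)) \<le> (SUP f\<in>{f \<in> analytic_Hardy d p. cLp_norm (torus d) p f \<le> 1}. Lp_norm (torus d) p (LP_square d f))"
    by (intro SUP_upper2[of f]) auto
  show "(SUP f\<in>{f \<in> analytic_Hardy d p. cLp_norm (torus d) p f \<le> 1}. Lp_norm (torus d) p (LP_square d f))
      \<le> ennreal (50000 ^ d * (p - 1) powi (- int d))"
    by (intro SUP_least LP_square_upper_bound p) auto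
qed

end
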